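(* Let $(M,\omega)$ be a symplectic manifold, $P\subset TM$ a real polarization, $\Phi:M\to M$ a symplectomorphism, and $(L,\nabla)\to M$ a prequantum line bundle. Let $\underline{\mathbb{C}}_M^\times$ be the sheaf of locally constant, non-vanishing complex-valued functions on $M$. If $\check{H}^1(M,\underline{\mathbb{C}}_M^\times)=0$, then $\Phi$ induces an isomorphism between the Bohr-Sommerfeld quantizations $$Q_{BS}(M,P,\nabla)\to Q_{BS}(M,\Phi^*P,\nabla).$$
   Context: Prequantum line bundle: a complex Hermitian line bundle $L\to M$ with a compatible connection (covariant derivative) $\nabla$ such that $curv(\nabla)=\omega$. Curvature convention: if $s$ is a non-vanishing local section and $\nabla s=i\alpha\otimes s$, then $curv(\nabla)=d\alpha$. Polarization: a (singular, real) polarization of $(M,\omega)$ is a smooth singular subbundle $P\subset TM$, i.e. a family of linear subspaces $P_x\subset T_xM$, possibly of varying dimension, such that each vector of $P_x$ is the value at $x$ of a smooth local section of $P$, whose sheaf of sections $\mathfrak{F}_P$ (smooth vector fields $X$ on $U$ with $X_x\in P_x$ for all $x \in U$) satisfies: (i) if $X,Y\in\mathfrak{F}_P$ then $[X,Y]\in\mathfrak{F}_P$; (ii) each $x\in M$ has an open neighbourhood $U$ and $X_1,\dots,X_k\in\mathfrak{F}_P(U)$ with $\mathfrak{F}_P(U)=\mathrm{span}_{C^\infty(U)}\{X_1,\dots,X_k\}$; (iii) there is an open dense subset $U\subset M$ such that $P_x\subset T_xM$ is Lagrangian for all $x\in U$. Pulled-back polarization: $(\Phi^*P)_x:=d_{\Phi(x)}\Phi^{-1}(P_{\Phi(x)})$;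 it is again a polarization. Leaves: a polarization $P$ decomposes $M$ into disjoint immersed submanifolds $\iota:B\to M$, its leaves, which are the maximal (connected) integral submanifolds of $P$, where integral means $\iota_*(T_xB)=P_{\iota(x)}$ for all $x\in B$. For a leaf $\iota:B\to M$ of $P$, $\Phi^*B$ denotes the leaf $\Phi^{-1}\circ\iota:B\to M$ of $\Phi^*P$. Bohr-Sommerfeld quantization: for a leaf $\iota:B\to M$ and $U\subset B$ open, $\mathscr{S}_{(P,\nabla)}|_B(U)=\{s\in\Gamma(U,\iota^*L)\mid (\iota^*\nabla)_Xs=0\ \text{for all vector fields } X \text{ on } U\}$. The leaf $B$ is Bohr-Sommerfeld if $H^0(B,\mathscr{S}_{(P,\nabla)}|_B)\neq0$; $BS(P)$ is the set of Bohr-Sommerfeld leaves of $P$; and $Q_{BS}(M,P,\nabla)=\bigoplus_{B\in BS(P)}H^0(B,\mathscr{S}_{(P,\nabla)}|_B)$. Lifts: a lift of $\Phi$ is a diffeomorphism $F:L\to L$ covering $\Phi$ (i.e. $\pi\circ F=\Phi\circ\pi$, where $\pi:L\to M$ is the projection) and restricting to linear isomorphisms $F_x:L_x\to L_{\Phi(x)}$. For $t\in\Gamma(\Phi^{-1}(U),L)$ put $(F_*t)(x)=F_{\Phi^{-1}(x)}(t(\Phi^{-1}(x)))$, and let $F^*\nabla$ be the connection determined by $F_*((F^*\nabla)_Xt)=\nabla_{\Phi_*X}(F_*t)$. Meaning of "$\Phi$ induces an isomorphism": there is a lift $F$ of $\Phi$ with $F^*\nabla=\nabla$ such that the isomorphism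 (of complex vector spaces) sends the summand of $B\in BS(P)$ to that of $\Phi^*B\in BS(\Phi^*P)$ by applying $F^{-1}$ fibrewise to sections, i.e. $s\in\Gamma(B,\iota^*L)$ is sent to the section of $(\Phi^{-1}\circ\iota)^*L$ whose value at $x\in B$ is $F^{-1}(s(x))\in L_{\Phi^{-1}(\iota(x))}$. *)

theory Defs
  imports "HOL-Analysis.Analysis"
begin

section \<open>Smooth maps between subsets of normed spaces\<close>

primrec Ck_on :: "nat \<Rightarrow> 'a::real_normed_vector set \<Rightarrow> ('a \<Rightarrow> 'b::real_normed_vector) \<Rightarrow> bool" where
  "Ck_on 0 W f \<longleftrightarrow> continuous_on W f"
| "Ck_on (Suc k) W f \<longleftrightarrow>
     (\<forall>x\<in>W. f differentiable (at x)) \<and>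
     (\<forall>v. Ck_on k W (\<lambda>x. frechet_derivative f (at x) v))"

text \<open>Manifolds are modelled on open subsets of linear subspaces of a fixed Euclidean space.
  Such a set need not be open in the ambient space, so smoothness on it means local extendability
  to a smooth map on an ambient open set; on open subsets of a subspace this is the usual notion.\<close>

definition smooth_on :: "'a::real_normed_vector set \<Rightarrow> ('a \<Rightarrow> 'b::real_normed_vector) \<Rightarrow> bool" where
  "smooth_on D f \<longleftrightarrow>
     (\<forall>x\<in>D. \<exists>W g. open W \<and> x \<in> W \<and> (\<forall>k. Ck_on k W g) \<and> (\<forall>y\<in>W \<inter> D. g y = f y))"

definition dir_deriv :: "('a::real_normed_vector \<Rightarrow> 'b::real_normed_vector) \<Rightarrow> 'a \<Rightarrow> 'a \<Rightarrow> 'b" where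
  "dir_deriv f p v = vector_derivative (\<lambda>t. f (p + t *\<^sub>R v)) (at 0)"


section \<open>Smooth manifolds\<close>

text \<open>A chart takes values in the linear subspace \<open>cspace\<close> of the ambient type, so that manifolds of
  different dimensions, in particular the leaves of a singular foliation, have the same type.
  Charts are \<open>undefined\<close> outside their domain, which makes the maximal atlas of a manifold unique.\<close>

record ('a, 'e) chart =
  cdom :: "'a set"
  cmap :: "'a \<Rightarrow> 'e"
  cspace :: "'e set"

record ('a, 'e) mfd =
  mtop :: "'a topology"
  atlas :: "('a, 'e) chart set"

abbreviation pts :: "('a, 'e) mfd \<Rightarrow> 'a set" where
  "pts M \<equiv> topspace (mtop M)"

definition cinv :: "('a, 'e) chart \<Rightarrow> 'e \<Rightarrow> 'a" where
  "cinv \<kappa> = inv_into (cdom \<kappa>) (cmap \<kappa>)"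

definition chart_on :: "nat \<Rightarrow> 'a topology \<Rightarrow> ('a, 'e::euclidean_space) chart \<Rightarrow> bool" where
  "chart_on d X \<kappa> \<longleftrightarrow>
     openin X (cdom \<kappa>) \<and> cmap \<kappa> \<in> extensional (cdom \<kappa>) \<and>
     subspace (cspace \<kappa>) \<and> dim (cspace \<kappa>) = d \<and>
     openin (top_of_set (cspace \<kappa>)) (cmap \<kappa> ` cdom \<kappa>) \<and>
     homeomorphic_map (subtopology X (cdom \<kappa>)) (top_of_set (cmap \<kappa> ` cdom \<kappa>)) (cmap \<kappa>)"

definition charts_compatible ::
  "('a, 'e::euclidean_space) chart \<Rightarrow> ('a, 'e) chart \<Rightarrow> bool" where
  "charts_compatible \<kappa> \<kappa>' \<longleftrightarrow>
     smooth_on (cmap \<kappa> ` (cdom \<kappa> \<inter> cdom \<kappa>')) (cmap \<kappa>' \<circ> cinv \<kappa>) \<and>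
     smooth_on (cmap \<kappa>' ` (cdom \<kappa> \<inter> cdom \<kappa>')) (cmap \<kappa> \<circ> cinv \<kappa>')"

definition smooth_manifold :: "nat \<Rightarrow> ('a, 'e::euclidean_space) mfd \<Rightarrow> bool" where
  "smooth_manifold d M \<longleftrightarrow>
     Hausdorff_space (mtop M) \<and> second_countable (mtop M) \<and>
     (\<forall>\<kappa>\<in>atlas M. chart_on d (mtop M) \<kappa>) \<and>
     (\<forall>\<kappa>\<in>atlas M. \<forall>\<kappa>'\<in>atlas M. charts_compatible \<kappa> \<kappa>') \<and>
     pts M = (\<Union>\<kappa>\<in>atlas M. cdom \<kappa>) \<and>
     (\<forall>\<kappa>. chart_on d (mtop M) \<kappa> \<and> (\<forall>\<kappa>'\<in>atlas M. charts_compatible \<kappa> \<kappa>') \<longrightarrow> \<kappa> \<in> atlas M)"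

definition charts_at :: "('a, 'e) mfd \<Rightarrow> 'a \<Rightarrow> ('a, 'e) chart set" where
  "charts_at M x = {\<kappa> \<in> atlas M. x \<in> cdom \<kappa>}"

definition smooth_map_on ::
  "('a, 'e::euclidean_space) mfd \<Rightarrow> 'a set \<Rightarrow> ('b, 'f::euclidean_space) mfd \<Rightarrow> ('a \<Rightarrow> 'b) \<Rightarrow> bool" where
  "smooth_map_on M U N f \<longleftrightarrow>
     continuous_map (subtopology (mtop M) U) (mtop N) f \<and>
     (\<forall>\<kappa>\<in>atlas M. \<forall>\<mu>\<in>atlas N.
        smooth_on (cmap \<kappa> ` (U \<inter> cdom \<kappa> \<inter> f -` cdom \<mu>)) (cmap \<mu> \<circ> f \<circ> cinv \<kappa>))"

definition smooth_fun_on ::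
  "('a, 'e::euclidean_space) mfd \<Rightarrow> 'a set \<Rightarrow> ('a \<Rightarrow> 'b::real_normed_vector) \<Rightarrow> bool" where
  "smooth_fun_on M U f \<longleftrightarrow> (\<forall>\<kappa>\<in>atlas M. smooth_on (cmap \<kappa> ` (U \<inter> cdom \<kappa>)) (f \<circ> cinv \<kappa>))"

definition inv_on :: "('a, 'e) mfd \<Rightarrow> ('a \<Rightarrow> 'b) \<Rightarrow> 'b \<Rightarrow> 'a" where
  "inv_on M f = inv_into (pts M) f"

definition diffeomorphism :: "('a, 'e::euclidean_space) mfd \<Rightarrow> ('b, 'f::euclidean_space) mfd \<Rightarrow> ('a \<Rightarrow> 'b) \<Rightarrow> bool" where
  "diffeomorphism M N f \<longleftrightarrow>
     bij_betw f (pts M) (pts N) \<and>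
     smooth_map_on M (pts M) N f \<and> smooth_map_on N (pts N) M (inv_on M f)"


section \<open>Tangent vectors and vector fields\<close>

text \<open>A tangent vector at \<open>x\<close> is given by its components in all charts around \<open>x\<close>, subject to the
  transformation rule; it is zero on all other charts.\<close>

type_synonym ('a, 'e) tvec = "('a, 'e) chart \<Rightarrow> 'e"

definition tangent_space :: "('a, 'e::euclidean_space) mfd \<Rightarrow> 'a \<Rightarrow> ('a, 'e) tvec set" where
  "tangent_space M x =
     {v. (\<forall>\<kappa>. \<kappa> \<notin> charts_at M x \<longrightarrow> v \<kappa> = 0) \<and>
         (\<forall>\<kappa>\<in>charts_at M x. v \<kappa> \<in> cspace \<kappa>) \<and>
         (\<forall>\<kappa>\<in>charts_at M x. \<forall>\<kappa>'\<in>charts_at M x.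
            v \<kappa>' = dir_deriv (cmap \<kappa>' \<circ> cinv \<kappa>) (cmap \<kappa> x) (v \<kappa>))}"

definition tv_zero :: "('a, 'e::real_vector) tvec" where
  "tv_zero = (\<lambda>\<kappa>. 0)"

definition tv_add :: "('a, 'e::real_vector) tvec \<Rightarrow> ('a, 'e) tvec \<Rightarrow> ('a, 'e) tvec" where
  "tv_add v w = (\<lambda>\<kappa>. v \<kappa> + w \<kappa>)"

definition tv_scale :: "real \<Rightarrow> ('a, 'e::real_vector) tvec \<Rightarrow> ('a, 'e) tvec" where
  "tv_scale r v = (\<lambda>\<kappa>. r *\<^sub>R v \<kappa>)"

text \<open>The choice of the chart in the next two definitions is immaterial by the transformation rule.\<close>

definition tangent_map ::
  "('a, 'e::euclidean_space) mfd \<Rightarrow> ('b, 'f::euclidean_space) mfd \<Rightarrow> ('a \<Rightarrow> 'b) \<Rightarrow> 'a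
     \<Rightarrow> ('a, 'e) tvec \<Rightarrow> ('b, 'f) tvec" where
  "tangent_map M N f x v = (\<lambda>\<mu>.
     if \<mu> \<in> charts_at N (f x)
     then let \<kappa> = (SOME \<kappa>. \<kappa> \<in> charts_at M x)
          in dir_deriv (cmap \<mu> \<circ> f \<circ> cinv \<kappa>) (cmap \<kappa> x) (v \<kappa>)
     else 0)"

definition tderiv ::
  "('a, 'e::euclidean_space) mfd \<Rightarrow> ('a \<Rightarrow> 'b::real_normed_vector) \<Rightarrow> 'a \<Rightarrow> ('a, 'e) tvec \<Rightarrow> 'b" where
  "tderiv M f x v =
     (let \<kappa> = (SOME \<kappa>. \<kappa> \<in> charts_at M x) in dir_deriv (f \<circ> cinv \<kappa>) (cmap \<kappa> x) (v \<kappa>))"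

type_synonym ('a, 'e) vfield = "'a \<Rightarrow> ('a, 'e) tvec"

definition vector_fields :: "('a, 'e::euclidean_space) mfd \<Rightarrow> 'a set \<Rightarrow> ('a, 'e) vfield set" where
  "vector_fields M U =
     {X. (\<forall>x\<in>U. X x \<in> tangent_space M x) \<and>
         (\<forall>\<kappa>\<in>atlas M. smooth_on (cmap \<kappa> ` (U \<inter> cdom \<kappa>)) (\<lambda>p. X (cinv \<kappa> p) \<kappa>))}"

definition lie_bracket ::
  "('a, 'e::euclidean_space) mfd \<Rightarrow> ('a, 'e) vfield \<Rightarrow> ('a, 'e) vfield \<Rightarrow> ('a, 'e) vfield" where
  "lie_bracket M X Y = (\<lambda>x \<kappa>.
     if \<kappa> \<in> charts_at M x
     then dir_deriv (\<lambda>p. Y (cinv \<kappa> p) \<kappa>) (cmap \<kappa> x) (X x \<kappa>)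
        - dir_deriv (\<lambda>p. X (cinv \<kappa> p) \<kappa>) (cmap \<kappa> x) (Y x \<kappa>)
     else 0)"


section \<open>Differential forms and symplectic manifolds\<close>

type_synonym ('a, 'e, 'k) form1 = "'a \<Rightarrow> ('a, 'e) tvec \<Rightarrow> 'k"
type_synonym ('a, 'e) form2 = "'a \<Rightarrow> ('a, 'e) tvec \<Rightarrow> ('a, 'e) tvec \<Rightarrow> real"

definition ext_deriv1 ::
  "('a, 'e::euclidean_space) mfd \<Rightarrow> ('a, 'e, 'k::real_normed_vector) form1
     \<Rightarrow> ('a, 'e) vfield \<Rightarrow> ('a, 'e) vfield \<Rightarrow> 'a \<Rightarrow> 'k" where
  "ext_deriv1 M \<alpha> X Y x =
     tderiv M (\<lambda>y. \<alpha> y (Y y)) x (X x) - tderiv M (\<lambda>y. \<alpha> y (X y)) x (Y x)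
     - \<alpha> x (lie_bracket M X Y x)"

definition ext_deriv2 ::
  "('a, 'e::euclidean_space) mfd \<Rightarrow> ('a, 'e) form2
     \<Rightarrow> ('a, 'e) vfield \<Rightarrow> ('a, 'e) vfield \<Rightarrow> ('a, 'e) vfield \<Rightarrow> 'a \<Rightarrow> real" where
  "ext_deriv2 M \<omega> X Y Z x =
     tderiv M (\<lambda>y. \<omega> y (Y y) (Z y)) x (X x) - tderiv M (\<lambda>y. \<omega> y (X y) (Z y)) x (Y x)
     + tderiv M (\<lambda>y. \<omega> y (X y) (Y y)) x (Z x)
     - \<omega> x (lie_bracket M X Y x) (Z x) + \<omega> x (lie_bracket M X Z x) (Y x)
     - \<omega> x (lie_bracket M Y Z x) (X x)"

definition two_form :: "('a, 'e::euclidean_space) mfd \<Rightarrow> ('a, 'e) form2 \<Rightarrow> bool" where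
  "two_form M \<omega> \<longleftrightarrow>
     (\<forall>x\<in>pts M. \<forall>u\<in>tangent_space M x. \<forall>v\<in>tangent_space M x. \<forall>w\<in>tangent_space M x. \<forall>r.
        \<omega> x (tv_add u v) w = \<omega> x u w + \<omega> x v w \<and>
        \<omega> x (tv_scale r v) w = r * \<omega> x v w \<and>
        \<omega> x w v = - \<omega> x v w) \<and>
     (\<forall>U X Y. openin (mtop M) U \<and> X \<in> vector_fields M U \<and> Y \<in> vector_fields M U
        \<longrightarrow> smooth_fun_on M U (\<lambda>x. \<omega> x (X x) (Y x)))"

definition closed_two_form :: "('a, 'e::euclidean_space) mfd \<Rightarrow> ('a, 'e) form2 \<Rightarrow> bool" where
  "closed_two_form M \<omega> \<longleftrightarrow> two_form M \<omega> \<and>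
     (\<forall>U. openin (mtop M) U \<longrightarrow>
        (\<forall>X\<in>vector_fields M U. \<forall>Y\<in>vector_fields M U. \<forall>Z\<in>vector_fields M U. \<forall>x\<in>U.
           ext_deriv2 M \<omega> X Y Z x = 0))"

definition symplectic_manifold ::
  "nat \<Rightarrow> ('a, 'e::euclidean_space) mfd \<Rightarrow> ('a, 'e) form2 \<Rightarrow> bool" where
  "symplectic_manifold d M \<omega> \<longleftrightarrow>
     smooth_manifold d M \<and> closed_two_form M \<omega> \<and>
     (\<forall>x\<in>pts M. \<forall>v\<in>tangent_space M x.
        (\<forall>w\<in>tangent_space M x. \<omega> x v w = 0) \<longrightarrow> v = tv_zero)"

definition symplectomorphism ::
  "('a, 'e::euclidean_space) mfd \<Rightarrow> ('a, 'e) form2 \<Rightarrow> ('a \<Rightarrow> 'a) \<Rightarrow> bool" where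
  "symplectomorphism M \<omega> \<Phi> \<longleftrightarrow> diffeomorphism M M \<Phi> \<and>
     (\<forall>x\<in>pts M. \<forall>v\<in>tangent_space M x. \<forall>w\<in>tangent_space M x.
        \<omega> (\<Phi> x) (tangent_map M M \<Phi> x v) (tangent_map M M \<Phi> x w) = \<omega> x v w)"


section \<open>Polarizations\<close>

type_synonym ('a, 'e) distr = "'a \<Rightarrow> ('a, 'e) tvec set"

definition distr_sections ::
  "('a, 'e::euclidean_space) mfd \<Rightarrow> ('a, 'e) distr \<Rightarrow> 'a set \<Rightarrow> ('a, 'e) vfield set" where
  "distr_sections M P U = {X \<in> vector_fields M U. \<forall>x\<in>U. X x \<in> P x}"

definition singular_subbundle :: "('a, 'e::euclidean_space) mfd \<Rightarrow> ('a, 'e) distr \<Rightarrow> bool" where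
  "singular_subbundle M P \<longleftrightarrow>
     (\<forall>x\<in>pts M.
        P x \<subseteq> tangent_space M x \<and> tv_zero \<in> P x \<and>
        (\<forall>v\<in>P x. \<forall>w\<in>P x. tv_add v w \<in> P x) \<and> (\<forall>r. \<forall>v\<in>P x. tv_scale r v \<in> P x) \<and>
        (\<forall>v\<in>P x. \<exists>U X. openin (mtop M) U \<and> x \<in> U \<and> X \<in> distr_sections M P U \<and> X x = v))"

definition involutive :: "('a, 'e::euclidean_space) mfd \<Rightarrow> ('a, 'e) distr \<Rightarrow> bool" where
  "involutive M P \<longleftrightarrow>
     (\<forall>U. openin (mtop M) U \<longrightarrow>
        (\<forall>X\<in>distr_sections M P U. \<forall>Y\<in>distr_sections M P U.
           lie_bracket M X Y \<in> distr_sections M P U))"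

definition locally_finitely_generated ::
  "('a, 'e::euclidean_space) mfd \<Rightarrow> ('a, 'e) distr \<Rightarrow> bool" where
  "locally_finitely_generated M P \<longleftrightarrow>
     (\<forall>x\<in>pts M. \<exists>U k Xs. openin (mtop M) U \<and> x \<in> U \<and>
        (\<forall>i<k::nat. Xs i \<in> distr_sections M P U) \<and>
        (\<forall>X\<in>distr_sections M P U. \<exists>f.
           (\<forall>i<k. smooth_fun_on M U (f i)) \<and>
           (\<forall>y\<in>U. X y = (\<lambda>\<kappa>. \<Sum>i<k. (f i y :: real) *\<^sub>R Xs i y \<kappa>))))"

definition lagrangian ::
  "('a, 'e::euclidean_space) mfd \<Rightarrow> ('a, 'e) form2 \<Rightarrow> 'a \<Rightarrow> ('a, 'e) tvec set \<Rightarrow> bool" where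
  "lagrangian M \<omega> x V \<longleftrightarrow> V = {v \<in> tangent_space M x. \<forall>w\<in>V. \<omega> x v w = 0}"

definition polarization ::
  "('a, 'e::euclidean_space) mfd \<Rightarrow> ('a, 'e) form2 \<Rightarrow> ('a, 'e) distr \<Rightarrow> bool" where
  "polarization M \<omega> P \<longleftrightarrow>
     singular_subbundle M P \<and> involutive M P \<and> locally_finitely_generated M P \<and>
     (\<exists>U. openin (mtop M) U \<and> mtop M closure_of U = pts M \<and> (\<forall>x\<in>U. lagrangian M \<omega> x (P x)))"

definition pullback_distr ::
  "('a, 'e::euclidean_space) mfd \<Rightarrow> ('a \<Rightarrow> 'a) \<Rightarrow> ('a, 'e) distr \<Rightarrow> ('a, 'e) distr" where
  "pullback_distr M \<Phi> P = (\<lambda>x. tangent_map M M (inv_on M \<Phi>) (\<Phi> x) ` P (\<Phi> x))"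


section \<open>Leaves\<close>

text \<open>An injectively immersed manifold \<open>\<iota> : B \<rightarrow> M\<close> is identified with its image, carrying the
  topology and smooth structure of \<open>B\<close> (in general finer than the subspace topology), so that
  \<open>\<iota>\<close> becomes the inclusion.  This selects one representative of each leaf, so that leaves form a
  set over which a direct sum can be taken.\<close>

definition integral_manifold ::
  "('a, 'e::euclidean_space) mfd \<Rightarrow> ('a, 'e) distr \<Rightarrow> ('a, 'e) mfd \<Rightarrow> bool" where
  "integral_manifold M P B \<longleftrightarrow>
     (\<exists>d. smooth_manifold d B) \<and> connected_space (mtop B) \<and> pts B \<noteq> {} \<and>
     pts B \<subseteq> pts M \<and> smooth_map_on B (pts B) M (\<lambda>x. x) \<and>
     (\<forall>x\<in>pts B. inj_on (tangent_map B M (\<lambda>x. x) x) (tangent_space B x) \<and>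
                tangent_map B M (\<lambda>x. x) x ` tangent_space B x = P x)"

definition leaves :: "('a, 'e::euclidean_space) mfd \<Rightarrow> ('a, 'e) distr \<Rightarrow> ('a, 'e) mfd set" where
  "leaves M P =
     {B. integral_manifold M P B \<and>
         (\<forall>B'. integral_manifold M P B' \<and> pts B \<subseteq> pts B' \<longrightarrow> pts B' = pts B)}"

text \<open>The immersion \<open>\<Phi>\<^sup>-\<^sup>1 \<circ> \<iota>\<close>: the image of \<open>B\<close> under \<open>\<Phi>\<^sup>-\<^sup>1\<close> with the transported structure.\<close>

definition pullback_leaf ::
  "('a, 'e) mfd \<Rightarrow> ('a \<Rightarrow> 'a) \<Rightarrow> ('a, 'e) mfd \<Rightarrow> ('a, 'e) mfd" where
  "pullback_leaf M \<Phi> B =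
     \<lparr> mtop = pullback_topology (inv_on M \<Phi> ` pts B) \<Phi> (mtop B),
       atlas = (\<lambda>\<kappa>. \<lparr> cdom = inv_on M \<Phi> ` cdom \<kappa>,
                      cmap = restrict (cmap \<kappa> \<circ> \<Phi>) (inv_on M \<Phi> ` cdom \<kappa>),
                      cspace = cspace \<kappa> \<rparr>) ` atlas B \<rparr>"


section \<open>Line bundles and connections\<close>

record ('a, 'l, 'e) line_bundle =
  ltotal :: "('l, 'e \<times> complex) mfd"
  lproj :: "'l \<Rightarrow> 'a"
  lzero :: "'a \<Rightarrow> 'l"
  ladd :: "'l \<Rightarrow> 'l \<Rightarrow> 'l"
  lscale :: "complex \<Rightarrow> 'l \<Rightarrow> 'l"
  lherm :: "'l \<Rightarrow> 'l \<Rightarrow> complex"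

definition fibre :: "('a, 'l, 'e) line_bundle \<Rightarrow> 'a \<Rightarrow> 'l set" where
  "fibre L x = {l \<in> pts (ltotal L). lproj L l = x}"

text \<open>The total space has an atlas of bundle charts \<open>\<mu> = (\<kappa> \<circ> \<pi>, c)\<close>, with \<open>c\<close> a linear isomorphism
  on each fibre.  As \<open>c\<close> is bijective and respects the operations, the complex vector space
  axioms hold in each fibre.\<close>

definition bundle_chart ::
  "('a, 'l, 'e::euclidean_space) line_bundle \<Rightarrow> ('a, 'e) chart \<Rightarrow> ('l, 'e \<times> complex) chart \<Rightarrow> bool" where
  "bundle_chart L \<kappa> \<mu> \<longleftrightarrow>
     cdom \<mu> = {l \<in> pts (ltotal L). lproj L l \<in> cdom \<kappa>} \<and>
     (\<forall>l\<in>cdom \<mu>. fst (cmap \<mu> l) = cmap \<kappa> (lproj L l)) \<and>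
     (\<forall>x\<in>cdom \<kappa>.
        bij_betw (\<lambda>l. snd (cmap \<mu> l)) (fibre L x) UNIV \<and>
        snd (cmap \<mu> (lzero L x)) = 0 \<and>
        (\<forall>a\<in>fibre L x. \<forall>b\<in>fibre L x. snd (cmap \<mu> (ladd L a b)) = snd (cmap \<mu> a) + snd (cmap \<mu> b)) \<and>
        (\<forall>z. \<forall>a\<in>fibre L x. snd (cmap \<mu> (lscale L z a)) = z * snd (cmap \<mu> a)))"

definition sections ::
  "('a, 'e::euclidean_space) mfd \<Rightarrow> ('a, 'l, 'e) line_bundle \<Rightarrow> 'a set \<Rightarrow> ('a \<Rightarrow> 'l) set" where
  "sections M L U = {s. smooth_map_on M U (ltotal L) s \<and> (\<forall>x\<in>U. s x \<in> fibre L x)}"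

definition complex_line_bundle ::
  "nat \<Rightarrow> ('a, 'e::euclidean_space) mfd \<Rightarrow> ('a, 'l, 'e) line_bundle \<Rightarrow> bool" where
  "complex_line_bundle d M L \<longleftrightarrow>
     smooth_manifold (d + 2) (ltotal L) \<and>
     smooth_map_on (ltotal L) (pts (ltotal L)) M (lproj L) \<and>
     (\<forall>x\<in>pts M. lzero L x \<in> fibre L x \<and>
        (\<forall>a\<in>fibre L x. \<forall>b\<in>fibre L x. ladd L a b \<in> fibre L x) \<and>
        (\<forall>z. \<forall>a\<in>fibre L x. lscale L z a \<in> fibre L x)) \<and>
     (\<forall>x\<in>pts M. \<exists>\<kappa>\<in>charts_at M x. \<exists>\<mu>\<in>atlas (ltotal L). bundle_chart L \<kappa> \<mu>)"

definition hermitian_metric ::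
  "('a, 'e::euclidean_space) mfd \<Rightarrow> ('a, 'l, 'e) line_bundle \<Rightarrow> bool" where
  "hermitian_metric M L \<longleftrightarrow>
     (\<forall>x\<in>pts M. \<forall>a\<in>fibre L x. \<forall>b\<in>fibre L x. \<forall>c\<in>fibre L x. \<forall>z.
        lherm L (ladd L a b) c = lherm L a c + lherm L b c \<and>
        lherm L (lscale L z a) b = z * lherm L a b \<and>
        lherm L b a = cnj (lherm L a b) \<and>
        (a \<noteq> lzero L x \<longrightarrow> Re (lherm L a a) > 0)) \<and>
     (\<forall>U. openin (mtop M) U \<longrightarrow>
        (\<forall>s\<in>sections M L U. \<forall>t\<in>sections M L U. smooth_fun_on M U (\<lambda>x. lherm L (s x) (t x))))"

text \<open>A covariant derivative maps a local section \<open>s\<close> around \<open>x\<close> and a tangent vector \<open>v\<close> at \<open>x\<close>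
  to \<open>\<nabla>\<^sub>v s \<in> L\<^sub>x\<close>, depending only on the germ of \<open>s\<close> at \<open>x\<close>.\<close>

type_synonym ('a, 'l, 'e) connection = "('a \<Rightarrow> 'l) \<Rightarrow> 'a \<Rightarrow> ('a, 'e) tvec \<Rightarrow> 'l"

definition is_connection ::
  "('a, 'e::euclidean_space) mfd \<Rightarrow> ('a, 'l, 'e) line_bundle \<Rightarrow> ('a, 'l, 'e) connection \<Rightarrow> bool" where
  "is_connection M L nab \<longleftrightarrow>
     (\<forall>U. openin (mtop M) U \<longrightarrow>
        (\<forall>s\<in>sections M L U.
           (\<forall>X\<in>vector_fields M U. (\<lambda>x. nab s x (X x)) \<in> sections M L U) \<and>
           (\<forall>x\<in>U. \<forall>v\<in>tangent_space M x. nab s x v \<in> fibre L x) \<and>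
           (\<forall>x\<in>U. \<forall>v\<in>tangent_space M x. \<forall>w\<in>tangent_space M x.
              nab s x (tv_add v w) = ladd L (nab s x v) (nab s x w)) \<and>
           (\<forall>x\<in>U. \<forall>v\<in>tangent_space M x. \<forall>r.
              nab s x (tv_scale r v) = lscale L (of_real r) (nab s x v)) \<and>
           (\<forall>t\<in>sections M L U. \<forall>x\<in>U. \<forall>v\<in>tangent_space M x.
              nab (\<lambda>y. ladd L (s y) (t y)) x v = ladd L (nab s x v) (nab t x v)) \<and>
           (\<forall>f. smooth_fun_on M U f \<longrightarrow> (\<forall>x\<in>U. \<forall>v\<in>tangent_space M x.
              nab (\<lambda>y. lscale L (f y) (s y)) x v =
              ladd L (lscale L (tderiv M f x v) (s x)) (lscale L (f x) (nab s x v)))) \<and>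
           (\<forall>V t. openin (mtop M) V \<and> V \<subseteq> U \<and> t \<in> sections M L V \<and> (\<forall>y\<in>V. t y = s y) \<longrightarrow>
              (\<forall>x\<in>V. \<forall>v\<in>tangent_space M x. nab t x v = nab s x v))))"

definition metric_connection ::
  "('a, 'e::euclidean_space) mfd \<Rightarrow> ('a, 'l, 'e) line_bundle \<Rightarrow> ('a, 'l, 'e) connection \<Rightarrow> bool" where
  "metric_connection M L nab \<longleftrightarrow>
     (\<forall>U. openin (mtop M) U \<longrightarrow>
        (\<forall>s\<in>sections M L U. \<forall>t\<in>sections M L U. \<forall>x\<in>U. \<forall>v\<in>tangent_space M x.
           tderiv M (\<lambda>y. lherm L (s y) (t y)) x v =
           lherm L (nab s x v) (t x) + lherm L (s x) (nab t x v)))"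

definition frames ::
  "('a, 'e::euclidean_space) mfd \<Rightarrow> ('a, 'l, 'e) line_bundle \<Rightarrow> 'a set \<Rightarrow> ('a \<Rightarrow> 'l) set" where
  "frames M L U = {s \<in> sections M L U. \<forall>x\<in>U. s x \<noteq> lzero L x}"

text \<open>The connection form \<open>\<alpha>\<close> is real only in unitary frames, hence its complex values.\<close>

definition has_curvature ::
  "('a, 'e::euclidean_space) mfd \<Rightarrow> ('a, 'l, 'e) line_bundle \<Rightarrow> ('a, 'l, 'e) connection
     \<Rightarrow> ('a, 'e) form2 \<Rightarrow> bool" where
  "has_curvature M L nab \<omega> \<longleftrightarrow>
     (\<forall>U s \<alpha>. openin (mtop M) U \<and> s \<in> frames M L U \<and>
        (\<forall>x\<in>U. \<forall>v\<in>tangent_space M x. nab s x v = lscale L (\<i> * \<alpha> x v) (s x)) \<longrightarrow>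
        (\<forall>X\<in>vector_fields M U. \<forall>Y\<in>vector_fields M U. \<forall>x\<in>U.
           ext_deriv1 M \<alpha> X Y x = complex_of_real (\<omega> x (X x) (Y x))))"

definition prequantum_line_bundle ::
  "nat \<Rightarrow> ('a, 'e::euclidean_space) mfd \<Rightarrow> ('a, 'e) form2 \<Rightarrow> ('a, 'l, 'e) line_bundle
     \<Rightarrow> ('a, 'l, 'e) connection \<Rightarrow> bool" where
  "prequantum_line_bundle d M \<omega> L nab \<longleftrightarrow>
     complex_line_bundle d M L \<and> hermitian_metric M L \<and>
     is_connection M L nab \<and> metric_connection M L nab \<and> has_curvature M L nab \<omega>"


section \<open>Bohr-Sommerfeld quantization\<close>

text \<open>The pullback \<open>\<iota>\<^sup>*\<nabla>\<close> to an immersed manifold \<open>B \<subseteq> M\<close>.  It is the connection on \<open>\<iota>\<^sup>*L\<close> with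
  \<open>(\<iota>\<^sup>*\<nabla>)\<^sub>v(\<iota>\<^sup>*t) = \<nabla>\<^sub>\<iota>\<^sub>*\<^sub>v t\<close>; for \<open>s = f \<cdot> \<iota>\<^sup>*t\<close> with \<open>t\<close> a local frame of \<open>L\<close> the Leibniz rule
  gives \<open>(\<iota>\<^sup>*\<nabla>)\<^sub>v s = (v f) \<cdot> t + f \<cdot> \<nabla>\<^sub>\<iota>\<^sub>*\<^sub>v t\<close>, which does not depend on \<open>t\<close>.\<close>

definition leaf_connection ::
  "('a, 'e::euclidean_space) mfd \<Rightarrow> ('a, 'l, 'e) line_bundle \<Rightarrow> ('a, 'l, 'e) connection
     \<Rightarrow> ('a, 'e) mfd \<Rightarrow> ('a, 'l, 'e) connection" where
  "leaf_connection M L nab B s x v =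
     (let t = (SOME t. \<exists>U. openin (mtop M) U \<and> x \<in> U \<and> t \<in> frames M L U);
          f = (\<lambda>y. THE z. s y = lscale L z (t y))
      in ladd L (lscale L (tderiv B f x v) (t x))
                (lscale L (f x) (nab t x (tangent_map B M (\<lambda>x. x) x v))))"

text \<open>A section of \<open>\<iota>\<^sup>*L\<close> is a smooth map \<open>s : U \<rightarrow> L\<close> with \<open>\<pi> \<circ> s = \<iota>\<close>, smoothness being that of \<open>B\<close>.
  Sections are \<open>undefined\<close> outside \<open>U\<close>.\<close>

definition flat_sections ::
  "('a, 'e::euclidean_space) mfd \<Rightarrow> ('a, 'l, 'e) line_bundle \<Rightarrow> ('a, 'l, 'e) connection
     \<Rightarrow> ('a, 'e) mfd \<Rightarrow> 'a set \<Rightarrow> ('a \<Rightarrow> 'l) set" where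
  "flat_sections M L nab B U =
     {s \<in> sections B L U. s \<in> extensional U \<and>
        (\<forall>X\<in>vector_fields B U. \<forall>x\<in>U. leaf_connection M L nab B s x (X x) = lzero L x)}"

abbreviation H0 ::
  "('a, 'e::euclidean_space) mfd \<Rightarrow> ('a, 'l, 'e) line_bundle \<Rightarrow> ('a, 'l, 'e) connection
     \<Rightarrow> ('a, 'e) mfd \<Rightarrow> ('a \<Rightarrow> 'l) set" where
  "H0 M L nab B \<equiv> flat_sections M L nab B (pts B)"

definition zero_section :: "('a, 'l, 'e) line_bundle \<Rightarrow> ('a, 'e) mfd \<Rightarrow> 'a \<Rightarrow> 'l" where
  "zero_section L B = restrict (lzero L) (pts B)"

definition BS ::
  "('a, 'e::euclidean_space) mfd \<Rightarrow> ('a, 'l, 'e) line_bundle \<Rightarrow> ('a, 'l, 'e) connection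
     \<Rightarrow> ('a, 'e) distr \<Rightarrow> ('a, 'e) mfd set" where
  "BS M L nab P = {B \<in> leaves M P. H0 M L nab B \<noteq> {zero_section L B}}"

definition Q_BS ::
  "('a, 'e::euclidean_space) mfd \<Rightarrow> ('a, 'l, 'e) line_bundle \<Rightarrow> ('a, 'l, 'e) connection
     \<Rightarrow> ('a, 'e) distr \<Rightarrow> (('a, 'e) mfd \<Rightarrow> 'a \<Rightarrow> 'l) set" where
  "Q_BS M L nab P =
     {q \<in> (\<Pi>\<^sub>E B\<in>BS M L nab P. H0 M L nab B).
        finite {B \<in> BS M L nab P. q B \<noteq> zero_section L B}}"

definition Q_add ::
  "('a, 'l, 'e) line_bundle \<Rightarrow> ('a, 'e) mfd set
     \<Rightarrow> (('a, 'e) mfd \<Rightarrow> 'a \<Rightarrow> 'l) \<Rightarrow> (('a, 'e) mfd \<Rightarrow> 'a \<Rightarrow> 'l) \<Rightarrow> ('a, 'e) mfd \<Rightarrow> 'a \<Rightarrow> 'l" where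
  "Q_add L \<B> q q' = (\<lambda>B\<in>\<B>. \<lambda>x\<in>pts B. ladd L (q B x) (q' B x))"

definition Q_scale ::
  "('a, 'l, 'e) line_bundle \<Rightarrow> ('a, 'e) mfd set
     \<Rightarrow> complex \<Rightarrow> (('a, 'e) mfd \<Rightarrow> 'a \<Rightarrow> 'l) \<Rightarrow> ('a, 'e) mfd \<Rightarrow> 'a \<Rightarrow> 'l" where
  "Q_scale L \<B> z q = (\<lambda>B\<in>\<B>. \<lambda>x\<in>pts B. lscale L z (q B x))"

definition Q_incl ::
  "('a, 'l, 'e) line_bundle \<Rightarrow> ('a, 'e) mfd set
     \<Rightarrow> ('a, 'e) mfd \<Rightarrow> ('a \<Rightarrow> 'l) \<Rightarrow> ('a, 'e) mfd \<Rightarrow> 'a \<Rightarrow> 'l" where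
  "Q_incl L \<B> B s = (\<lambda>B'\<in>\<B>. if B' = B then s else zero_section L B')"

definition Q_isomorphism ::
  "('a, 'e::euclidean_space) mfd \<Rightarrow> ('a, 'l, 'e) line_bundle \<Rightarrow> ('a, 'l, 'e) connection
     \<Rightarrow> ('a, 'e) distr \<Rightarrow> ('a, 'e) distr
     \<Rightarrow> ((('a, 'e) mfd \<Rightarrow> 'a \<Rightarrow> 'l) \<Rightarrow> ('a, 'e) mfd \<Rightarrow> 'a \<Rightarrow> 'l) \<Rightarrow> bool" where
  "Q_isomorphism M L nab P P' T \<longleftrightarrow>
     bij_betw T (Q_BS M L nab P) (Q_BS M L nab P') \<and>
     (\<forall>q\<in>Q_BS M L nab P. \<forall>q'\<in>Q_BS M L nab P.
        T (Q_add L (BS M L nab P) q q') = Q_add L (BS M L nab P') (T q) (T q')) \<and>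
     (\<forall>z. \<forall>q\<in>Q_BS M L nab P.
        T (Q_scale L (BS M L nab P) z q) = Q_scale L (BS M L nab P') z (T q))"


section \<open>Lifts\<close>

definition is_lift ::
  "('a, 'e::euclidean_space) mfd \<Rightarrow> ('a, 'l, 'e) line_bundle \<Rightarrow> ('a \<Rightarrow> 'a) \<Rightarrow> ('l \<Rightarrow> 'l) \<Rightarrow> bool" where
  "is_lift M L \<Phi> F \<longleftrightarrow>
     diffeomorphism (ltotal L) (ltotal L) F \<and>
     (\<forall>l\<in>pts (ltotal L). lproj L (F l) = \<Phi> (lproj L l)) \<and>
     (\<forall>x\<in>pts M.
        bij_betw F (fibre L x) (fibre L (\<Phi> x)) \<and>
        (\<forall>a\<in>fibre L x. \<forall>b\<in>fibre L x. F (ladd L a b) = ladd L (F a) (F b)) \<and>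
        (\<forall>z. \<forall>a\<in>fibre L x. F (lscale L z a) = lscale L z (F a)))"

definition push_section ::
  "('a, 'e) mfd \<Rightarrow> ('a \<Rightarrow> 'a) \<Rightarrow> ('l \<Rightarrow> 'l) \<Rightarrow> ('a \<Rightarrow> 'l) \<Rightarrow> 'a \<Rightarrow> 'l" where
  "push_section M \<Phi> F t = (\<lambda>y. F (t (inv_on M \<Phi> y)))"

text \<open>\<open>F\<^sup>*\<nabla>\<close>, that is, \<open>F\<^sub>*((F\<^sup>*\<nabla>)\<^sub>X t) = \<nabla> (F\<^sub>* t)\<close> along \<open>\<Phi>\<^sub>*X\<close>, solved for \<open>(F\<^sup>*\<nabla>)\<^sub>X t\<close>.\<close>

definition pullback_connection ::
  "('a, 'e::euclidean_space) mfd \<Rightarrow> ('a, 'l, 'e) line_bundle \<Rightarrow> ('a \<Rightarrow> 'a) \<Rightarrow> ('l \<Rightarrow> 'l)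
     \<Rightarrow> ('a, 'l, 'e) connection \<Rightarrow> ('a, 'l, 'e) connection" where
  "pullback_connection M L \<Phi> F nab t x v =
     inv_on (ltotal L) F (nab (push_section M \<Phi> F t) (\<Phi> x) (tangent_map M M \<Phi> x v))"

definition connection_eq ::
  "('a, 'e::euclidean_space) mfd \<Rightarrow> ('a, 'l, 'e) line_bundle
     \<Rightarrow> ('a, 'l, 'e) connection \<Rightarrow> ('a, 'l, 'e) connection \<Rightarrow> bool" where
  "connection_eq M L nab nab' \<longleftrightarrow>
     (\<forall>U. openin (mtop M) U \<longrightarrow>
        (\<forall>t\<in>sections M L U. \<forall>x\<in>U. \<forall>v\<in>tangent_space M x. nab t x v = nab' t x v))"

text \<open>\<open>F\<^sup>-\<^sup>1\<close> applied fibrewise to a section over \<open>B\<close>, giving a section over \<open>\<Phi>\<^sup>*B\<close>.  With \<open>\<Phi>\<^sup>*B\<close>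
  realised as a subset of \<open>M\<close>, the value at \<open>y = \<Phi>\<^sup>-\<^sup>1(x)\<close> is \<open>F\<^sup>-\<^sup>1(s(x))\<close>.\<close>

definition pullback_section ::
  "('a, 'e) mfd \<Rightarrow> ('a, 'l, 'e) line_bundle \<Rightarrow> ('a \<Rightarrow> 'a) \<Rightarrow> ('l \<Rightarrow> 'l) \<Rightarrow> ('a, 'e) mfd
     \<Rightarrow> ('a \<Rightarrow> 'l) \<Rightarrow> 'a \<Rightarrow> 'l" where
  "pullback_section M L \<Phi> F B s =
     (\<lambda>y\<in>pts (pullback_leaf M \<Phi> B). inv_on (ltotal L) F (s (\<Phi> y)))"


section \<open>First Cech cohomology\<close>

text \<open>\<open>G U\<close> are the sections over \<open>U\<close> of a sheaf of multiplicative groups of complex-valued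
  functions; only the values on \<open>U\<close> matter.  A cover is a set of open sets, indexed by itself:
  every indexed cover and the set of its members refine each other, so the direct limit over
  refinement is the same.\<close>

definition locally_constant_units :: "'a topology \<Rightarrow> 'a set \<Rightarrow> ('a \<Rightarrow> complex) set" where
  "locally_constant_units X U =
     {f. (\<forall>x\<in>U. f x \<noteq> 0) \<and>
         (\<forall>x\<in>U. \<exists>W. openin X W \<and> x \<in> W \<and> W \<subseteq> U \<and> (\<forall>y\<in>W. f y = f x))}"

definition open_cover :: "'a topology \<Rightarrow> 'a set set \<Rightarrow> bool" where
  "open_cover X \<U> \<longleftrightarrow> (\<forall>U\<in>\<U>. openin X U) \<and> \<Union>\<U> = topspace X"

type_synonym 'a cochain1 = "'a set \<Rightarrow> 'a set \<Rightarrow> 'a \<Rightarrow> complex"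

definition cech_cocycle :: "('a set \<Rightarrow> ('a \<Rightarrow> complex) set) \<Rightarrow> 'a set set \<Rightarrow> 'a cochain1 \<Rightarrow> bool" where
  "cech_cocycle G \<U> c \<longleftrightarrow>
     (\<forall>U\<in>\<U>. \<forall>V\<in>\<U>. c U V \<in> G (U \<inter> V)) \<and>
     (\<forall>U\<in>\<U>. \<forall>V\<in>\<U>. \<forall>W\<in>\<U>. \<forall>x\<in>U \<inter> V \<inter> W. c U V x * c V W x = c U W x)"

definition cech_cohomologous ::
  "('a set \<Rightarrow> ('a \<Rightarrow> complex) set) \<Rightarrow> 'a set set \<Rightarrow> 'a cochain1 \<Rightarrow> 'a cochain1 \<Rightarrow> bool" where
  "cech_cohomologous G \<U> c c' \<longleftrightarrow>
     (\<exists>b. (\<forall>U\<in>\<U>. b U \<in> G U) \<and>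
          (\<forall>U\<in>\<U>. \<forall>V\<in>\<U>. \<forall>x\<in>U \<inter> V. c U V x = c' U V x * (b V x / b U x)))"

definition cech_cocycles ::
  "'a topology \<Rightarrow> ('a set \<Rightarrow> ('a \<Rightarrow> complex) set) \<Rightarrow> ('a set set \<times> 'a cochain1) set" where
  "cech_cocycles X G = {(\<U>, c). open_cover X \<U> \<and> cech_cocycle G \<U> c}"

definition refinement :: "'a set set \<Rightarrow> 'a set set \<Rightarrow> ('a set \<Rightarrow> 'a set) \<Rightarrow> bool" where
  "refinement \<W> \<U> r \<longleftrightarrow> (\<forall>W\<in>\<W>. r W \<in> \<U> \<and> W \<subseteq> r W)"

definition cech_rel ::
  "'a topology \<Rightarrow> ('a set \<Rightarrow> ('a \<Rightarrow> complex) set)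
     \<Rightarrow> (('a set set \<times> 'a cochain1) \<times> ('a set set \<times> 'a cochain1)) set" where
  "cech_rel X G =
     {((\<U>, c), (\<V>, c')). (\<U>, c) \<in> cech_cocycles X G \<and> (\<V>, c') \<in> cech_cocycles X G \<and>
        (\<exists>\<W> r r'. open_cover X \<W> \<and> refinement \<W> \<U> r \<and> refinement \<W> \<V> r' \<and>
           cech_cohomologous G \<W> (\<lambda>W W'. c (r W) (r W')) (\<lambda>W W'. c' (r' W) (r' W')))}"

definition cech_H1 ::
  "'a topology \<Rightarrow> ('a set \<Rightarrow> ('a \<Rightarrow> complex) set) \<Rightarrow> ('a set set \<times> 'a cochain1) set set" where
  "cech_H1 X G = cech_cocycles X G // cech_rel X G"

definition cech_trivial_class ::
  "'a topology \<Rightarrow> ('a set \<Rightarrow> ('a \<Rightarrow> complex) set) \<Rightarrow> ('a set set \<times> 'a cochain1) set" where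
  "cech_trivial_class X G = cech_rel X G `` {({topspace X}, \<lambda>U V x. 1)}"

end

theory Submission
  imports Defs
begin

text \<open>Locally, a lift of \<open>\<Phi>\<close> that preserves the connection is a pair of frames, \<open>s\<close> over \<open>U\<close> and \<open>s'\<close> over
  \<open>\<Phi>(U)\<close>, whose connection forms correspond under \<open>\<Phi>\<close>: it sends \<open>z s(x)\<close> to \<open>z s'(\<Phi>(x))\<close>.  Such pairs
  exist around every point.  Indeed, the connection form of any \<open>s\<close> and the pullback of that of any \<open>s'\<close>
  have the same exterior derivative, because \<open>\<Phi>\<^sup>*\<omega> = \<omega>\<close>; by the Poincare lemma their difference is \<open>dg\<close>
  on a small ball, and rescaling \<open>s'\<close> by \<open>exp(g \<circ> \<Phi>\<^sup>-\<^sup>1)\<close> makes the two forms agree.  Two such local lifts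
  differ by a function whose logarithmic derivative vanishes, that is, by a locally constant unit.  These
  units form a Cech 1-cocycle, and a trivialization of it rescales the local lifts into a global lift \<open>F\<close>.
  The inverse of \<open>F\<close> is a lift of \<open>\<Phi>\<^sup>-\<^sup>1\<close> of the same kind, so transport of leaves and of flat sections
  along \<open>(\<Phi>, F)\<close> is inverted by transport along \<open>(\<Phi>\<^sup>-\<^sup>1, F\<^sup>-\<^sup>1)\<close>; this symmetry gives the maximality of the
  pulled back leaves, the correspondence of Bohr-Sommerfeld leaves and the bijectivity.\<close>

section \<open>Calculus of smooth maps\<close>

text \<open>Three obstacles shape the proof. Charts map into relatively open subsets of linear
  subspaces, where an ambient Frechet derivative is not determined; derivatives are therefore taken
  within the domain and evaluated only along the subspace, and a projection onto the subspace
  reduces the Poincare lemma to the ambient case. The frames are not normalized, so connection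
  forms, exponents and ratios of local lifts are all complex; hence the obstruction lives in
  cohomology with values in the nonzero complex numbers. Equal curvatures alone do not make a local
  lift flat: the Leibniz rule turns a fibrewise linear map into one that commutes with the covariant
  derivative when the connection forms of corresponding frames agree, and the primitive
  \<open>g\<close> removes the exact difference that equal curvatures still allow. Finally, leaves
  with their topology and atlas index a direct sum, so transport is built on extensional charts:
  pulling back along \<open>\<Phi>\<close> and then along its inverse returns the very same
  record.\<close>

lemma Ck_on_subset: "Ck_on k W f \<Longrightarrow> V \<subseteq> W \<Longrightarrow> Ck_on k V f"
  by (induction k arbitrary: f) (auto intro: continuous_on_subset)

text \<open>The recursion differentiates at points in the whole space, so equality on
  \<open>W\<close> determines the derivatives only because \<open>W\<close> is open.\<close>

lemma Ck_on_cong: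
  assumes "open W" "\<And>x. x \<in> W \<Longrightarrow> f x = g x" "Ck_on k W f"
  shows "Ck_on k W g"
  using assms(2,3)
proof (induction k arbitrary: f g)
  case 0
  then show ?case using continuous_on_cong by fastforce
next
  case (Suc k)
  have d: "f differentiable (at x)" if "x \<in> W" for x
    using Suc.prems that by simp
  have g: "(g has_derivative frechet_derivative f (at x)) (at x)" if "x \<in> W" for x
    using has_derivative_transform_within_open[OF _ \<open>open W\<close> that, of f _ UNIV g] d[OF that] Suc.prems(1)
    by (simp add: frechet_derivative_works)
  have "Ck_on k W (\<lambda>x. frechet_derivative g (at x) v)" for v
    using Suc.IH[of "\<lambda>x. frechet_derivative f (at x) v" "\<lambda>x. frechet_derivative g (at x) v"] Suc.prems(2)
      frechet_derivative_at[OF g] by simp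
  then show ?case using g by (auto simp: differentiable_def)
qed

text \<open>Lets any explicit formula for the derivative replace \<open>frechet_derivative\<close>;
  the closure properties below unfold the recursion through this rule.\<close>

lemma Ck_on_SucI:
  assumes "open W" "\<And>x. x \<in> W \<Longrightarrow> (f has_derivative f' x) (at x)" "\<And>v. Ck_on k W (\<lambda>x. f' x v)"
  shows "Ck_on (Suc k) W f"
proof -
  have "Ck_on k W (\<lambda>x. frechet_derivative f (at x) v)" for v
    by (rule Ck_on_cong[OF assms(1) _ assms(3)[of v]])
      (metis assms(2) frechet_derivative_at)
  then show ?thesis using assms(2) by (auto simp: differentiable_def)
qed

lemma Ck_on_SucD:
  "Ck_on (Suc k) W f \<Longrightarrow> x \<in> W \<Longrightarrow> (f has_derivative frechet_derivative f (at x)) (at x)"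
  by (simp add: frechet_derivative_works)

lemma Ck_on_Suc_le: "Ck_on (Suc k) W f \<Longrightarrow> Ck_on k W f"
proof (induction k arbitrary: f)
  case 0
  then show ?case
    by (auto intro!: differentiable_imp_continuous_on simp: differentiable_on_def differentiable_at_withinI)
next
  case (Suc k)
  then show ?case by (metis Ck_on.simps(2))
qed

lemma Ck_on_local:
  assumes "\<And>x. x \<in> W \<Longrightarrow> \<exists>V. open V \<and> x \<in> V \<and> Ck_on k V f"
  shows "Ck_on k W f"
  using assms
proof (induction k arbitrary: f)
  case 0
  then have "isCont f x" if "x \<in> W" for x
    using that by (metis Ck_on.simps(1) continuous_on_eq_continuous_at)
  then show ?case by (simp add: continuous_at_imp_continuous_on)
next
  case (Suc k)
  have "Ck_on k W (\<lambda>x. frechet_derivative f (at x) v)" for v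
    by (rule Suc.IH) (metis Suc.prems Ck_on.simps(2))
  then show ?case using Suc.prems by (metis Ck_on.simps(2))
qed

lemma Ck_on_const: "Ck_on k W (\<lambda>x. c)"
  by (induction k arbitrary: c) auto

lemma Ck_on_bounded_linear: "bounded_linear f \<Longrightarrow> open W \<Longrightarrow> Ck_on k W f"
proof (cases k)
  case (Suc n)
  assume "bounded_linear f" "open W"
  then show ?thesis unfolding Suc
    by (intro Ck_on_SucI[of W f "\<lambda>x. f"] Ck_on_const) (auto intro: bounded_linear_imp_has_derivative)
qed (simp add: linear_continuous_on)

lemma Ck_on_add: "open W \<Longrightarrow> Ck_on k W f \<Longrightarrow> Ck_on k W g \<Longrightarrow> Ck_on k W (\<lambda>x. f x + g x)"
proof (induction k arbitrary: f g)
  case (Suc k)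
  show ?case
  proof (rule Ck_on_SucI[OF Suc.prems(1)])
    show "((\<lambda>x. f x + g x) has_derivative
        (\<lambda>v. frechet_derivative f (at x) v + frechet_derivative g (at x) v)) (at x)" if "x \<in> W" for x
      by (rule has_derivative_add) (use Suc.prems that Ck_on_SucD in blast)+
    show "Ck_on k W (\<lambda>x. frechet_derivative f (at x) v + frechet_derivative g (at x) v)" for v
      by (rule Suc.IH) (use Suc.prems in auto)
  qed
qed (auto intro: continuous_intros)

lemma Ck_on_sum:
  "open W \<Longrightarrow> (\<And>i. i \<in> I \<Longrightarrow> Ck_on k W (f i)) \<Longrightarrow> Ck_on k W (\<lambda>x. \<Sum>i\<in>I. f i x)"
  by (induction I rule: infinite_finite_induct) (auto intro!: Ck_on_add Ck_on_const)

text \<open>The product rule writes the derivative as a sum of two values of \<open>h\<close>, each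
  with one factor undifferentiated; hence the induction over arbitrary \<open>f\<close> and
  \<open>g\<close>, and the need for both factors at the lower order.\<close>

lemma Ck_on_bilinear:
  assumes "bounded_bilinear h" "open W"
  shows "Ck_on k W f \<Longrightarrow> Ck_on k W g \<Longrightarrow> Ck_on k W (\<lambda>x. h (f x) (g x))"
proof (induction k arbitrary: f g)
  case 0
  then show ?case using bounded_bilinear.continuous_on[OF assms(1)] by auto
next
  case (Suc k)
  have fg: "Ck_on k W f" "Ck_on k W g" using Suc.prems Ck_on_Suc_le by blast+
  show ?case
  proof (rule Ck_on_SucI[OF assms(2)])
    fix x assume "x \<in> W"
    then show "((\<lambda>x. h (f x) (g x)) has_derivative
        (\<lambda>v. h (f x) (frechet_derivative g (at x) v) + h (frechet_derivative f (at x) v) (g x))) (at x)"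
      by (intro bounded_bilinear.FDERIV[OF assms(1)] Ck_on_SucD[OF Suc.prems(1)] Ck_on_SucD[OF Suc.prems(2)])
  next
    fix v
    have "Ck_on k W (\<lambda>x. frechet_derivative f (at x) v)" "Ck_on k W (\<lambda>x. frechet_derivative g (at x) v)"
      using Suc.prems by simp_all
    then show "Ck_on k W (\<lambda>x. h (f x) (frechet_derivative g (at x) v) + h (frechet_derivative f (at x) v) (g x))"
      by (intro Ck_on_add assms(2) Suc.IH fg)
  qed
qed

text \<open>The recursion only speaks about derivatives in fixed directions, while the chain rule
  differentiates \<open>g\<close> in a direction that varies with the point. Expanding that
  direction in a basis of the Euclidean middle space leaves products of functions covered by the
  induction.\<close>

lemma Ck_on_compose:
  fixes f :: "'a::real_normed_vector \<Rightarrow> 'b::euclidean_space" and g :: "'b \<Rightarrow> 'c::real_normed_vector"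
  assumes "open W" "open V" "f ` W \<subseteq> V"
  shows "Ck_on k W f \<Longrightarrow> Ck_on k V g \<Longrightarrow> Ck_on k W (\<lambda>x. g (f x))"
proof (induction k arbitrary: g)
  case 0
  then show ?case using continuous_on_compose2[OF _ _ assms(3), of g] by simp
next
  case (Suc k)
  have f: "(f has_derivative frechet_derivative f (at x)) (at x)" if "x \<in> W" for x
    using that Ck_on_SucD[OF Suc.prems(1)] by blast
  have g: "(g has_derivative frechet_derivative g (at y)) (at y)" if "y \<in> V" for y
    using that Ck_on_SucD[OF Suc.prems(2)] by blast
  have h: "((\<lambda>x. g (f x)) has_derivative
      (\<lambda>v. \<Sum>b\<in>Basis. (frechet_derivative f (at x) v \<bullet> b) *\<^sub>R frechet_derivative g (at (f x)) b)) (at x)"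
    if "x \<in> W" for x
  proof -
    have lin: "linear (frechet_derivative g (at (f x)))"
      using g assms(3) that has_derivative_linear by blast
    have eq: "(\<Sum>b\<in>Basis. (u \<bullet> b) *\<^sub>R frechet_derivative g (at (f x)) b) = frechet_derivative g (at (f x)) u" for u
    proof -
      have "frechet_derivative g (at (f x)) u = frechet_derivative g (at (f x)) (\<Sum>b\<in>Basis. (u \<bullet> b) *\<^sub>R b)"
        by (simp add: euclidean_representation)
      also have "\<dots> = (\<Sum>b\<in>Basis. (u \<bullet> b) *\<^sub>R frechet_derivative g (at (f x)) b)"
        by (simp add: linear_sum[OF lin] linear_cmul[OF lin])
      finally show ?thesis by simp
    qed
    show ?thesis unfolding eq
      using diff_chain_at[OF f[OF that] g[of "f x"]] assms(3) that by (auto simp: o_def)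
  qed
  have "Ck_on k W (\<lambda>x. \<Sum>b\<in>Basis. (frechet_derivative f (at x) v \<bullet> b) *\<^sub>R frechet_derivative g (at (f x)) b)" for v
  proof (intro Ck_on_sum assms Ck_on_bilinear[OF bounded_bilinear_scaleR])
    fix b :: 'b
    show "Ck_on k W (\<lambda>x. frechet_derivative f (at x) v \<bullet> b)"
      using Suc.prems(1) by (intro Ck_on_bilinear[OF bounded_bilinear_inner] assms Ck_on_const) auto
    show "Ck_on k W (\<lambda>x. frechet_derivative g (at (f x)) b)"
      using Suc.IH[of "\<lambda>y. frechet_derivative g (at y) b"] Suc.prems Ck_on_Suc_le by auto
  qed
  then show ?case by (intro Ck_on_SucI[OF assms(1)]) (rule h)
qed

text \<open>The derivative is a constant multiple of the function itself, so the induction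
  hypothesis applies directly.\<close>

lemma Ck_on_exp: "Ck_on k UNIV (exp :: complex \<Rightarrow> complex)"
proof (induction k)
  case (Suc k)
  have "(exp has_derivative (\<lambda>h. exp z * h)) (at z)" for z :: complex
    using DERIV_exp[of z] by (simp add: has_field_derivative_def)
  moreover have "Ck_on k UNIV (\<lambda>z. exp z * v)" for v :: complex
    by (rule Ck_on_bilinear[OF bounded_bilinear_mult open_UNIV Suc Ck_on_const])
  ultimately show ?case by (rule Ck_on_SucI[OF open_UNIV])
qed (auto intro: continuous_intros)

text \<open>The derivative is a constant times the square of the function itself, so the bilinear
  rule closes the induction.\<close>

lemma Ck_on_inverse: "Ck_on k (- {0}) (inverse :: complex \<Rightarrow> complex)"
proof (induction k)
  case (Suc k)
  have o: "open (- {0 :: complex})" by (simp add: open_Compl)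
  have "(inverse has_derivative (\<lambda>h. (- h) * (inverse z * inverse z))) (at z)" if "z \<in> - {0}" for z :: complex
    by (rule has_derivative_eq_rhs[OF DERIV_inverse[of z UNIV, unfolded has_field_derivative_def]])
      (use that in \<open>auto simp: fun_eq_iff power2_eq_square\<close>)
  moreover have "Ck_on k (- {0}) (\<lambda>z. (- v) * (inverse z * inverse z))" for v :: complex
    by (rule Ck_on_bilinear[OF bounded_bilinear_mult o Ck_on_const Ck_on_bilinear[OF bounded_bilinear_mult o Suc Suc]])
  ultimately show ?case by (rule Ck_on_SucI[OF o])
qed (auto intro!: continuous_intros)

section \<open>Smoothness on arbitrary subsets through local extensions\<close>

lemma smooth_onI:
  "(\<And>x. x \<in> D \<Longrightarrow> \<exists>W g. open W \<and> x \<in> W \<and> (\<forall>k. Ck_on k W g) \<and> (\<forall>y\<in>W \<inter> D. g y = f y)) \<Longrightarrow> smooth_on D f"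
  by (auto simp: smooth_on_def)

lemma smooth_onE:
  assumes "smooth_on D f" "x \<in> D"
  obtains W g where "open W" "x \<in> W" "\<And>k. Ck_on k W g" "\<And>y. y \<in> W \<Longrightarrow> y \<in> D \<Longrightarrow> g y = f y"
proof -
  from assms(1)[unfolded smooth_on_def, rule_format, OF assms(2)]
  obtain W g where "open W" "x \<in> W" "\<forall>k. Ck_on k W g" "\<forall>y\<in>W \<inter> D. g y = f y" by (elim exE conjE)
  then show ?thesis by (intro that[of W g]) auto
qed

lemma smooth_on_subset: "smooth_on D f \<Longrightarrow> E \<subseteq> D \<Longrightarrow> smooth_on E f"
proof (rule smooth_onI)
  fix x assume "smooth_on D f" "E \<subseteq> D" "x \<in> E"
  then obtain W g where "open W" "x \<in> W" "\<And>k. Ck_on k W g" "\<And>y. y \<in> W \<Longrightarrow> y \<in> D \<Longrightarrow> g y = f y"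
    using smooth_onE[of D f x] by (metis subsetD)
  then show "\<exists>W g. open W \<and> x \<in> W \<and> (\<forall>k. Ck_on k W g) \<and> (\<forall>y\<in>W \<inter> E. g y = f y)"
    using \<open>E \<subseteq> D\<close> by (intro exI[of _ W] exI[of _ g]) auto
qed

lemma smooth_on_cong: "(\<And>x. x \<in> D \<Longrightarrow> f x = g x) \<Longrightarrow> smooth_on D f \<longleftrightarrow> smooth_on D g"
  unfolding smooth_on_def by auto

lemma smooth_on_local:
  assumes "\<And>x. x \<in> D \<Longrightarrow> \<exists>E. openin (top_of_set D) E \<and> x \<in> E \<and> smooth_on E f"
  shows "smooth_on D f"
proof (rule smooth_onI)
  fix x assume "x \<in> D"
  then obtain E where E: "openin (top_of_set D) E" "x \<in> E" "smooth_on E f" using assms by blast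
  obtain T where T: "open T" "E = D \<inter> T" using E(1) by (auto simp: openin_open)
  obtain W g where W: "open W" "x \<in> W" "\<And>k. Ck_on k W g" "\<And>y. y \<in> W \<Longrightarrow> y \<in> E \<Longrightarrow> g y = f y"
    using smooth_onE[OF E(3,2)] by blast
  then show "\<exists>W g. open W \<and> x \<in> W \<and> (\<forall>k. Ck_on k W g) \<and> (\<forall>y\<in>W \<inter> D. g y = f y)"
    using T E by (intro exI[of _ "W \<inter> T"] exI[of _ g]) (auto intro: Ck_on_subset)
qed

lemma smooth_on_const: "smooth_on D (\<lambda>x. c)"
  by (intro smooth_onI exI[of _ UNIV] exI[of _ "\<lambda>x. c"]) (auto intro: Ck_on_const)

lemma smooth_on_bounded_linear: "bounded_linear f \<Longrightarrow> smooth_on D f"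
  by (intro smooth_onI exI[of _ UNIV] exI[of _ f]) (auto intro: Ck_on_bounded_linear)

lemma smooth_on_id: "smooth_on D (\<lambda>x. x)"
  by (rule smooth_on_bounded_linear) (rule bounded_linear_ident)

lemma Ck_on_imp_smooth_on: "open W \<Longrightarrow> (\<And>k. Ck_on k W f) \<Longrightarrow> D \<subseteq> W \<Longrightarrow> smooth_on D f"
  by (intro smooth_onI exI[of _ W] exI[of _ f]) auto

text \<open>Local extensions of \<open>f\<close> and \<open>g\<close> live on different
  neighbourhoods; passing to the intersection is done here once for sums, products and
  pairs.\<close>

lemma smooth_on_binary:
  fixes D :: "'a::real_normed_vector set"
  assumes Ck: "\<And>k (W :: 'a set) f g. open W \<Longrightarrow> Ck_on k W f \<Longrightarrow> Ck_on k W g \<Longrightarrow> Ck_on k W (\<lambda>x. h (f x) (g x))"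
    and "smooth_on D f" "smooth_on D g"
  shows "smooth_on D (\<lambda>x. h (f x) (g x))"
proof (rule smooth_onI)
  fix x assume "x \<in> D"
  obtain W f1 where W: "open W" "x \<in> W" "\<And>k. Ck_on k W f1" "\<And>y. y \<in> W \<Longrightarrow> y \<in> D \<Longrightarrow> f1 y = f y"
    using smooth_onE[OF assms(2) \<open>x \<in> D\<close>] by blast
  obtain V g1 where V: "open V" "x \<in> V" "\<And>k. Ck_on k V g1" "\<And>y. y \<in> V \<Longrightarrow> y \<in> D \<Longrightarrow> g1 y = g y"
    using smooth_onE[OF assms(3) \<open>x \<in> D\<close>] by blast
  have "Ck_on n (W \<inter> V) (\<lambda>x. h (f1 x) (g1 x))" for n
    by (rule Ck) (use W(1) V(1) in \<open>auto intro: Ck_on_subset[OF W(3)] Ck_on_subset[OF V(3)]\<close>)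
  then show "\<exists>W k. open W \<and> x \<in> W \<and> (\<forall>n. Ck_on n W k) \<and> (\<forall>y\<in>W \<inter> D. k y = h (f y) (g y))"
    using W(1,2,4) V(1,2,4) by (intro exI[of _ "W \<inter> V"] exI[of _ "\<lambda>x. h (f1 x) (g1 x)"]) auto
qed

lemma smooth_on_bilinear:
  "bounded_bilinear h \<Longrightarrow> smooth_on D f \<Longrightarrow> smooth_on D g \<Longrightarrow> smooth_on D (\<lambda>x. h (f x) (g x))"
  by (rule smooth_on_binary[OF Ck_on_bilinear])

lemmas smooth_on_mult = smooth_on_bilinear[OF bounded_bilinear_mult]
lemmas smooth_on_scaleR = smooth_on_bilinear[OF bounded_bilinear_scaleR]

lemma smooth_on_add: "smooth_on D f \<Longrightarrow> smooth_on D g \<Longrightarrow> smooth_on D (\<lambda>x. f x + g x)"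
  by (rule smooth_on_binary[OF Ck_on_add])

lemma smooth_on_imp_continuous_on: 
  assumes "smooth_on D f" shows "continuous_on D f"
proof (subst continuous_on_eq_continuous_within, intro ballI)
  fix x assume x: "x \<in> D"
  obtain W g where W: "open W" "x \<in> W" "\<And>k. Ck_on k W g" "\<And>y. y \<in> W \<Longrightarrow> y \<in> D \<Longrightarrow> g y = f y"
    using smooth_onE[OF assms x] by blast
  have "isCont g x" using W(1,2) W(3)[of 0] by (simp add: continuous_on_eq_continuous_at)
  then have "continuous (at x within D) g" using continuous_at_imp_continuous_at_within by blast
  then have "continuous (at x within D \<inter> W) g" using continuous_within_subset by blast
  then have "continuous (at x within D \<inter> W) f"
    using W(2,4) x continuous_transform_within[of x "D \<inter> W" g 1 f] by (metis IntD1 IntD2 IntI zero_less_one)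
  then show "continuous (at x within D) f"
    using at_within_nhd[OF W(2,1), of D "D \<inter> W"] by (simp add: Int_assoc continuous_within)
qed

lemma smooth_on_compose:
  fixes f :: "'a::real_normed_vector \<Rightarrow> 'b::euclidean_space" and g :: "'b \<Rightarrow> 'c::real_normed_vector"
  assumes "smooth_on E g" "smooth_on D f" "\<And>x. x \<in> D \<Longrightarrow> f x \<in> E"
  shows "smooth_on D (\<lambda>x. g (f x))"
proof (rule smooth_onI)
  fix x assume x: "x \<in> D"
  obtain W f1 where W: "open W" "x \<in> W" "\<And>k. Ck_on k W f1" "\<And>y. y \<in> W \<Longrightarrow> y \<in> D \<Longrightarrow> f1 y = f y"
    using smooth_onE[OF assms(2) x] by blast
  obtain V g1 where V: "open V" "f x \<in> V" "\<And>k. Ck_on k V g1" "\<And>y. y \<in> V \<Longrightarrow> y \<in> E \<Longrightarrow> g1 y = g y"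
    using smooth_onE[OF assms(1,3)] x by blast
  \<comment> \<open>The extension \<open>f1\<close> may leave the set on which \<open>g1\<close> is
    defined, so its domain is cut down to a preimage.\<close>
  have o: "open (f1 -` V \<inter> W)"
    using continuous_open_preimage[of W f1 V] W(1) W(3)[of 0] V(1) by (simp add: Int_commute)
  show "\<exists>W k. open W \<and> x \<in> W \<and> (\<forall>n. Ck_on n W k) \<and> (\<forall>y\<in>W \<inter> D. k y = g (f y))"
  proof (intro exI[of _ "f1 -` V \<inter> W"] exI[of _ "\<lambda>x. g1 (f1 x)"] conjI allI ballI)
    show "Ck_on n (f1 -` V \<inter> W) (\<lambda>x. g1 (f1 x))" for n
      by (rule Ck_on_compose[OF o V(1) _ _ V(3)]) (auto intro: Ck_on_subset[OF W(3)])
    show "x \<in> f1 -` V \<inter> W" using W(2,4) V(2) x by simp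
    show "g1 (f1 y) = g (f y)" if "y \<in> f1 -` V \<inter> W \<inter> D" for y
      using that W(4)[of y] V(4)[of "f y"] assms(3) by auto
  qed (rule o)
qed

lemma Ck_on_Pair: "open A \<Longrightarrow> Ck_on k A f \<Longrightarrow> Ck_on k A g \<Longrightarrow> Ck_on k A (\<lambda>x. (f x, g x))"
proof (induction k arbitrary: f g)
  case (Suc k)
  show ?case
  proof (rule Ck_on_SucI[OF Suc.prems(1)])
    show "((\<lambda>x. (f x, g x)) has_derivative
        (\<lambda>v. (frechet_derivative f (at x) v, frechet_derivative g (at x) v))) (at x)" if "x \<in> A" for x
      by (rule has_derivative_Pair) (use Suc.prems that Ck_on_SucD in blast)+
    show "Ck_on k A (\<lambda>x. (frechet_derivative f (at x) v, frechet_derivative g (at x) v))" for v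
      by (rule Suc.IH) (use Suc.prems in auto)
  qed
qed (auto intro: continuous_intros)

lemma smooth_on_Pair: "smooth_on D f \<Longrightarrow> smooth_on D g \<Longrightarrow> smooth_on D (\<lambda>x. (f x, g x))"
  by (rule smooth_on_binary[OF Ck_on_Pair])

lemma smooth_on_snd:
  fixes f :: "'a::real_normed_vector \<Rightarrow> 'b::euclidean_space \<times> 'c::euclidean_space"
  shows "smooth_on D f \<Longrightarrow> smooth_on D (\<lambda>x. snd (f x))"
  using smooth_on_compose[OF smooth_on_bounded_linear[OF bounded_linear_snd, of UNIV], of D f] by auto

section \<open>Directional derivatives on open subsets of subspaces\<close>

text \<open>The line through \<open>p\<close> in direction \<open>v\<close> stays in
  \<open>D\<close> for small times, since \<open>D\<close> is open in \<open>S\<close> and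
  \<open>v\<close> lies in \<open>S\<close>. So a derivative within \<open>D\<close>, which is
  determined only along \<open>S\<close>, determines the directional derivative.\<close>

lemma dir_deriv_eq:
  assumes S: "subspace S" "openin (top_of_set S) D" "p \<in> D" "v \<in> S"
    and f: "(f has_derivative f') (at p within D)"
  shows "dir_deriv f p v = f' v"
proof -
  obtain T where T: "open T" "D = S \<inter> T" using S(2) by (auto simp: openin_open)
  have "open ((\<lambda>t. p + t *\<^sub>R v) -` T)"
    by (intro open_vimage T continuous_intros)
  moreover have "(\<lambda>t. p + t *\<^sub>R v) -` D = (\<lambda>t. p + t *\<^sub>R v) -` T"
    using S T by (auto intro!: subspace_add subspace_scale)
  ultimately have o: "open ((\<lambda>t. p + t *\<^sub>R v) -` D)" by simp
  have "((\<lambda>t. p + t *\<^sub>R v) has_derivative (\<lambda>t. t *\<^sub>R v)) (at 0 within ((\<lambda>t. p + t *\<^sub>R v) -` D))"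
    by (auto intro!: derivative_eq_intros)
  moreover have "(f has_derivative f') (at (p + 0 *\<^sub>R v) within (\<lambda>t. p + t *\<^sub>R v) ` (\<lambda>t. p + t *\<^sub>R v) -` D)"
    using f by (auto intro: has_derivative_subset)
  ultimately have "((\<lambda>t. f (p + t *\<^sub>R v)) has_derivative (\<lambda>t. f' (t *\<^sub>R v)))
      (at 0 within ((\<lambda>t. p + t *\<^sub>R v) -` D))"
    by (rule has_derivative_in_compose)
  then have "((\<lambda>t. f (p + t *\<^sub>R v)) has_derivative (\<lambda>t. f' (t *\<^sub>R v))) (at 0)"
    using o S(3) at_within_open[of 0 "(\<lambda>t. p + t *\<^sub>R v) -` D"] by simp
  moreover have "f' (t *\<^sub>R v) = t *\<^sub>R f' v" for t
    using f by (simp add: has_derivative_linear linear_cmul)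
  ultimately have "((\<lambda>t. f (p + t *\<^sub>R v)) has_vector_derivative f' v) (at 0)"
    by (simp add: has_vector_derivative_def)
  then show ?thesis by (simp add: dir_deriv_def vector_derivative_at)
qed

lemma smooth_on_has_derivative:
  assumes "smooth_on D f" "p \<in> D"
  obtains f' where "(f has_derivative f') (at p within D)"
proof -
  obtain W g where W: "open W" "p \<in> W" "\<And>k. Ck_on k W g" "\<And>y. y \<in> W \<Longrightarrow> y \<in> D \<Longrightarrow> g y = f y"
    using smooth_onE[OF assms] by blast
  have "(g has_derivative frechet_derivative g (at p)) (at p within D)"
    using Ck_on_SucD[OF W(3) W(2)] has_derivative_at_withinI by blast
  then have "(f has_derivative frechet_derivative g (at p)) (at p within D)"
  proof -
    obtain d where "d > 0" "ball p d \<subseteq> W" using W(1,2) open_contains_ball by blast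
    then show ?thesis
      using \<open>(g has_derivative frechet_derivative g (at p)) (at p within D)\<close> W(4)
        has_derivative_transform_within[of g _ p D d f] assms(2) by (auto simp: dist_commute subset_iff)
  qed
  then show ?thesis using that by blast
qed

lemma smooth_on_has_dir_deriv:
  assumes S: "subspace S" "openin (top_of_set S) D" "p \<in> D" and "smooth_on D f"
  obtains f' where "(f has_derivative f') (at p within D)" "\<And>v. v \<in> S \<Longrightarrow> dir_deriv f p v = f' v"
  using smooth_on_has_derivative[OF assms(4,3)] dir_deriv_eq[OF S] by metis

lemma dir_deriv_add:
  assumes "subspace S" "openin (top_of_set S) D" "p \<in> D" "smooth_on D f" "u \<in> S" "v \<in> S"
  shows "dir_deriv f p (u + v) = dir_deriv f p u + dir_deriv f p v"
  using smooth_on_has_dir_deriv[OF assms(1-4)] assms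
  by (metis has_derivative_linear linear_add subspace_add)

lemma dir_deriv_scale:
  assumes "subspace S" "openin (top_of_set S) D" "p \<in> D" "smooth_on D f" "v \<in> S"
  shows "dir_deriv f p (r *\<^sub>R v) = r *\<^sub>R dir_deriv f p v"
  using smooth_on_has_dir_deriv[OF assms(1-4)] assms
  by (metis has_derivative_linear linear_cmul subspace_scale)

lemma dir_deriv_cong:
  assumes "subspace S" "openin (top_of_set S) D" "p \<in> D" "v \<in> S" "\<And>q. q \<in> D \<Longrightarrow> f q = g q" "smooth_on D f"
  shows "dir_deriv f p v = dir_deriv g p v"
proof -
  obtain f' where f': "(f has_derivative f') (at p within D)" "\<And>v. v \<in> S \<Longrightarrow> dir_deriv f p v = f' v"
    using smooth_on_has_dir_deriv[OF assms(1-3,6)] by blast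
  have "(g has_derivative f') (at p within D)"
    using has_derivative_transform[OF assms(3) _ f'(1)] assms(5) by simp
  then show ?thesis using f'(2) dir_deriv_eq[OF assms(1-4)] assms(4) by metis
qed

lemma dir_deriv_const:
  assumes "subspace S" "openin (top_of_set S) D" "p \<in> D" "v \<in> S" "\<And>q. q \<in> D \<Longrightarrow> f q = c"
  shows "dir_deriv f p v = 0"
proof -
  have "(f has_derivative (\<lambda>_. 0)) (at p within D)"
    using has_derivative_transform[OF assms(3) _ has_derivative_const[of c]] assms(5) by blast
  then show ?thesis by (rule dir_deriv_eq[OF assms(1-4)])
qed

lemma dir_deriv_id:
  assumes "subspace S" "openin (top_of_set S) D" "p \<in> D" "v \<in> S" "\<And>q. q \<in> D \<Longrightarrow> f q = q"
  shows "dir_deriv f p v = v"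
proof -
  have "(f has_derivative (\<lambda>v. v)) (at p within D)"
    using has_derivative_transform[OF assms(3) _ has_derivative_ident] assms(5) by blast
  then show ?thesis by (rule dir_deriv_eq[OF assms(1-4)])
qed

text \<open>A vector orthogonal to \<open>S'\<close> has inner product 0 with all values of
  \<open>f\<close> on \<open>D\<close>, hence also with the derivative; so the component of the
  derivative orthogonal to \<open>S'\<close> vanishes.\<close>

lemma dir_deriv_in_subspace:
  fixes f :: "'a::real_normed_vector \<Rightarrow> 'b::euclidean_space"
  assumes "subspace S" "openin (top_of_set S) D" "p \<in> D" "v \<in> S" "smooth_on D f"
    and "subspace S'" "f ` D \<subseteq> S'"
  shows "dir_deriv f p v \<in> S'"
proof -
  obtain f' where f': "(f has_derivative f') (at p within D)" "\<And>v. v \<in> S \<Longrightarrow> dir_deriv f p v = f' v"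
    using smooth_on_has_dir_deriv[OF assms(1-3,5)] by blast
  have "orthogonal w (f' v)" if w: "\<And>u. u \<in> S' \<Longrightarrow> orthogonal w u" for w
  proof -
    have "((\<lambda>q. w \<bullet> f q) has_derivative (\<lambda>v. w \<bullet> f' v)) (at p within D)"
      by (rule has_derivative_inner_right[OF f'(1)])
    then have "dir_deriv (\<lambda>q. w \<bullet> f q) p v = w \<bullet> f' v" by (rule dir_deriv_eq[OF assms(1-4)])
    moreover have "dir_deriv (\<lambda>q. w \<bullet> f q) p v = 0"
      by (rule dir_deriv_const[OF assms(1-4), of _ 0]) (use w assms(7) in \<open>auto simp: orthogonal_def\<close>)
    ultimately show ?thesis by (simp add: orthogonal_def)
  qed
  moreover obtain y z where yz: "y \<in> span S'" "\<And>w. w \<in> span S' \<Longrightarrow> orthogonal z w" "f' v = y + z"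
    using orthogonal_subspace_decomp_exists[of S' "f' v"] by metis
  ultimately have "orthogonal z (y + z)" by (metis span_base)
  then have "z = 0" using yz(1,2) by (simp add: orthogonal_def inner_add_right)
  then show ?thesis using yz assms(4,6) f'(2) by (simp add: span_eq_iff[THEN iffD2])
qed

text \<open>The derivative of \<open>g\<close> within \<open>E\<close> is tied to
  \<open>dir_deriv\<close> only along \<open>S'\<close>; \<open>dir_deriv_in_subspace\<close> places
  the inner derivative there.\<close>

lemma dir_deriv_compose:
  fixes f :: "'a::real_normed_vector \<Rightarrow> 'b::euclidean_space" and g :: "'b \<Rightarrow> 'c::real_normed_vector"
  assumes "subspace S" "openin (top_of_set S) D" "p \<in> D" "v \<in> S" "smooth_on D f"
    and "subspace S'" "openin (top_of_set S') E" "f ` D \<subseteq> E" "smooth_on E g"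
  shows "dir_deriv (\<lambda>x. g (f x)) p v = dir_deriv g (f p) (dir_deriv f p v)"
proof -
  obtain f' where f': "(f has_derivative f') (at p within D)" "\<And>v. v \<in> S \<Longrightarrow> dir_deriv f p v = f' v"
    using smooth_on_has_dir_deriv[OF assms(1-3,5)] by blast
  have fp: "f p \<in> E" using assms by blast
  obtain g' where g': "(g has_derivative g') (at (f p) within E)" "\<And>v. v \<in> S' \<Longrightarrow> dir_deriv g (f p) v = g' v"
    using smooth_on_has_dir_deriv[OF assms(6,7) fp assms(9)] by blast
  have "((\<lambda>x. g (f x)) has_derivative (\<lambda>x. g' (f' x))) (at p within D)"
    by (rule has_derivative_in_compose[OF f'(1) has_derivative_subset[OF g'(1) assms(8)]])
  then have "dir_deriv (\<lambda>x. g (f x)) p v = g' (f' v)" by (rule dir_deriv_eq[OF assms(1-4)])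
  moreover have "E \<subseteq> S'" using assms(7) openin_imp_subset by blast
  then have "dir_deriv f p v \<in> S'"
    by (intro dir_deriv_in_subspace[OF assms(1-6)]) (use assms(8) in auto)
  ultimately show ?thesis using f'(2) g'(2) assms(4) by metis
qed

text \<open>The derivative in direction \<open>v\<close> of a local extension is itself a local
  extension of the directional derivative: as \<open>v\<close> is tangent to \<open>S\<close>, only
  values on \<open>D\<close> are seen.\<close>

lemma smooth_on_dir_deriv:
  fixes f :: "'a::real_normed_vector \<Rightarrow> 'b::real_normed_vector"
  assumes S: "subspace S" "openin (top_of_set S) D" and f: "smooth_on D f" and v: "v \<in> S"
  shows "smooth_on D (\<lambda>p. dir_deriv f p v)"
proof (rule smooth_onI)
  fix x assume x: "x \<in> D"
  obtain W g where W: "open W" "x \<in> W" "\<And>k. Ck_on k W g" "\<And>y. y \<in> W \<Longrightarrow> y \<in> D \<Longrightarrow> g y = f y"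
    using smooth_onE[OF f x] by blast
  have "frechet_derivative g (at y) v = dir_deriv f y v" if y: "y \<in> W \<inter> D" for y
  proof -
    obtain T where T: "open T" "D = S \<inter> T" using S(2) by (auto simp: openin_open)
    have o: "openin (top_of_set S) (W \<inter> D)"
      by (intro openin_open_Int[of "W \<inter> T" S, THEN back_subst[of "openin _"]] open_Int) (use T W(1) in auto)
    have "(g has_derivative frechet_derivative g (at y)) (at y within W \<inter> D)"
      using Ck_on_SucD[OF W(3)] y has_derivative_at_withinI by blast
    then have "(f has_derivative frechet_derivative g (at y)) (at y within W \<inter> D)"
      by (rule has_derivative_transform[OF y, rotated]) (use W(4) in auto)
    then show ?thesis by (rule dir_deriv_eq[OF S(1) o y v, symmetric])
  qed
  moreover have "Ck_on k W (\<lambda>y. frechet_derivative g (at y) v)" for k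
    using W(3)[of "Suc k"] by simp
  ultimately show "\<exists>W g. open W \<and> x \<in> W \<and> (\<forall>k. Ck_on k W g) \<and> (\<forall>y\<in>W \<inter> D. g y = dir_deriv f y v)"
    using W(1,2) by (intro exI[of _ W] exI[of _ "\<lambda>y. frechet_derivative g (at y) v"]) auto
qed

section \<open>The Poincare lemma for 1-forms\<close>

lemma smooth_on_imp_Ck_on:
  assumes "open W" "smooth_on W f"
  shows "Ck_on k W f"
proof (rule Ck_on_local)
  fix x assume "x \<in> W"
  then obtain V g where V: "open V" "x \<in> V" "\<And>k. Ck_on k V g" "\<And>y. y \<in> V \<Longrightarrow> y \<in> W \<Longrightarrow> g y = f y"
    using smooth_onE[OF assms(2)] by blast
  have "Ck_on k (V \<inter> W) f"
    by (rule Ck_on_cong[of _ g]) (use V assms(1) Ck_on_subset[OF V(3), of "V \<inter> W"] in auto)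
  then show "\<exists>V. open V \<and> x \<in> V \<and> Ck_on k V f"
    using V(1,2) assms(1) \<open>x \<in> W\<close> by blast
qed

text \<open>The primitive integrates \<open>\<beta>\<close> along the segments issuing from
  \<open>c\<close>. After differentiation under the integral, closedness exchanges the two
  directions and makes the integrand the time derivative of t times
  \<open>\<beta> (\<gamma> x t) h\<close>, which integrates to \<open>\<beta> x h\<close>.\<close>

lemma poincare_convex:
  fixes \<beta> :: "'a::euclidean_space \<Rightarrow> 'a \<Rightarrow> complex"
  assumes W: "open W" "convex W" "c \<in> W"
    and lin: "\<And>x. x \<in> W \<Longrightarrow> linear (\<beta> x)"
    and smooth: "\<And>v. smooth_on W (\<lambda>x. \<beta> x v)"
    and closed: "\<And>x u v. x \<in> W \<Longrightarrow>
      frechet_derivative (\<lambda>x. \<beta> x u) (at x) v = frechet_derivative (\<lambda>x. \<beta> x v) (at x) u"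
  obtains G where "smooth_on W G" "\<And>x. x \<in> W \<Longrightarrow> (G has_derivative \<beta> x) (at x)"
proof -
  define D where "D x u = frechet_derivative (\<lambda>x. \<beta> x u) (at x)" for x u
  define \<gamma> where "\<gamma> x t = c + t *\<^sub>R (x - c)" for x and t :: real
  define f where "f x t = \<beta> (\<gamma> x t) (x - c)" for x t
  \<comment> \<open>The derivative of \<open>f\<close> in \<open>x\<close> with closedness already
    applied: the last term would otherwise be the derivative in direction \<open>h\<close> of the
    coefficient at \<open>x - c\<close>.\<close>
  define f' where "f' x t h = \<beta> (\<gamma> x t) h + t *\<^sub>R D (\<gamma> x t) h (x - c)" for x t h
  note Ck = smooth_on_imp_Ck_on[OF W(1) smooth]
  have D: "((\<lambda>x. \<beta> x u) has_derivative D x u) (at x)" if "x \<in> W" for x u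
    unfolding D_def using Ck_on_SucD[OF Ck that] by blast
  have Dlin: "linear (D x u)" if "x \<in> W" for x u using D[OF that] has_derivative_linear by blast
  have \<gamma>: "\<gamma> x t \<in> W" if "x \<in> W" "t \<in> {0..1}" for x t
  proof -
    have "\<gamma> x t = (1 - t) *\<^sub>R c + t *\<^sub>R x" by (simp add: \<gamma>_def algebra_simps)
    then show ?thesis using W(2,3) that by (simp add: convex_alt)
  qed
  have expand: "linear g \<Longrightarrow> g w = (\<Sum>b\<in>Basis. (w \<bullet> b) *\<^sub>R g b)" for g :: "'a \<Rightarrow> complex" and w
    by (metis (no_types, lifting) euclidean_representation linear_cmul linear_sum sum.cong)
  have f': "((\<lambda>x. f x t) has_derivative f' x t) (at x within W)" if "x \<in> W" "t \<in> {0..1}" for x t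
  proof -
    have g: "((\<lambda>x. \<gamma> x t) has_derivative (\<lambda>h. t *\<^sub>R h)) (at x)"
      unfolding \<gamma>_def by (auto intro!: derivative_eq_intros)
    have b: "((\<lambda>x. \<beta> (\<gamma> x t) b) has_derivative (\<lambda>h. D (\<gamma> x t) b (t *\<^sub>R h))) (at x)" for b
      using diff_chain_at[OF g D[OF \<gamma>[OF that]]] by (simp add: o_def)
    \<comment> \<open>Here \<open>x\<close> is both base point and argument of
      \<open>\<beta>\<close>; expanding \<open>x - c\<close> in the basis leaves
      \<open>\<beta>\<close> at fixed vectors, whose derivatives are known.\<close>
    have "((\<lambda>x. \<Sum>b\<in>Basis. ((x - c) \<bullet> b) *\<^sub>R \<beta> (\<gamma> x t) b) has_derivative
        (\<lambda>h. \<Sum>b\<in>Basis. ((x - c) \<bullet> b) *\<^sub>R D (\<gamma> x t) b (t *\<^sub>R h) + (h \<bullet> b) *\<^sub>R \<beta> (\<gamma> x t) b)) (at x)"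
      by (intro has_derivative_sum has_derivative_scaleR b) (auto intro!: derivative_eq_intros)
    moreover have "(\<Sum>b\<in>Basis. ((x - c) \<bullet> b) *\<^sub>R D (\<gamma> x t) b (t *\<^sub>R h) + (h \<bullet> b) *\<^sub>R \<beta> (\<gamma> x t) b) = f' x t h" for h
    proof -
      have "D (\<gamma> x t) b (t *\<^sub>R h) = t *\<^sub>R D (\<gamma> x t) h b" for b
        using closed[OF \<gamma>[OF that], of b h] linear_cmul[OF Dlin[OF \<gamma>[OF that]]] by (simp add: D_def)
      then have "(\<Sum>b\<in>Basis. ((x - c) \<bullet> b) *\<^sub>R D (\<gamma> x t) b (t *\<^sub>R h)) = t *\<^sub>R D (\<gamma> x t) h (x - c)"
        by (subst (2) expand[OF Dlin[OF \<gamma>[OF that]]]) (simp add: scaleR_sum_right mult.commute)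
      then show ?thesis
        by (simp add: sum.distrib f'_def expand[OF lin[OF \<gamma>[OF that]], of h])
    qed
    ultimately have "((\<lambda>x. \<Sum>b\<in>Basis. ((x - c) \<bullet> b) *\<^sub>R \<beta> (\<gamma> x t) b) has_derivative f' x t) (at x within W)"
      by (metis (no_types, lifting) ext has_derivative_at_withinI)
    then show ?thesis
      by (rule has_derivative_transform[OF that(1), rotated])
        (simp add: f_def expand[OF lin[OF \<gamma>[OF _ that(2)]]])
  qed
  have bl: "bounded_linear (f' x t)" if "x \<in> W" "t \<in> {0..1}" for x t
    using f'[OF that] has_derivative_bounded_linear by blast
  \<comment> \<open>Differentiation under the integral takes the derivative as a continuous family
    of bounded linear maps.\<close>
  define fb where "fb x t = Blinfun (f' x t)" for x t
  have fb: "blinfun_apply (fb x t) = f' x t" if "x \<in> W" "t \<in> {0..1}" for x t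
    unfolding fb_def by (rule bounded_linear_Blinfun_apply[OF bl[OF that]])
  have cont_\<gamma>: "continuous_on (W \<times> {0..1}) (\<lambda>(x, t). \<gamma> x t)"
    unfolding \<gamma>_def by (auto simp: split_beta intro!: continuous_intros)
  have cont: "continuous_on (W \<times> {0..1}) (\<lambda>z. g (\<gamma> (fst z) (snd z)))" if "continuous_on W g" for g :: "'a \<Rightarrow> complex"
  proof -
    have "(\<lambda>z. \<gamma> (fst z) (snd z)) ` (W \<times> {0..1}) \<subseteq> W" using \<gamma> by auto
    then show ?thesis using continuous_on_compose2[OF that cont_\<gamma>] by (simp add: split_beta)
  qed
  have cf: "continuous_on (W \<times> {0..1}) (\<lambda>(x, t). fb x t)"
  proof (rule continuous_on_blinfun_componentwise)
    fix b :: 'a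
    have "continuous_on W (\<lambda>x. \<beta> x b)" using Ck[of 0 b] by simp
    moreover have "continuous_on W (\<lambda>x. D x b b')" for b'
      using Ck[of 1 b] by (simp add: D_def)
    ultimately have "continuous_on (W \<times> {0..1}) (\<lambda>z. \<beta> (\<gamma> (fst z) (snd z)) b +
         snd z *\<^sub>R (\<Sum>b'\<in>Basis. ((fst z - c) \<bullet> b') *\<^sub>R D (\<gamma> (fst z) (snd z)) b b'))"
      by (intro continuous_intros cont) auto
    then show "continuous_on (W \<times> {0..1}) (\<lambda>z. blinfun_apply (case z of (x, t) \<Rightarrow> fb x t) b)"
      by (rule continuous_on_eq) (auto simp: fb f'_def expand[OF Dlin[OF \<gamma>], of _ _ _ "_ - _"])
  qed
  have int_f: "f x integrable_on {0..1}" if "x \<in> W" for x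
  proof (rule integrable_continuous_real)
    have "continuous_on {0..1} (\<lambda>t. \<gamma> x t)" unfolding \<gamma>_def by (intro continuous_intros)
    then show "continuous_on {0..1} (f x)"
      unfolding f_def using Ck[of 0 "x - c"] \<gamma>[OF that]
      by (intro continuous_on_compose2[of W "\<lambda>y. \<beta> y (x - c)" "{0..1}"]) auto
  qed
  define G where "G x = integral {0..1} (f x)" for x
  have G: "(G has_derivative \<beta> x) (at x)" if x: "x \<in> W" for x
  proof -
    have "(G has_derivative blinfun_apply (integral {0..1} (fb x))) (at x within W)"
      unfolding G_def
      using leibniz_rule[of W 0 1 f fb x] f' fb int_f cf x W(2) by simp
    moreover have "blinfun_apply (integral {0..1} (fb x)) h = \<beta> x h" for h
    proof -
      have "continuous_on {0..1} (fb x)"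
      proof -
        have "continuous_on {0..1 :: real} (Pair x)" by (intro continuous_intros)
        moreover have "Pair x ` {0..1} \<subseteq> W \<times> {0..1}" using x by auto
        ultimately show ?thesis using continuous_on_compose2[OF cf, of "{0..1}" "Pair x"] by simp
      qed
      then have "blinfun_apply (integral {0..1} (fb x)) h = integral {0..1} (\<lambda>t. blinfun_apply (fb x t) h)"
        by (intro blinfun_apply_integral integrable_continuous_real)
      also have "\<dots> = integral {0..1} (\<lambda>t. f' x t h)"
        by (rule integral_cong) (simp add: fb x)
      also have "((\<lambda>t. f' x t h) has_integral 1 *\<^sub>R \<beta> (\<gamma> x 1) h - 0 *\<^sub>R \<beta> (\<gamma> x 0) h) {0..1}"
      proof (rule fundamental_theorem_of_calculus)
        fix t :: real assume t: "t \<in> {0..1}"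
        have "((\<lambda>t. \<gamma> x t) has_vector_derivative (x - c)) (at t within {0..1})"
          unfolding \<gamma>_def by (auto intro!: derivative_eq_intros)
        then have "((\<lambda>t. \<beta> (\<gamma> x t) h) has_vector_derivative D (\<gamma> x t) h (x - c)) (at t within {0..1})"
          using vector_derivative_diff_chain_within[of "\<lambda>t. \<gamma> x t" "x - c" t "{0..1}" "\<lambda>y. \<beta> y h" "D (\<gamma> x t) h"]
            D[OF \<gamma>[OF x t], of h] has_derivative_at_withinI by (auto simp: o_def)
        then have "((\<lambda>t. t *\<^sub>R \<beta> (\<gamma> x t) h) has_vector_derivative
            t *\<^sub>R D (\<gamma> x t) h (x - c) + 1 *\<^sub>R \<beta> (\<gamma> x t) h) (at t within {0..1})"
          by (intro has_vector_derivative_scaleR) auto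
        then show "((\<lambda>t. t *\<^sub>R \<beta> (\<gamma> x t) h) has_vector_derivative f' x t h) (at t within {0..1})"
          by (simp add: f'_def add.commute)
      qed simp
      then have "integral {0..1} (\<lambda>t. f' x t h) = \<beta> x h"
        by (simp add: integral_unique \<gamma>_def)
      finally show ?thesis .
    qed
    ultimately show ?thesis using at_within_open[OF x W(1)] by (metis ext)
  qed
  \<comment> \<open>Higher orders require no further differentiation under the integral, because the
    derivative of \<open>G\<close> is the smooth form \<open>\<beta>\<close>.\<close>
  have "Ck_on k W G" for k
  proof (cases k)
    case 0
    then show ?thesis using G W(1)
      by (auto intro!: continuous_at_imp_continuous_on has_derivative_continuous)
  next
    case (Suc n)
    then show ?thesis using Ck_on_SucI[OF W(1) G Ck] by blast
  qed
  then show ?thesis using that[of G] G Ck_on_imp_smooth_on[OF W(1)] by blast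
qed

text \<open>Orthogonal projection, written in an orthonormal basis. It extends data from an open
  subset of \<open>S\<close> to an open subset of the ambient space.\<close>

lemma subspace_projection:
  fixes S :: "'a::euclidean_space set"
  assumes "subspace S"
  obtains \<pi> where "linear \<pi>" "\<And>x. \<pi> x \<in> S" "\<And>x. x \<in> S \<Longrightarrow> \<pi> x = x"
proof -
  obtain B where B: "B \<subseteq> S" "pairwise orthogonal B" "\<And>x. x \<in> B \<Longrightarrow> norm x = 1"
      "independent B" "span B = S"
    using orthonormal_basis_subspace[OF assms] by metis
  have fin: "finite B" using B(4) independent_bound_general by blast
  define \<pi> where "\<pi> x = (\<Sum>b\<in>B. (x \<bullet> b) *\<^sub>R b)" for x
  have lin: "linear \<pi>" unfolding \<pi>_def
    by (rule linearI) (auto simp: inner_add_left scaleR_add_left sum.distrib scaleR_sum_right)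
  have "\<pi> x \<in> S" for x unfolding \<pi>_def
    using B(1) assms by (intro subspace_sum subspace_scale) auto
  moreover have "\<pi> x = x" if "x \<in> S" for x
  proof (rule linear_eq_on[OF lin linear_id, unfolded id_def])
    show "x \<in> span B" using that B(5) by simp
    fix y assume y: "y \<in> B"
    have "y \<bullet> b = (if b = y then 1 else 0)" if "b \<in> B" for b
      using B(2,3) y that by (auto simp: pairwise_def orthogonal_def dot_square_norm)
    then have "\<pi> y = (\<Sum>b\<in>B. (if b = y then y else 0))" unfolding \<pi>_def by (intro sum.cong) auto
    then show "\<pi> y = y" using fin y by simp
  qed
  ultimately show ?thesis using that lin by blast
qed

text \<open>The form is pulled back along the projection to the preimage of \<open>D\<close>, which
  is open and convex in the ambient space; a primitive there restricts to one on
  \<open>D\<close>.\<close>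

lemma poincare_subspace:
  fixes B :: "'a::euclidean_space \<Rightarrow> 'a \<Rightarrow> complex"
  assumes S: "subspace S" "openin (top_of_set S) D" "convex D" "c \<in> D"
    and add: "\<And>x u v. x \<in> D \<Longrightarrow> u \<in> S \<Longrightarrow> v \<in> S \<Longrightarrow> B x (u + v) = B x u + B x v"
    and scale: "\<And>x u r. x \<in> D \<Longrightarrow> u \<in> S \<Longrightarrow> B x (r *\<^sub>R u) = r *\<^sub>R B x u"
    and smooth: "\<And>v. v \<in> S \<Longrightarrow> smooth_on D (\<lambda>x. B x v)"
    and closed: "\<And>x u v. x \<in> D \<Longrightarrow> u \<in> S \<Longrightarrow> v \<in> S \<Longrightarrow>
      dir_deriv (\<lambda>x. B x u) x v = dir_deriv (\<lambda>x. B x v) x u"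
  obtains G where "smooth_on D G" "\<And>x v. x \<in> D \<Longrightarrow> v \<in> S \<Longrightarrow> dir_deriv G x v = B x v"
proof -
  obtain \<pi> where \<pi>: "linear \<pi>" "\<And>x. \<pi> x \<in> S" "\<And>x. x \<in> S \<Longrightarrow> \<pi> x = x"
    using subspace_projection[OF S(1)] by blast
  have bl: "bounded_linear \<pi>" using \<pi>(1) by (simp add: linear_conv_bounded_linear)
  have DS: "D \<subseteq> S" using S(2) openin_imp_subset by blast
  define W where "W = \<pi> -` D"
  obtain T where T: "open T" "D = S \<inter> T" using S(2) by (auto simp: openin_open)
  have W: "open W" "convex W" "c \<in> W"
  proof -
    have "W = \<pi> -` T" unfolding W_def T using \<pi>(2) by auto
    then show "open W" using T(1) bl by (simp add: open_vimage linear_continuous_on)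
    show "convex W" unfolding W_def by (rule convex_linear_vimage[OF \<pi>(1) S(3)])
    show "c \<in> W" using \<pi>(3) S(4) DS by (auto simp: W_def)
  qed
  have DW: "D \<subseteq> W" using \<pi>(3) DS by (auto simp: W_def)
  define \<beta> where "\<beta> x v = B (\<pi> x) (\<pi> v)" for x v
  have lin: "linear (\<beta> x)" if "x \<in> W" for x
    using that unfolding \<beta>_def W_def
    by (intro linearI) (auto simp: linear_add[OF \<pi>(1)] linear_cmul[OF \<pi>(1)] add scale \<pi>(2))
  have sm: "smooth_on W (\<lambda>x. \<beta> x v)" for v
    unfolding \<beta>_def
    by (rule smooth_on_compose[OF smooth[OF \<pi>(2)] smooth_on_bounded_linear[OF bl]]) (simp add: W_def)
  \<comment> \<open>Derivatives of the pulled back coefficients are derivatives of \<open>B\<close>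
    along projected vectors, which is how closedness is inherited.\<close>
  have d: "frechet_derivative (\<lambda>x. \<beta> x u) (at x) v = dir_deriv (\<lambda>p. B p (\<pi> u)) (\<pi> x) (\<pi> v)"
    if x: "x \<in> W" for x u v
  proof -
    have "((\<lambda>x. \<beta> x u) has_derivative frechet_derivative (\<lambda>x. \<beta> x u) (at x)) (at x within W)"
      using Ck_on_SucD[OF smooth_on_imp_Ck_on[OF W(1) sm] x] has_derivative_at_withinI by blast
    then have "frechet_derivative (\<lambda>x. \<beta> x u) (at x) v = dir_deriv (\<lambda>x. \<beta> x u) x v"
      by (intro dir_deriv_eq[of UNIV W x v, symmetric]) (use W(1) x in auto)
    also have "\<dots> = dir_deriv (\<lambda>p. B p (\<pi> u)) (\<pi> x) (dir_deriv \<pi> x v)"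
      unfolding \<beta>_def
      by (rule dir_deriv_compose[where f=\<pi> and S=UNIV and D=W and E=D, OF _ _ x _
            smooth_on_bounded_linear[OF bl] S(1,2) _ smooth[OF \<pi>(2)]]) (use W(1) in \<open>auto simp: W_def\<close>)
    also have "dir_deriv \<pi> x v = \<pi> v"
      by (rule dir_deriv_eq[of UNIV W]) (use W(1) x bl in \<open>auto intro: bounded_linear_imp_has_derivative\<close>)
    finally show ?thesis .
  qed
  obtain G where G: "smooth_on W G" "\<And>x. x \<in> W \<Longrightarrow> (G has_derivative \<beta> x) (at x)"
    by (rule poincare_convex[OF W lin sm]) (auto simp: d W_def closed \<pi>(2))
  show ?thesis
  proof (rule that[OF smooth_on_subset[OF G(1) DW]])
    fix x v assume x: "x \<in> D" "v \<in> S"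
    have "(G has_derivative \<beta> x) (at x within D)"
      using G(2) DW x by (blast intro: has_derivative_at_withinI)
    then have "dir_deriv G x v = \<beta> x v" by (rule dir_deriv_eq[OF S(1,2) x])
    then show "dir_deriv G x v = B x v" using \<pi>(3) DS x by (auto simp: \<beta>_def)
  qed
qed

text \<open>The hypothesis controls the derivative within \<open>D\<close> only on \<open>S\<close>.
  Precomposing with the projection, which is the identity on \<open>D\<close>, yields derivative 0
  in all directions, and \<open>D\<close> is convex.\<close>

lemma locally_constant_if_dir_deriv_zero:
  fixes f :: "'a::euclidean_space \<Rightarrow> 'b::real_normed_vector"
  assumes S: "subspace S" "openin (top_of_set S) D" "convex D"
    and smooth: "smooth_on D f" and zero: "\<And>x v. x \<in> D \<Longrightarrow> v \<in> S \<Longrightarrow> dir_deriv f x v = 0"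
    and xy: "x \<in> D" "y \<in> D"
  shows "f x = f y"
proof -
  obtain \<pi> where \<pi>: "linear \<pi>" "\<And>x. \<pi> x \<in> S" "\<And>x. x \<in> S \<Longrightarrow> \<pi> x = x"
    using subspace_projection[OF S(1)] by blast
  have bl: "bounded_linear \<pi>" using \<pi>(1) by (simp add: linear_conv_bounded_linear)
  have DS: "D \<subseteq> S" using S(2) openin_imp_subset by blast
  have "(f has_derivative (\<lambda>_. 0)) (at p within D)" if p: "p \<in> D" for p
  proof -
    obtain f' where f': "(f has_derivative f') (at p within D)" "\<And>v. v \<in> S \<Longrightarrow> dir_deriv f p v = f' v"
      using smooth_on_has_dir_deriv[OF S(1,2) p smooth] by blast
    have "(\<pi> has_derivative \<pi>) (at p within D)" by (rule bounded_linear_imp_has_derivative[OF bl])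
    moreover have "(f has_derivative f') (at (\<pi> p) within \<pi> ` D)"
      using f'(1) \<pi>(3) DS p by (simp add: subset_iff image_cong[of D D \<pi> id])
    ultimately have "((\<lambda>x. f (\<pi> x)) has_derivative (\<lambda>v. f' (\<pi> v))) (at p within D)"
      by (rule has_derivative_in_compose)
    then have "((\<lambda>x. f (\<pi> x)) has_derivative (\<lambda>_. 0)) (at p within D)"
      using f'(2) zero[OF p] \<pi>(2) by simp
    then show ?thesis
      by (rule has_derivative_transform[OF p, rotated]) (use \<pi>(3) DS in auto)
  qed
  then show ?thesis using has_derivative_zero_constant[OF S(3), of f] xy by metis
qed

section \<open>Charts\<close>

lemma
  assumes "chart_on d X \<kappa>"
  shows chart_on_openin: "openin X (cdom \<kappa>)"
    and chart_on_subspace: "subspace (cspace \<kappa>)"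
    and chart_on_openin_image: "openin (top_of_set (cspace \<kappa>)) (cmap \<kappa> ` cdom \<kappa>)"
    and chart_on_inj: "inj_on (cmap \<kappa>) (cdom \<kappa>)"
proof -
  show o: "openin X (cdom \<kappa>)" and "subspace (cspace \<kappa>)"
    "openin (top_of_set (cspace \<kappa>)) (cmap \<kappa> ` cdom \<kappa>)"
    using assms by (auto simp: chart_on_def)
  have "topspace (subtopology X (cdom \<kappa>)) = cdom \<kappa>" using openin_subset[OF o] by auto
  moreover have "homeomorphic_map (subtopology X (cdom \<kappa>)) (top_of_set (cmap \<kappa> ` cdom \<kappa>)) (cmap \<kappa>)"
    using assms by (simp add: chart_on_def)
  ultimately show "inj_on (cmap \<kappa>) (cdom \<kappa>)"
    using homeomorphic_imp_injective_map by metis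
qed

lemma chart_on_topspace: "chart_on d X \<kappa> \<Longrightarrow> topspace (subtopology X (cdom \<kappa>)) = cdom \<kappa>"
  by (metis chart_on_openin inf.absorb2 openin_subset topspace_subtopology)

lemma cinv_cmap: "chart_on d X \<kappa> \<Longrightarrow> x \<in> cdom \<kappa> \<Longrightarrow> cinv \<kappa> (cmap \<kappa> x) = x"
  unfolding cinv_def by (meson chart_on_inj inv_into_f_f)

lemma cmap_cinv: "p \<in> cmap \<kappa> ` cdom \<kappa> \<Longrightarrow> cmap \<kappa> (cinv \<kappa> p) = p"
  unfolding cinv_def by (rule f_inv_into_f)

lemma chart_on_image_openin:
  assumes "chart_on d X \<kappa>" "openin X U"
  shows "openin (top_of_set (cspace \<kappa>)) (cmap \<kappa> ` (U \<inter> cdom \<kappa>))"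
proof -
  have "openin (subtopology X (cdom \<kappa>)) (U \<inter> cdom \<kappa>)"
    using assms(2) by (auto simp: openin_subtopology)
  then have "openin (top_of_set (cmap \<kappa> ` cdom \<kappa>)) (cmap \<kappa> ` (U \<inter> cdom \<kappa>))"
    using assms(1) homeomorphic_map_openness_eq unfolding chart_on_def by metis
  then show ?thesis using chart_on_openin_image[OF assms(1)] openin_trans by blast
qed

lemma chart_on_image_openin_subset:
  "chart_on d X \<kappa> \<Longrightarrow> openin X U \<Longrightarrow> U \<subseteq> cdom \<kappa> \<Longrightarrow> openin (top_of_set (cspace \<kappa>)) (cmap \<kappa> ` U)"
  using chart_on_image_openin by (metis inf.orderE)

lemma chart_on_continuous: "chart_on d X \<kappa> \<Longrightarrow> continuous_map (subtopology X (cdom \<kappa>)) euclidean (cmap \<kappa>)"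
  unfolding chart_on_def
  by (metis continuous_map_into_fulltopology homeomorphic_imp_continuous_map)

lemma chart_on_preimage_openin:
  assumes "chart_on d X \<kappa>" "openin (top_of_set (cspace \<kappa>)) D"
  shows "openin X {x \<in> cdom \<kappa>. cmap \<kappa> x \<in> D}"
proof -
  obtain T where T: "open T" "D = cspace \<kappa> \<inter> T" using assms(2) by (auto simp: openin_open)
  have "openin (subtopology X (cdom \<kappa>)) {x \<in> cdom \<kappa>. cmap \<kappa> x \<in> T}"
    using openin_continuous_map_preimage[OF chart_on_continuous[OF assms(1)], of T] T(1)
    unfolding chart_on_topspace[OF assms(1)] by simp
  moreover have "{x \<in> cdom \<kappa>. cmap \<kappa> x \<in> T} = {x \<in> cdom \<kappa>. cmap \<kappa> x \<in> D}"
    using openin_imp_subset[OF chart_on_openin_image[OF assms(1)]] T(2) by auto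
  ultimately show ?thesis using openin_trans_full chart_on_openin[OF assms(1)] by metis
qed

text \<open>\<open>cinv\<close> is an \<open>inv_into\<close>; it agrees on the image of the chart
  with the inverse homeomorphism and takes its continuity from there.\<close>

lemma chart_on_cinv_continuous:
  assumes "chart_on d X \<kappa>"
  shows "continuous_map (top_of_set (cmap \<kappa> ` cdom \<kappa>)) X (cinv \<kappa>)"
proof -
  have "homeomorphic_map (subtopology X (cdom \<kappa>)) (top_of_set (cmap \<kappa> ` cdom \<kappa>)) (cmap \<kappa>)"
    using assms by (simp add: chart_on_def)
  then obtain g where g: "homeomorphic_maps (subtopology X (cdom \<kappa>)) (top_of_set (cmap \<kappa> ` cdom \<kappa>)) (cmap \<kappa>) g"
    using homeomorphic_map_maps by blast
  then have "continuous_map (top_of_set (cmap \<kappa> ` cdom \<kappa>)) X g"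
    unfolding homeomorphic_maps_def using continuous_map_into_fulltopology by blast
  moreover have "g p = cinv \<kappa> p" if "p \<in> cmap \<kappa> ` cdom \<kappa>" for p
  proof -
    have "g (cmap \<kappa> x) = x" if "x \<in> cdom \<kappa>" for x
      using that g chart_on_topspace[OF assms] unfolding homeomorphic_maps_def by metis
    then show ?thesis using that cinv_cmap[OF assms] by auto
  qed
  ultimately show ?thesis
    by (rule continuous_map_eq) simp
qed

section \<open>Smooth maps and functions on manifolds\<close>

lemma
  assumes "smooth_manifold d M"
  shows atlas_chart_on: "\<kappa> \<in> atlas M \<Longrightarrow> chart_on d (mtop M) \<kappa>"
    and atlas_compatible: "\<kappa> \<in> atlas M \<Longrightarrow> \<kappa>' \<in> atlas M \<Longrightarrow>
      smooth_on (cmap \<kappa> ` (cdom \<kappa> \<inter> cdom \<kappa>')) (cmap \<kappa>' \<circ> cinv \<kappa>)"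
    and atlas_covers: "x \<in> pts M \<Longrightarrow> \<exists>\<kappa>. \<kappa> \<in> charts_at M x"
    and atlas_dom: "\<kappa> \<in> atlas M \<Longrightarrow> cdom \<kappa> \<subseteq> pts M"
proof -
  show c: "\<kappa> \<in> atlas M \<Longrightarrow> chart_on d (mtop M) \<kappa>" for \<kappa> using assms unfolding smooth_manifold_def by blast
  show "\<kappa> \<in> atlas M \<Longrightarrow> \<kappa>' \<in> atlas M \<Longrightarrow> smooth_on (cmap \<kappa> ` (cdom \<kappa> \<inter> cdom \<kappa>')) (cmap \<kappa>' \<circ> cinv \<kappa>)"
    using assms unfolding smooth_manifold_def charts_compatible_def by blast
  show "x \<in> pts M \<Longrightarrow> \<exists>\<kappa>. \<kappa> \<in> charts_at M x"
    using assms unfolding smooth_manifold_def charts_at_def by blast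
  show "\<kappa> \<in> atlas M \<Longrightarrow> cdom \<kappa> \<subseteq> pts M" by (rule openin_subset[OF chart_on_openin[OF c]])
qed

lemma charts_atD: "\<kappa> \<in> charts_at M x \<Longrightarrow> \<kappa> \<in> atlas M" "\<kappa> \<in> charts_at M x \<Longrightarrow> x \<in> cdom \<kappa>"
  by (auto simp: charts_at_def)

lemma openin_in_pts: "openin (mtop M) U \<Longrightarrow> x \<in> U \<Longrightarrow> x \<in> pts M"
  using openin_subset by blast

lemma openin_vimage:
  assumes "continuous_map (subtopology X U) Y f" "openin X U" "openin Y W"
  shows "openin X (U \<inter> f -` W)"
proof -
  have "openin (subtopology X U) {x \<in> topspace (subtopology X U). f x \<in> W}"
    using assms openin_continuous_map_preimage by blast
  moreover have "{x \<in> topspace (subtopology X U). f x \<in> W} = U \<inter> f -` W"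
    using openin_subset[OF assms(2)] by auto
  ultimately show ?thesis using assms(2) openin_trans_full by metis
qed

lemma smooth_map_on_continuous: "smooth_map_on M U N f \<Longrightarrow> continuous_map (subtopology (mtop M) U) (mtop N) f"
  by (simp add: smooth_map_on_def)

lemma smooth_map_on_in_pts: "smooth_map_on M U N f \<Longrightarrow> openin (mtop M) U \<Longrightarrow> x \<in> U \<Longrightarrow> f x \<in> pts N"
  using smooth_map_on_continuous openin_subset
  by (fastforce simp: continuous_map_def Pi_iff)

lemma smooth_map_on_vimage:
  "smooth_map_on M U N f \<Longrightarrow> openin (mtop M) U \<Longrightarrow> openin (mtop N) W \<Longrightarrow> openin (mtop M) (U \<inter> f -` W)"
  using openin_vimage smooth_map_on_continuous by metis

lemma smooth_map_on_rep:
  "smooth_map_on M U N f \<Longrightarrow> \<kappa> \<in> atlas M \<Longrightarrow> \<mu> \<in> atlas N \<Longrightarrow>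
    smooth_on (cmap \<kappa> ` (U \<inter> cdom \<kappa> \<inter> f -` cdom \<mu>)) (cmap \<mu> \<circ> f \<circ> cinv \<kappa>)"
  by (simp add: smooth_map_on_def)

lemma smooth_map_on_subset: "smooth_map_on M U N f \<Longrightarrow> V \<subseteq> U \<Longrightarrow> smooth_map_on M V N f"
  unfolding smooth_map_on_def
proof (intro conjI ballI; elim conjE)
  fix \<kappa> \<mu> assume V: "V \<subseteq> U" and \<kappa>: "\<kappa> \<in> atlas M" "\<mu> \<in> atlas N"
    and f: "\<forall>\<kappa>\<in>atlas M. \<forall>\<mu>\<in>atlas N. smooth_on (cmap \<kappa> ` (U \<inter> cdom \<kappa> \<inter> f -` cdom \<mu>)) (cmap \<mu> \<circ> f \<circ> cinv \<kappa>)"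
  show "smooth_on (cmap \<kappa> ` (V \<inter> cdom \<kappa> \<inter> f -` cdom \<mu>)) (cmap \<mu> \<circ> f \<circ> cinv \<kappa>)"
    by (rule smooth_on_subset[OF f[rule_format, OF \<kappa>]]) (use V in auto)
qed (rule continuous_map_from_subtopology_mono)

lemma smooth_fun_on_subset: "smooth_fun_on M U f \<Longrightarrow> V \<subseteq> U \<Longrightarrow> smooth_fun_on M V f"
  unfolding smooth_fun_on_def
  by (meson Int_mono image_mono order_refl smooth_on_subset)

lemma smooth_fun_on_rep:
  "smooth_fun_on M U f \<Longrightarrow> \<kappa> \<in> atlas M \<Longrightarrow> smooth_on (cmap \<kappa> ` (U \<inter> cdom \<kappa>)) (\<lambda>p. f (cinv \<kappa> p))"
  by (simp add: smooth_fun_on_def comp_def)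

lemma smooth_fun_on_cong:
  assumes "smooth_manifold d M" "\<And>x. x \<in> U \<Longrightarrow> f x = g x"
  shows "smooth_fun_on M U f \<longleftrightarrow> smooth_fun_on M U g"
  unfolding smooth_fun_on_def using assms cinv_cmap[OF atlas_chart_on[OF assms(1)]]
  by (intro ball_cong smooth_on_cong) auto

lemma smooth_fun_on_local:
  assumes M: "smooth_manifold d M"
    and loc: "\<And>x. x \<in> U \<Longrightarrow> \<exists>V. openin (mtop M) V \<and> x \<in> V \<and> smooth_fun_on M V f"
  shows "smooth_fun_on M U f"
  unfolding smooth_fun_on_def
proof (intro ballI smooth_on_local)
  fix \<kappa> p assume \<kappa>: "\<kappa> \<in> atlas M" and p: "p \<in> cmap \<kappa> ` (U \<inter> cdom \<kappa>)"
  then obtain x where x: "x \<in> U" "x \<in> cdom \<kappa>" "p = cmap \<kappa> x" by blast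
  obtain V where V: "openin (mtop M) V" "x \<in> V" "smooth_fun_on M V f" using loc[OF x(1)] by blast
  have "openin (top_of_set (cspace \<kappa>)) (cmap \<kappa> ` (V \<inter> cdom \<kappa>))"
    by (rule chart_on_image_openin[OF atlas_chart_on[OF M \<kappa>] V(1)])
  then obtain T where T: "open T" "cmap \<kappa> ` (V \<inter> cdom \<kappa>) = cspace \<kappa> \<inter> T" by (auto simp: openin_open)
  \<comment> \<open>\<open>U\<close> is an arbitrary set, so a relative neighbourhood is cut out by
    the ambient open set \<open>T\<close> that describes the image of \<open>V\<close>.\<close>
  let ?E = "cmap \<kappa> ` (U \<inter> cdom \<kappa>) \<inter> T"
  have sub: "?E \<subseteq> cmap \<kappa> ` (V \<inter> cdom \<kappa>)"
    using T(2) openin_imp_subset[OF chart_on_openin_image[OF atlas_chart_on[OF M \<kappa>]]] by blast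
  have "openin (top_of_set (cmap \<kappa> ` (U \<inter> cdom \<kappa>))) ?E" using T(1) by (simp add: openin_open_Int)
  moreover have "p \<in> ?E" using x V(2) T(2) by blast
  moreover have "smooth_on ?E (f \<circ> cinv \<kappa>)"
    using V(3) \<kappa> sub by (auto simp: smooth_fun_on_def intro: smooth_on_subset)
  ultimately show "\<exists>E. openin (top_of_set (cmap \<kappa> ` (U \<inter> cdom \<kappa>))) E \<and> p \<in> E \<and> smooth_on E (f \<circ> cinv \<kappa>)"
    by blast
qed

text \<open>Transition maps carry smoothness in one chart to all others, so a single chart around
  \<open>U\<close> is enough.\<close>

lemma smooth_fun_onI_chart:
  assumes M: "smooth_manifold d M" and \<kappa>: "\<kappa> \<in> atlas M" and U: "U \<subseteq> cdom \<kappa>"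
    and f: "smooth_on (cmap \<kappa> ` U) (f \<circ> cinv \<kappa>)"
  shows "smooth_fun_on M U f"
  unfolding smooth_fun_on_def
proof
  fix \<kappa>' assume \<kappa>': "\<kappa>' \<in> atlas M"
  note inv = cinv_cmap[OF atlas_chart_on[OF M \<kappa>]] cinv_cmap[OF atlas_chart_on[OF M \<kappa>']]
  have "smooth_on (cmap \<kappa>' ` (U \<inter> cdom \<kappa>')) (\<lambda>p. (f \<circ> cinv \<kappa>) ((cmap \<kappa> \<circ> cinv \<kappa>') p))"
    by (rule smooth_on_compose[OF f smooth_on_subset[OF atlas_compatible[OF M \<kappa>' \<kappa>]]])
      (use U in \<open>auto simp: inv\<close>)
  then show "smooth_on (cmap \<kappa>' ` (U \<inter> cdom \<kappa>')) (f \<circ> cinv \<kappa>')"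
    by (rule smooth_on_cong[THEN iffD1, rotated]) (use U in \<open>auto simp: inv\<close>)
qed

lemma smooth_fun_on_chart:
  assumes M: "smooth_manifold d M" and \<kappa>: "\<kappa> \<in> atlas M" and U: "U \<subseteq> cdom \<kappa>"
  shows "smooth_fun_on M U f \<longleftrightarrow> smooth_on (cmap \<kappa> ` U) (f \<circ> cinv \<kappa>)"
  using smooth_fun_onI_chart[OF assms] \<kappa> U by (auto simp: smooth_fun_on_def inf_absorb1)

lemma smooth_fun_on_cmap: "smooth_manifold d M \<Longrightarrow> \<kappa> \<in> atlas M \<Longrightarrow> smooth_fun_on M (cdom \<kappa>) (cmap \<kappa>)"
  by (subst smooth_fun_on_chart, assumption+, rule order_refl)
    (auto intro!: smooth_on_cong[THEN iffD1, OF _ smooth_on_id] simp: cmap_cinv)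

text \<open>Unlike \<open>smooth_map_on\<close>, \<open>smooth_fun_on\<close> does not contain
  continuity. It is recovered chart by chart and supplies the topological half of
  \<open>smooth_map_onI_fun\<close>.\<close>

lemma smooth_fun_on_continuous:
  assumes M: "smooth_manifold d M" and U: "openin (mtop M) U" and f: "smooth_fun_on M U f"
  shows "continuous_map (subtopology (mtop M) U) euclidean f"
proof -
  have "\<exists>W. openin (mtop M) W \<and> x \<in> W \<and> W \<subseteq> U \<inter> f -` T" if T: "open T" and x: "x \<in> U" "f x \<in> T" for T x
  proof -
    obtain \<kappa> where \<kappa>: "\<kappa> \<in> atlas M" "x \<in> cdom \<kappa>"
      using atlas_covers[OF M openin_in_pts[OF U x(1)]] by (auto simp: charts_at_def)
    note c = atlas_chart_on[OF M \<kappa>(1)]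
    let ?D = "cmap \<kappa> ` (U \<inter> cdom \<kappa>)"
    have "continuous_on ?D (f \<circ> cinv \<kappa>)"
      using smooth_fun_on_rep[OF f \<kappa>(1)] by (simp add: comp_def smooth_on_imp_continuous_on)
    then have "openin (top_of_set ?D) (?D \<inter> (f \<circ> cinv \<kappa>) -` T)"
      using T continuous_openin_preimage_gen by blast
    then have "openin (top_of_set (cspace \<kappa>)) (?D \<inter> (f \<circ> cinv \<kappa>) -` T)"
      using chart_on_image_openin[OF c U] openin_trans by blast
    then have "openin (mtop M) {y \<in> cdom \<kappa>. cmap \<kappa> y \<in> ?D \<inter> (f \<circ> cinv \<kappa>) -` T}"
      by (rule chart_on_preimage_openin[OF c])
    moreover have "{y \<in> cdom \<kappa>. cmap \<kappa> y \<in> ?D \<inter> (f \<circ> cinv \<kappa>) -` T} \<subseteq> U \<inter> f -` T"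
      using cinv_cmap[OF c] chart_on_inj[OF c] by (auto simp: inj_on_eq_iff)
    ultimately show ?thesis using x \<kappa>(2) cinv_cmap[OF c]
      by (intro exI[of _ "{y \<in> cdom \<kappa>. cmap \<kappa> y \<in> ?D \<inter> (f \<circ> cinv \<kappa>) -` T}"]) auto
  qed
  then have "openin (mtop M) (U \<inter> f -` T)" if "open T" for T
    using that by (subst openin_subopen) blast
  then have "openin (subtopology (mtop M) U) (U \<inter> f -` T)" if "open T" for T
    using that U by (metis openin_open_subtopology inf.cobounded1)
  moreover have "topspace (subtopology (mtop M) U) = U" using openin_subset[OF U] by auto
  moreover have "{x \<in> U. f x \<in> T} = U \<inter> f -` T" for T by auto
  ultimately show ?thesis by (simp add: continuous_map_def)
qed

lemma smooth_map_on_imp_fun: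
  assumes "smooth_map_on M U N f" "f ` U \<subseteq> cdom \<mu>" "\<mu> \<in> atlas N"
  shows "smooth_fun_on M U (\<lambda>x. cmap \<mu> (f x))"
  unfolding smooth_fun_on_def
proof
  fix \<kappa> assume "\<kappa> \<in> atlas M"
  moreover have "U \<inter> cdom \<kappa> \<inter> f -` cdom \<mu> = U \<inter> cdom \<kappa>" using assms(2) by auto
  ultimately show "smooth_on (cmap \<kappa> ` (U \<inter> cdom \<kappa>)) ((\<lambda>x. cmap \<mu> (f x)) \<circ> cinv \<kappa>)"
    using smooth_map_on_rep[OF assms(1) _ assms(3)] by (metis (no_types, lifting) comp_def comp_apply ext)
qed

text \<open>Continuity comes from composing the coordinate function with the continuous
  \<open>cinv\<close>, the other target charts from transition maps. With
  \<open>smooth_map_on_local\<close>, this reduces maps between manifolds to vector-valued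
  functions.\<close>

lemma smooth_map_onI_fun:
  assumes M: "smooth_manifold d M" and N: "smooth_manifold d' N" and U: "openin (mtop M) U"
    and f: "f ` U \<subseteq> cdom \<mu>" "\<mu> \<in> atlas N" "smooth_fun_on M U (\<lambda>x. cmap \<mu> (f x))"
  shows "smooth_map_on M U N f"
  unfolding smooth_map_on_def
proof (intro conjI ballI)
  note c = atlas_chart_on[OF N f(2)]
  have top: "topspace (subtopology (mtop M) U) = U" using openin_subset[OF U] by auto
  have "continuous_map (subtopology (mtop M) U) (top_of_set (cmap \<mu> ` cdom \<mu>)) (\<lambda>x. cmap \<mu> (f x))"
    using smooth_fun_on_continuous[OF M U f(3)] f(1) top
    by (auto simp: continuous_map_in_subtopology)
  then have "continuous_map (subtopology (mtop M) U) (mtop N) (cinv \<mu> \<circ> (\<lambda>x. cmap \<mu> (f x)))"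
    using chart_on_cinv_continuous[OF c] continuous_map_compose by blast
  then show "continuous_map (subtopology (mtop M) U) (mtop N) f"
    by (rule continuous_map_eq) (use f(1) cinv_cmap[OF c] top in auto)
  fix \<kappa> \<mu>' assume \<kappa>: "\<kappa> \<in> atlas M" "\<mu>' \<in> atlas N"
  let ?D = "cmap \<kappa> ` (U \<inter> cdom \<kappa> \<inter> f -` cdom \<mu>')"
  note inv = cinv_cmap[OF c] cinv_cmap[OF atlas_chart_on[OF M \<kappa>(1)]]
  have sf: "smooth_on ?D (\<lambda>p. ((\<lambda>x. cmap \<mu> (f x)) \<circ> cinv \<kappa>) p)"
    using smooth_on_subset[OF smooth_fun_on_rep[OF f(3) \<kappa>(1)], of ?D] by auto
  have "smooth_on ?D (\<lambda>p. (cmap \<mu>' \<circ> cinv \<mu>) (((\<lambda>x. cmap \<mu> (f x)) \<circ> cinv \<kappa>) p))"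
    by (rule smooth_on_compose[OF atlas_compatible[OF N f(2) \<kappa>(2)] sf]) (use f(1) in \<open>auto simp: inv\<close>)
  then show "smooth_on ?D (cmap \<mu>' \<circ> f \<circ> cinv \<kappa>)"
    by (rule smooth_on_cong[THEN iffD1, rotated]) (use f(1) in \<open>auto simp: inv image_subset_iff\<close>)
qed

lemma smooth_map_on_local:
  assumes M: "smooth_manifold d M" and N: "smooth_manifold d' N" and U: "openin (mtop M) U"
    and loc: "\<And>x. x \<in> U \<Longrightarrow> \<exists>V. openin (mtop M) V \<and> x \<in> V \<and> smooth_map_on M V N f"
  shows "smooth_map_on M U N f"
  unfolding smooth_map_on_def
proof (intro conjI ballI)
  have top: "topspace (subtopology (mtop M) U) = U" using openin_subset[OF U] by auto
  have o: "openin (mtop M) (U \<inter> f -` W)" if W: "openin (mtop N) W" for W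
  proof (subst openin_subopen, intro ballI)
    fix x assume x: "x \<in> U \<inter> f -` W"
    then obtain V where V: "openin (mtop M) V" "x \<in> V" "smooth_map_on M V N f" using loc by blast
    have "openin (mtop M) ((V \<inter> f -` W) \<inter> U)"
      using smooth_map_on_vimage[OF V(3,1) W] U by blast
    then show "\<exists>T. openin (mtop M) T \<and> x \<in> T \<and> T \<subseteq> U \<inter> f -` W" using x V(2) by blast
  qed
  show "continuous_map (subtopology (mtop M) U) (mtop N) f"
    unfolding continuous_map_def
  proof (intro conjI allI impI)
    show "f \<in> topspace (subtopology (mtop M) U) \<rightarrow> pts N"
      using loc smooth_map_on_in_pts[of M _ N f] top by fastforce
    fix W assume "openin (mtop N) W"
    then have "openin (subtopology (mtop M) U) (U \<inter> f -` W)" 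
      using o U by (metis openin_open_subtopology inf.cobounded1)
    then show "openin (subtopology (mtop M) U) {x \<in> topspace (subtopology (mtop M) U). f x \<in> W}"
      unfolding top by (simp add: vimage_def Int_def)
  qed
  fix \<kappa> \<mu> assume \<kappa>: "\<kappa> \<in> atlas M" "\<mu> \<in> atlas N"
  have "smooth_fun_on M (U \<inter> f -` cdom \<mu>) (\<lambda>x. cmap \<mu> (f x))"
  proof (rule smooth_fun_on_local[OF M])
    fix x assume x: "x \<in> U \<inter> f -` cdom \<mu>"
    then obtain V where V: "openin (mtop M) V" "x \<in> V" "smooth_map_on M V N f" using loc by blast
    have "openin (mtop M) (V \<inter> f -` cdom \<mu>)"
      by (rule smooth_map_on_vimage[OF V(3,1) chart_on_openin[OF atlas_chart_on[OF N \<kappa>(2)]]])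
    moreover have "smooth_fun_on M (V \<inter> f -` cdom \<mu>) (\<lambda>x. cmap \<mu> (f x))"
      by (rule smooth_map_on_imp_fun[OF smooth_map_on_subset[OF V(3)]]) (use \<kappa> in auto)
    ultimately show "\<exists>V. openin (mtop M) V \<and> x \<in> V \<and> smooth_fun_on M V (\<lambda>x. cmap \<mu> (f x))"
      using x V(2) by blast
  qed
  then show "smooth_on (cmap \<kappa> ` (U \<inter> cdom \<kappa> \<inter> f -` cdom \<mu>)) (cmap \<mu> \<circ> f \<circ> cinv \<kappa>)"
    using smooth_fun_on_rep[OF _ \<kappa>(1), of "U \<inter> f -` cdom \<mu>" "\<lambda>x. cmap \<mu> (f x)"] by (simp add: comp_def Int_ac)
qed

lemma smooth_fun_on_compose:
  assumes M: "smooth_manifold d M" and N: "smooth_manifold d' N" and U: "openin (mtop M) U"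
    and f: "smooth_map_on M U N f" "f ` U \<subseteq> W" and g: "smooth_fun_on N W g"
  shows "smooth_fun_on M U (\<lambda>x. g (f x))"
proof (rule smooth_fun_on_local[OF M])
  fix x assume x: "x \<in> U"
  then obtain \<mu> where \<mu>: "\<mu> \<in> atlas N" "f x \<in> cdom \<mu>"
    using atlas_covers[OF N smooth_map_on_in_pts[OF f(1) U]] by (auto simp: charts_at_def)
  let ?V = "U \<inter> f -` cdom \<mu>"
  have V: "openin (mtop M) ?V"
    by (rule smooth_map_on_vimage[OF f(1) U chart_on_openin[OF atlas_chart_on[OF N \<mu>(1)]]])
  have fV: "smooth_fun_on M ?V (\<lambda>x. cmap \<mu> (f x))"
    by (rule smooth_map_on_imp_fun[OF smooth_map_on_subset[OF f(1)]]) (use \<mu> in auto)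
  have "smooth_fun_on M ?V (\<lambda>x. g (f x))"
    unfolding smooth_fun_on_def
  proof
    fix \<kappa> assume \<kappa>: "\<kappa> \<in> atlas M"
    let ?D = "cmap \<kappa> ` (?V \<inter> cdom \<kappa>)"
    note inv = cinv_cmap[OF atlas_chart_on[OF N \<mu>(1)]] cinv_cmap[OF atlas_chart_on[OF M \<kappa>]]
    have s1: "smooth_on (cmap \<mu> ` (W \<inter> cdom \<mu>)) (g \<circ> cinv \<mu>)" using g \<mu> by (auto simp: smooth_fun_on_def)
    have s2: "smooth_on ?D (\<lambda>p. ((\<lambda>x. cmap \<mu> (f x)) \<circ> cinv \<kappa>) p)" using smooth_fun_on_rep[OF fV \<kappa>] by (simp add: comp_def)
    have "smooth_on ?D (\<lambda>p. (g \<circ> cinv \<mu>) (((\<lambda>x. cmap \<mu> (f x)) \<circ> cinv \<kappa>) p))"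
      by (rule smooth_on_compose[OF s1 s2]) (use f(2) in \<open>auto simp: inv\<close>)
    then show "smooth_on ?D ((\<lambda>x. g (f x)) \<circ> cinv \<kappa>)"
      by (rule smooth_on_cong[THEN iffD1, rotated]) (auto simp: inv)
  qed
  then show "\<exists>V. openin (mtop M) V \<and> x \<in> V \<and> smooth_fun_on M V (\<lambda>x. g (f x))" using V x \<mu>(2) by blast
qed

lemma smooth_map_on_compose:
  assumes M: "smooth_manifold d M" and N: "smooth_manifold d' N" and Z: "smooth_manifold d'' Z"
    and U: "openin (mtop M) U" and W: "openin (mtop N) W"
    and f: "smooth_map_on M U N f" "f ` U \<subseteq> W" and g: "smooth_map_on N W Z g"
  shows "smooth_map_on M U Z (\<lambda>x. g (f x))"
proof (rule smooth_map_on_local[OF M Z U])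
  fix x assume x: "x \<in> U"
  then obtain \<zeta> where \<zeta>: "\<zeta> \<in> atlas Z" "g (f x) \<in> cdom \<zeta>"
    using atlas_covers[OF Z smooth_map_on_in_pts[OF g W]] f(2) by (auto simp: charts_at_def)
  let ?W = "W \<inter> g -` cdom \<zeta>"
  have "openin (mtop N) ?W"
    by (rule smooth_map_on_vimage[OF g W chart_on_openin[OF atlas_chart_on[OF Z \<zeta>(1)]]])
  then have V: "openin (mtop M) (U \<inter> f -` ?W)" by (rule smooth_map_on_vimage[OF f(1) U])
  have "smooth_fun_on N ?W (\<lambda>y. cmap \<zeta> (g y))"
    by (rule smooth_map_on_imp_fun[OF smooth_map_on_subset[OF g]]) (use \<zeta> in auto)
  then have "smooth_fun_on M (U \<inter> f -` ?W) (\<lambda>x. cmap \<zeta> (g (f x)))"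
    by (intro smooth_fun_on_compose[OF M N V smooth_map_on_subset[OF f(1)]]) auto
  then have "smooth_map_on M (U \<inter> f -` ?W) Z (\<lambda>x. g (f x))"
    by (intro smooth_map_onI_fun[OF M Z V _ \<zeta>(1)]) auto
  then show "\<exists>V. openin (mtop M) V \<and> x \<in> V \<and> smooth_map_on M V Z (\<lambda>x. g (f x))"
    using V x f(2) \<zeta>(2) by blast
qed

lemma smooth_map_on_cong:
  assumes "smooth_manifold d M" "openin (mtop M) U" "\<And>x. x \<in> U \<Longrightarrow> f x = g x" "smooth_map_on M U N f"
  shows "smooth_map_on M U N g"
  unfolding smooth_map_on_def
proof (intro conjI ballI)
  show "continuous_map (subtopology (mtop M) U) (mtop N) g"
    by (rule continuous_map_eq[OF smooth_map_on_continuous[OF assms(4)]]) (use assms(3) in auto)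
  fix \<kappa> \<mu> assume \<kappa>: "\<kappa> \<in> atlas M" "\<mu> \<in> atlas N"
  have "U \<inter> cdom \<kappa> \<inter> f -` cdom \<mu> = U \<inter> cdom \<kappa> \<inter> g -` cdom \<mu>" using assms(3) by auto
  then show "smooth_on (cmap \<kappa> ` (U \<inter> cdom \<kappa> \<inter> g -` cdom \<mu>)) (cmap \<mu> \<circ> g \<circ> cinv \<kappa>)"
    using smooth_map_on_rep[OF assms(4) \<kappa>]
    by (elim smooth_on_cong[THEN iffD1, rotated, OF back_subst[of "\<lambda>A. smooth_on (cmap \<kappa> ` A) _"]])
      (use assms(3) cinv_cmap[OF atlas_chart_on[OF assms(1) \<kappa>(1)]] in auto)
qed

lemma smooth_map_on_id:
  assumes M: "smooth_manifold d M" and U: "openin (mtop M) U"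
  shows "smooth_map_on M U M (\<lambda>x. x)"
  unfolding smooth_map_on_def
proof (intro conjI ballI)
  show "continuous_map (subtopology (mtop M) U) (mtop M) (\<lambda>x. x)"
    by (simp add: continuous_map_from_subtopology)
  fix \<kappa> \<mu> assume "\<kappa> \<in> atlas M" "\<mu> \<in> atlas M"
  then show "smooth_on (cmap \<kappa> ` (U \<inter> cdom \<kappa> \<inter> (\<lambda>x. x) -` cdom \<mu>)) (cmap \<mu> \<circ> (\<lambda>x. x) \<circ> cinv \<kappa>)"
    using atlas_compatible[OF M, of \<kappa> \<mu>] by (auto simp: comp_def intro: smooth_on_subset)
qed

section \<open>Arithmetic of smooth functions\<close>

lemma smooth_fun_on_const: "smooth_fun_on M U (\<lambda>x. c)"
  by (simp add: smooth_fun_on_def comp_def smooth_on_const)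

lemma smooth_fun_on_mult:
  fixes f g :: "'a \<Rightarrow> complex"
  shows "smooth_fun_on M U f \<Longrightarrow> smooth_fun_on M U g \<Longrightarrow> smooth_fun_on M U (\<lambda>x. f x * g x)"
  by (simp add: smooth_fun_on_def comp_def smooth_on_mult)

lemma smooth_fun_on_Pair:
  "smooth_fun_on M U f \<Longrightarrow> smooth_fun_on M U g \<Longrightarrow> smooth_fun_on M U (\<lambda>x. (f x, g x))"
  by (simp add: smooth_fun_on_def comp_def smooth_on_Pair)

lemma smooth_fun_on_snd:
  fixes f :: "'a \<Rightarrow> 'b::euclidean_space \<times> 'c::euclidean_space"
  shows "smooth_fun_on M U f \<Longrightarrow> smooth_fun_on M U (\<lambda>x. snd (f x))"
  by (simp add: smooth_fun_on_def comp_def smooth_on_snd)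

lemma smooth_fun_on_comp:
  fixes f :: "'a \<Rightarrow> 'b::euclidean_space"
  assumes "smooth_manifold d M" "smooth_fun_on M U f" "f ` U \<subseteq> E" "smooth_on E g"
  shows "smooth_fun_on M U (\<lambda>x. g (f x))"
  unfolding smooth_fun_on_def
proof
  fix \<kappa> assume \<kappa>: "\<kappa> \<in> atlas M"
  then have "smooth_on (cmap \<kappa> ` (U \<inter> cdom \<kappa>)) (\<lambda>p. f (cinv \<kappa> p))"
    using assms(2) by (auto simp: smooth_fun_on_def comp_def)
  then show "smooth_on (cmap \<kappa> ` (U \<inter> cdom \<kappa>)) ((\<lambda>x. g (f x)) \<circ> cinv \<kappa>)"
    unfolding comp_def
    by (rule smooth_on_compose[OF assms(4)]) (use assms(3) cinv_cmap[OF atlas_chart_on[OF assms(1) \<kappa>]] in auto)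
qed

lemma smooth_fun_on_inverse:
  fixes f :: "'a \<Rightarrow> complex"
  assumes "smooth_manifold d M" "smooth_fun_on M U f" "\<And>x. x \<in> U \<Longrightarrow> f x \<noteq> 0"
  shows "smooth_fun_on M U (\<lambda>x. inverse (f x))"
  by (rule smooth_fun_on_comp[OF assms(1,2), of "- {0}"])
    (use assms(3) in \<open>auto intro!: Ck_on_imp_smooth_on[of "- {0}" inverse, OF _ Ck_on_inverse]\<close>)

lemma smooth_fun_on_divide:
  fixes f :: "'a \<Rightarrow> complex"
  assumes "smooth_manifold d M" "smooth_fun_on M U f" "smooth_fun_on M U g" "\<And>x. x \<in> U \<Longrightarrow> g x \<noteq> 0"
  shows "smooth_fun_on M U (\<lambda>x. f x / g x)"
  unfolding divide_inverse by (intro smooth_fun_on_mult smooth_fun_on_inverse[OF assms(1)] assms)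

lemma smooth_fun_on_exp:
  fixes f :: "'a \<Rightarrow> complex"
  assumes "smooth_manifold d M" "smooth_fun_on M U f"
  shows "smooth_fun_on M U (\<lambda>x. exp (f x))"
  by (rule smooth_fun_on_comp[OF assms, of UNIV])
    (use Ck_on_imp_smooth_on[of UNIV exp, OF _ Ck_on_exp] in auto)

section \<open>Tangent vectors\<close>

lemma charts_at_openin: "smooth_manifold d M \<Longrightarrow> \<kappa> \<in> charts_at M x \<Longrightarrow> openin (mtop M) (cdom \<kappa>)"
  by (rule chart_on_openin[OF atlas_chart_on]) (auto simp: charts_at_def)

lemma charts_at_subspace: "smooth_manifold d M \<Longrightarrow> \<kappa> \<in> charts_at M x \<Longrightarrow> subspace (cspace \<kappa>)"
  by (rule chart_on_subspace[OF atlas_chart_on]) (auto simp: charts_at_def)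

lemma charts_at_cinv: "smooth_manifold d M \<Longrightarrow> \<kappa> \<in> charts_at M x \<Longrightarrow> cinv \<kappa> (cmap \<kappa> x) = x"
  by (rule cinv_cmap[OF atlas_chart_on]) (auto simp: charts_at_def)

text \<open>The chain rule in charts. With \<open>f\<close> the identity it makes
  \<open>tderiv\<close> independent of the chart, and with \<open>h\<close> a chart it becomes the
  transformation rule of tangent vectors.\<close>

lemma
  fixes h :: "'b \<Rightarrow> 'c::real_normed_vector" and N :: "('b, 'f::euclidean_space) mfd"
    and M :: "('a, 'e::euclidean_space) mfd"
  assumes M: "smooth_manifold d M" and N: "smooth_manifold d' N"
    and U: "openin (mtop M) U" and f: "smooth_map_on M U N f" and x: "x \<in> U"
    and \<kappa>: "\<kappa> \<in> charts_at M x" and \<mu>: "\<mu> \<in> charts_at N (f x)" and v: "v \<in> cspace \<kappa>"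
  shows dir_deriv_chart_chain: "openin (mtop N) W \<Longrightarrow> smooth_fun_on N W h \<Longrightarrow> f x \<in> W \<Longrightarrow>
      dir_deriv (\<lambda>p. h (f (cinv \<kappa> p))) (cmap \<kappa> x) v =
      dir_deriv (\<lambda>p. h (cinv \<mu> p)) (cmap \<mu> (f x)) (dir_deriv (\<lambda>p. cmap \<mu> (f (cinv \<kappa> p))) (cmap \<kappa> x) v)"
    and dir_deriv_chart_in: "dir_deriv (\<lambda>p. cmap \<mu> (f (cinv \<kappa> p))) (cmap \<kappa> x) v \<in> cspace \<mu>"
proof -
  note \<kappa>' = charts_atD[OF \<kappa>] and \<mu>' = charts_atD[OF \<mu>]
  note c = atlas_chart_on[OF M \<kappa>'(1)] atlas_chart_on[OF N \<mu>'(1)]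
  have main: "dir_deriv (\<lambda>p. cmap \<mu> (f (cinv \<kappa> p))) (cmap \<kappa> x) v \<in> cspace \<mu> \<and>
      dir_deriv (\<lambda>p. h (f (cinv \<kappa> p))) (cmap \<kappa> x) v =
      dir_deriv (\<lambda>p. h (cinv \<mu> p)) (cmap \<mu> (f x)) (dir_deriv (\<lambda>p. cmap \<mu> (f (cinv \<kappa> p))) (cmap \<kappa> x) v)"
    if W: "openin (mtop N) W" and h: "smooth_fun_on N W h" and fx: "f x \<in> W"
    for W and h :: "'b \<Rightarrow> 'c"
  proof -
    let ?W = "W \<inter> cdom \<mu>" and ?E = "cmap \<mu> ` (W \<inter> cdom \<mu>)"
    let ?V = "U \<inter> f -` ?W"
    let ?D = "cmap \<kappa> ` (?V \<inter> cdom \<kappa>)"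
    have V: "openin (mtop M) ?V"
      using smooth_map_on_vimage[OF f U] W chart_on_openin[OF c(2)] by blast
    have D: "openin (top_of_set (cspace \<kappa>)) ?D" by (rule chart_on_image_openin[OF c(1) V])
    have E: "openin (top_of_set (cspace \<mu>)) ?E" by (rule chart_on_image_openin[OF c(2) W])
    have p: "cmap \<kappa> x \<in> ?D" using x \<kappa>'(2) \<mu>'(2) fx by auto
    have s1: "smooth_on ?D (\<lambda>p. cmap \<mu> (f (cinv \<kappa> p)))"
      using smooth_on_subset[OF smooth_map_on_rep[OF f \<kappa>'(1) \<mu>'(1)], of ?D] by (auto simp: comp_def)
    have s2: "smooth_on ?E (\<lambda>p. h (cinv \<mu> p))" by (rule smooth_fun_on_rep[OF h \<mu>'(1)])
    have im: "(\<lambda>p. cmap \<mu> (f (cinv \<kappa> p))) ` ?D \<subseteq> ?E" using cinv_cmap[OF c(1)] by auto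
    have E': "?E \<subseteq> cspace \<mu>" using E openin_imp_subset by blast
    have i: "dir_deriv (\<lambda>p. cmap \<mu> (f (cinv \<kappa> p))) (cmap \<kappa> x) v \<in> cspace \<mu>"
      by (rule dir_deriv_in_subspace[OF chart_on_subspace[OF c(1)] D p v s1 chart_on_subspace[OF c(2)]])
        (use im E' in blast)
    have "dir_deriv (\<lambda>p. h (cinv \<mu> (cmap \<mu> (f (cinv \<kappa> p))))) (cmap \<kappa> x) v =
        dir_deriv (\<lambda>p. h (cinv \<mu> p)) (cmap \<mu> (f x)) (dir_deriv (\<lambda>p. cmap \<mu> (f (cinv \<kappa> p))) (cmap \<kappa> x) v)"
      using dir_deriv_compose[OF chart_on_subspace[OF c(1)] D p v s1 chart_on_subspace[OF c(2)] E im s2]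
      by (simp add: cinv_cmap[OF c(1) \<kappa>'(2)])
    moreover have "dir_deriv (\<lambda>p. h (cinv \<mu> (cmap \<mu> (f (cinv \<kappa> p))))) (cmap \<kappa> x) v =
        dir_deriv (\<lambda>p. h (f (cinv \<kappa> p))) (cmap \<kappa> x) v"
    proof (rule dir_deriv_cong[OF chart_on_subspace[OF c(1)] D p v])
      show "smooth_on ?D (\<lambda>p. h (cinv \<mu> (cmap \<mu> (f (cinv \<kappa> p)))))"
        by (rule smooth_on_compose[OF s2 s1]) (use im in blast)
    qed (use cinv_cmap[OF c(1)] cinv_cmap[OF c(2)] in auto)
    ultimately show ?thesis using i by simp
  qed
  show "openin (mtop N) W \<Longrightarrow> smooth_fun_on N W h \<Longrightarrow> f x \<in> W \<Longrightarrow>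
      dir_deriv (\<lambda>p. h (f (cinv \<kappa> p))) (cmap \<kappa> x) v =
      dir_deriv (\<lambda>p. h (cinv \<mu> p)) (cmap \<mu> (f x)) (dir_deriv (\<lambda>p. cmap \<mu> (f (cinv \<kappa> p))) (cmap \<kappa> x) v)"
    using main by blast
  show "dir_deriv (\<lambda>p. cmap \<mu> (f (cinv \<kappa> p))) (cmap \<kappa> x) v \<in> cspace \<mu>"
    \<comment> \<open>This conclusion does not mention \<open>h\<close>, so a constant function on
      \<open>cdom \<mu>\<close> serves.\<close>
    using main[OF chart_on_openin[OF c(2)] smooth_fun_on_const[of _ _ 0] \<mu>'(2)] by blast
qed

lemma tangent_spaceD:
  assumes "w \<in> tangent_space M x"
  shows "\<kappa> \<in> charts_at M x \<Longrightarrow> w \<kappa> \<in> cspace \<kappa>"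
    and "\<kappa> \<in> charts_at M x \<Longrightarrow> \<kappa>' \<in> charts_at M x \<Longrightarrow>
      w \<kappa>' = dir_deriv (\<lambda>p. cmap \<kappa>' (cinv \<kappa> p)) (cmap \<kappa> x) (w \<kappa>)"
    and "\<kappa> \<notin> charts_at M x \<Longrightarrow> w \<kappa> = 0"
  using assms unfolding tangent_space_def comp_def by blast+

lemma tangent_space_eqI:
  assumes "v \<in> tangent_space M x" "w \<in> tangent_space M x" "\<kappa> \<in> charts_at M x" "v \<kappa> = w \<kappa>"
  shows "v = w"
  using tangent_spaceD[OF assms(1)] tangent_spaceD[OF assms(2)] assms(3,4) by (intro ext) metis

text \<open>The coordinate vector at \<open>x\<close>, specified by its component in the single
  chart \<open>\<kappa>\<close>. As \<open>x\<close> varies with \<open>v\<close> fixed, it is a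
  field with constant component in \<open>\<kappa>\<close>.\<close>

definition tvec :: "('a, 'e::euclidean_space) mfd \<Rightarrow> ('a, 'e) chart \<Rightarrow> 'a \<Rightarrow> 'e \<Rightarrow> ('a, 'e) tvec" where
  "tvec M \<kappa> x v = (\<lambda>\<kappa>'. if \<kappa>' \<in> charts_at M x
     then dir_deriv (\<lambda>p. cmap \<kappa>' (cinv \<kappa> p)) (cmap \<kappa> x) v else 0)"

lemma
  assumes M: "smooth_manifold d M" and \<kappa>: "\<kappa> \<in> charts_at M x" and v: "v \<in> cspace \<kappa>"
  shows tvec_in: "tvec M \<kappa> x v \<in> tangent_space M x"
    and tvec_self: "tvec M \<kappa> x v \<kappa> = v"
proof -
  note \<kappa>' = charts_atD[OF \<kappa>]
  note c = atlas_chart_on[OF M \<kappa>'(1)]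
  have o: "openin (mtop M) (pts M)" by simp
  have x: "x \<in> pts M" using atlas_dom[OF M \<kappa>'(1)] \<kappa>'(2) by blast
  note id = smooth_map_on_id[OF M o]
  show "tvec M \<kappa> x v \<in> tangent_space M x"
    unfolding tangent_space_def comp_def
  proof (intro CollectI conjI allI ballI impI)
    fix \<mu> \<mu>' assume \<mu>: "\<mu> \<in> charts_at M x" and \<mu>': "\<mu>' \<in> charts_at M x"
    show "tvec M \<kappa> x v \<mu> \<in> cspace \<mu>"
      using dir_deriv_chart_in[OF M M o id x \<kappa> \<mu> v] \<mu> by (simp add: tvec_def)
    show "tvec M \<kappa> x v \<mu>' = dir_deriv (\<lambda>p. cmap \<mu>' (cinv \<mu> p)) (cmap \<mu> x) (tvec M \<kappa> x v \<mu>)"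
      using dir_deriv_chart_chain[OF M M o id x \<kappa> \<mu> v charts_at_openin[OF M \<mu>']
          smooth_fun_on_cmap[OF M charts_atD(1)[OF \<mu>']] charts_atD(2)[OF \<mu>']] \<mu> \<mu>'
      by (simp add: tvec_def)
  qed (simp add: tvec_def)
  have "dir_deriv (\<lambda>p. cmap \<kappa> (cinv \<kappa> p)) (cmap \<kappa> x) v = v"
    by (rule dir_deriv_id[OF chart_on_subspace[OF c] chart_on_openin_image[OF c] _ v])
      (use \<kappa>'(2) cinv_cmap[OF c] in auto)
  then show "tvec M \<kappa> x v \<kappa> = v" using \<kappa> by (simp add: tvec_def)
qed

lemma tvec_eq:
  assumes "smooth_manifold d M" "w \<in> tangent_space M x" "\<kappa> \<in> charts_at M x"
  shows "tvec M \<kappa> x (w \<kappa>) = w"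
  using tangent_spaceD(1)[OF assms(2,3)]
  by (intro tangent_space_eqI[OF tvec_in[OF assms(1,3)] assms(2,3)]) (auto simp: tvec_self[OF assms(1,3)])

lemma tv_add_in:
  assumes M: "smooth_manifold d M" and x: "x \<in> pts M" and u: "u \<in> tangent_space M x" and v: "v \<in> tangent_space M x"
  shows "tv_add u v \<in> tangent_space M x" "tv_scale r u \<in> tangent_space M x"
proof -
  have *: "dir_deriv (\<lambda>p. cmap \<kappa>' (cinv \<kappa> p)) (cmap \<kappa> x) (u \<kappa> + v \<kappa>) = u \<kappa>' + v \<kappa>'"
     "dir_deriv (\<lambda>p. cmap \<kappa>' (cinv \<kappa> p)) (cmap \<kappa> x) (r *\<^sub>R u \<kappa>) = r *\<^sub>R u \<kappa>'"
    if \<kappa>: "\<kappa> \<in> charts_at M x" "\<kappa>' \<in> charts_at M x" for \<kappa> \<kappa>'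
  proof -
    note c = atlas_chart_on[OF M charts_atD(1)[OF \<kappa>(1)]]
    have o: "openin (top_of_set (cspace \<kappa>)) (cmap \<kappa> ` (cdom \<kappa> \<inter> cdom \<kappa>'))"
      using chart_on_image_openin[OF c charts_at_openin[OF M \<kappa>(2)]] by (simp add: Int_commute)
    have i: "cmap \<kappa> x \<in> cmap \<kappa> ` (cdom \<kappa> \<inter> cdom \<kappa>')" using charts_atD(2)[OF \<kappa>(1)] charts_atD(2)[OF \<kappa>(2)] by blast
    have s: "smooth_on (cmap \<kappa> ` (cdom \<kappa> \<inter> cdom \<kappa>')) (\<lambda>p. cmap \<kappa>' (cinv \<kappa> p))"
      using atlas_compatible[OF M charts_atD(1)[OF \<kappa>(1)] charts_atD(1)[OF \<kappa>(2)]] by (simp add: comp_def)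
    note t = tangent_spaceD(1)[OF u \<kappa>(1)] tangent_spaceD(1)[OF v \<kappa>(1)]
    show "dir_deriv (\<lambda>p. cmap \<kappa>' (cinv \<kappa> p)) (cmap \<kappa> x) (u \<kappa> + v \<kappa>) = u \<kappa>' + v \<kappa>'"
      "dir_deriv (\<lambda>p. cmap \<kappa>' (cinv \<kappa> p)) (cmap \<kappa> x) (r *\<^sub>R u \<kappa>) = r *\<^sub>R u \<kappa>'"
      using dir_deriv_add[OF chart_on_subspace[OF c] o i s t] dir_deriv_scale[OF chart_on_subspace[OF c] o i s t(1)]
        tangent_spaceD(2)[OF u \<kappa>] tangent_spaceD(2)[OF v \<kappa>] by simp_all
  qed
  show "tv_add u v \<in> tangent_space M x" "tv_scale r u \<in> tangent_space M x"
    unfolding tangent_space_def comp_def tv_add_def tv_scale_def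
    using * tangent_spaceD(1,3)[OF u] tangent_spaceD(1,3)[OF v]
    by (simp_all add: subspace_add subspace_scale charts_at_subspace[OF M])
qed

lemma tvec_add:
  assumes M: "smooth_manifold d M" and \<kappa>: "\<kappa> \<in> charts_at M x" and u: "u \<in> cspace \<kappa>" and v: "v \<in> cspace \<kappa>"
  shows "tvec M \<kappa> x (u + v) = tv_add (tvec M \<kappa> x u) (tvec M \<kappa> x v)"
    and "tvec M \<kappa> x (r *\<^sub>R u) = tv_scale r (tvec M \<kappa> x u)"
proof -
  have x: "x \<in> pts M" using atlas_dom[OF M charts_atD(1)[OF \<kappa>]] charts_atD(2)[OF \<kappa>] by blast
  note s = charts_at_subspace[OF M \<kappa>]
  note i = tvec_in[OF M \<kappa> u] tvec_in[OF M \<kappa> v]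
  show "tvec M \<kappa> x (u + v) = tv_add (tvec M \<kappa> x u) (tvec M \<kappa> x v)"
    by (rule tangent_space_eqI[OF tvec_in[OF M \<kappa>] tv_add_in(1)[OF M x i] \<kappa>])
      (use u v s in \<open>auto simp: tv_add_def tvec_self[OF M \<kappa>] subspace_add\<close>)
  show "tvec M \<kappa> x (r *\<^sub>R u) = tv_scale r (tvec M \<kappa> x u)"
    by (rule tangent_space_eqI[OF tvec_in[OF M \<kappa>] tv_add_in(2)[OF M x i(1) i(1)] \<kappa>])
      (use u v s in \<open>auto simp: tv_scale_def tvec_self[OF M \<kappa>] subspace_scale\<close>)
qed

text \<open>The transformation rule of \<open>v\<close> compensates for a change of chart, so the
  chart picked by \<open>SOME\<close> in \<open>tderiv\<close> can be replaced by any chart at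
  \<open>x\<close>.\<close>

lemma tderiv_chart:
  assumes M: "smooth_manifold d M" and U: "openin (mtop M) U" and f: "smooth_fun_on M U f"
    and x: "x \<in> U" and \<kappa>: "\<kappa> \<in> charts_at M x" and v: "v \<in> tangent_space M x"
  shows "tderiv M f x v = dir_deriv (\<lambda>p. f (cinv \<kappa> p)) (cmap \<kappa> x) (v \<kappa>)"
proof -
  define \<kappa>0 where "\<kappa>0 = (SOME \<kappa>. \<kappa> \<in> charts_at M x)"
  have \<kappa>0: "\<kappa>0 \<in> charts_at M x" unfolding \<kappa>0_def using \<kappa> by (rule someI)
  have "tderiv M f x v = dir_deriv (\<lambda>p. f (cinv \<kappa>0 p)) (cmap \<kappa>0 x) (v \<kappa>0)"
    by (simp add: tderiv_def Let_def \<kappa>0_def comp_def)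
  also have "\<dots> = dir_deriv (\<lambda>p. f (cinv \<kappa> p)) (cmap \<kappa> x) (dir_deriv (\<lambda>p. cmap \<kappa> (cinv \<kappa>0 p)) (cmap \<kappa>0 x) (v \<kappa>0))"
    by (rule dir_deriv_chart_chain[OF M M U smooth_map_on_id[OF M U] x \<kappa>0 \<kappa> tangent_spaceD(1)[OF v \<kappa>0] U f x])
  finally show ?thesis using tangent_spaceD(2)[OF v \<kappa>0 \<kappa>] by simp
qed

text \<open>Each component of a tangent map is the \<open>tderiv\<close> of a coordinate function of
  \<open>f\<close>, so the freedom in the source chart carries over.\<close>

lemma tangent_map_chart:
  assumes M: "smooth_manifold d M" and N: "smooth_manifold d' N"
    and U: "openin (mtop M) U" and f: "smooth_map_on M U N f" and x: "x \<in> U"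
    and \<kappa>: "\<kappa> \<in> charts_at M x" and \<mu>: "\<mu> \<in> charts_at N (f x)" and v: "v \<in> tangent_space M x"
  shows "tangent_map M N f x v \<mu> = dir_deriv (\<lambda>p. cmap \<mu> (f (cinv \<kappa> p))) (cmap \<kappa> x) (v \<kappa>)"
proof -
  let ?V = "U \<inter> f -` cdom \<mu>"
  have V: "openin (mtop M) ?V" by (rule smooth_map_on_vimage[OF f U charts_at_openin[OF N \<mu>]])
  have "smooth_fun_on M ?V (\<lambda>y. cmap \<mu> (f y))"
    by (rule smooth_map_on_imp_fun[OF smooth_map_on_subset[OF f]]) (use charts_atD[OF \<mu>] in auto)
  from tderiv_chart[OF M V this _ \<kappa> v]
  show ?thesis using x \<mu> charts_atD(2)[OF \<mu>] by (simp add: tangent_map_def tderiv_def comp_def)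
qed

lemma tangent_map_in:
  assumes M: "smooth_manifold d M" and N: "smooth_manifold d' N"
    and U: "openin (mtop M) U" and f: "smooth_map_on M U N f" and x: "x \<in> U" and v: "v \<in> tangent_space M x"
  shows "tangent_map M N f x v \<in> tangent_space N (f x)"
  unfolding tangent_space_def comp_def
proof (intro CollectI conjI allI ballI impI)
  obtain \<kappa> where \<kappa>: "\<kappa> \<in> charts_at M x" using atlas_covers[OF M openin_in_pts[OF U x]] by blast
  fix \<mu> \<mu>' assume \<mu>: "\<mu> \<in> charts_at N (f x)" and \<mu>': "\<mu>' \<in> charts_at N (f x)"
  note vk = tangent_spaceD(1)[OF v \<kappa>]
  note t = tangent_map_chart[OF M N U f x \<kappa> _ v]
  show "tangent_map M N f x v \<mu> \<in> cspace \<mu>"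
    unfolding t[OF \<mu>] by (rule dir_deriv_chart_in[OF M N U f x \<kappa> \<mu> vk])
  show "tangent_map M N f x v \<mu>' = dir_deriv (\<lambda>p. cmap \<mu>' (cinv \<mu> p)) (cmap \<mu> (f x)) (tangent_map M N f x v \<mu>)"
    unfolding t[OF \<mu>] t[OF \<mu>']
    by (rule dir_deriv_chart_chain[OF M N U f x \<kappa> \<mu> vk charts_at_openin[OF N \<mu>']
          smooth_fun_on_cmap[OF N charts_atD(1)[OF \<mu>']] charts_atD(2)[OF \<mu>']])
qed (simp add: tangent_map_def)

lemma tderiv_compose:
  assumes M: "smooth_manifold d M" and N: "smooth_manifold d' N"
    and U: "openin (mtop M) U" and f: "smooth_map_on M U N f" and x: "x \<in> U"
    and W: "openin (mtop N) W" and g: "smooth_fun_on N W g" and fx: "f x \<in> W" and v: "v \<in> tangent_space M x"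
  shows "tderiv M (\<lambda>y. g (f y)) x v = tderiv N g (f x) (tangent_map M N f x v)"
proof -
  obtain \<kappa> where \<kappa>: "\<kappa> \<in> charts_at M x" using atlas_covers[OF M openin_in_pts[OF U x]] by blast
  obtain \<mu> where \<mu>: "\<mu> \<in> charts_at N (f x)" using atlas_covers[OF N openin_in_pts[OF W fx]] by blast
  have V: "openin (mtop M) (U \<inter> f -` W)" by (rule smooth_map_on_vimage[OF f U W])
  have "smooth_fun_on M (U \<inter> f -` W) (\<lambda>y. g (f y))"
    by (rule smooth_fun_on_compose[OF M N V smooth_map_on_subset[OF f] _ g]) auto
  from tderiv_chart[OF M V this _ \<kappa> v]
  have "tderiv M (\<lambda>y. g (f y)) x v = dir_deriv (\<lambda>p. g (f (cinv \<kappa> p))) (cmap \<kappa> x) (v \<kappa>)"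
    using x fx by simp
  also have "\<dots> = tderiv N g (f x) (tangent_map M N f x v)"
    unfolding tderiv_chart[OF N W g fx \<mu> tangent_map_in[OF M N U f x v]] tangent_map_chart[OF M N U f x \<kappa> \<mu> v]
    by (rule dir_deriv_chart_chain[OF M N U f x \<kappa> \<mu> tangent_spaceD(1)[OF v \<kappa>] W g fx])
  finally show ?thesis .
qed

text \<open>Componentwise this is \<open>tderiv_compose\<close> for the coordinate functions of
  \<open>g\<close>.\<close>

lemma tangent_map_compose:
  assumes M: "smooth_manifold d M" and N: "smooth_manifold d' N" and Z: "smooth_manifold d'' Z"
    and U: "openin (mtop M) U" and f: "smooth_map_on M U N f" and x: "x \<in> U"
    and W: "openin (mtop N) W" and g: "smooth_map_on N W Z g" and fx: "f x \<in> W" and v: "v \<in> tangent_space M x"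
  shows "tangent_map M Z (\<lambda>y. g (f y)) x v = tangent_map N Z g (f x) (tangent_map M N f x v)"
proof
  fix \<zeta>
  show "tangent_map M Z (\<lambda>y. g (f y)) x v \<zeta> = tangent_map N Z g (f x) (tangent_map M N f x v) \<zeta>"
  proof (cases "\<zeta> \<in> charts_at Z (g (f x))")
    case \<zeta>: True
    let ?W = "W \<inter> g -` cdom \<zeta>"
    have W': "openin (mtop N) ?W" by (rule smooth_map_on_vimage[OF g W charts_at_openin[OF Z \<zeta>]])
    have "smooth_fun_on N ?W (\<lambda>y. cmap \<zeta> (g y))"
      by (rule smooth_map_on_imp_fun[OF smooth_map_on_subset[OF g]]) (use charts_atD[OF \<zeta>] in auto)
    from tderiv_compose[OF M N U f x W' this _ v] fx charts_atD(2)[OF \<zeta>] \<zeta>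
    show ?thesis by (simp add: tangent_map_def tderiv_def comp_def)
  qed (simp add: tangent_map_def)
qed

lemma tangent_map_id:
  assumes M: "smooth_manifold d M" and x: "x \<in> pts M" and v: "v \<in> tangent_space M x"
  shows "tangent_map M M (\<lambda>x. x) x v = v"
proof -
  obtain \<kappa> where \<kappa>: "\<kappa> \<in> charts_at M x" using atlas_covers[OF M x] by blast
  have i: "smooth_map_on M (pts M) M (\<lambda>x. x)" by (rule smooth_map_on_id[OF M]) simp
  show ?thesis
    using tangent_map_chart[OF M M _ i x \<kappa> _ v] tangent_spaceD(2)[OF v \<kappa> \<kappa>] \<kappa>
    by (intro tangent_space_eqI[OF tangent_map_in[OF M M _ i x v] v \<kappa>]) auto
qed

lemma tderiv_cong:
  assumes M: "smooth_manifold d M" and U: "openin (mtop M) U" and f: "smooth_fun_on M U f" and x: "x \<in> U"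
    and eq: "\<And>y. y \<in> U \<Longrightarrow> f y = g y" and v: "v \<in> tangent_space M x"
  shows "tderiv M f x v = tderiv M g x v"
proof -
  obtain \<kappa> where \<kappa>: "\<kappa> \<in> charts_at M x" using atlas_covers[OF M openin_in_pts[OF U x]] by blast
  note c = atlas_chart_on[OF M charts_atD(1)[OF \<kappa>]]
  have g: "smooth_fun_on M U g" by (rule smooth_fun_on_cong[OF M, THEN iffD1, OF _ f]) (rule eq)
  show ?thesis
    unfolding tderiv_chart[OF M U f x \<kappa> v] tderiv_chart[OF M U g x \<kappa> v]
    by (rule dir_deriv_cong[OF chart_on_subspace[OF c] chart_on_image_openin[OF c U] _ tangent_spaceD(1)[OF v \<kappa>]
          _ smooth_fun_on_rep[OF f charts_atD(1)[OF \<kappa>]]])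
      (use x charts_atD(2)[OF \<kappa>] cinv_cmap[OF c] eq in auto)
qed

lemma tangent_map_cong:
  assumes M: "smooth_manifold d M" and N: "smooth_manifold d' N" and U: "openin (mtop M) U"
    and f: "smooth_map_on M U N f" and x: "x \<in> U"
    and eq: "\<And>y. y \<in> U \<Longrightarrow> f y = g y" and v: "v \<in> tangent_space M x"
  shows "tangent_map M N f x v = tangent_map M N g x v"
proof
  fix \<mu>
  show "tangent_map M N f x v \<mu> = tangent_map M N g x v \<mu>"
  proof (cases "\<mu> \<in> charts_at N (f x)")
    case \<mu>: True
    let ?V = "U \<inter> f -` cdom \<mu>"
    have V: "openin (mtop M) ?V" by (rule smooth_map_on_vimage[OF f U charts_at_openin[OF N \<mu>]])
    have "smooth_fun_on M ?V (\<lambda>y. cmap \<mu> (f y))"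
      by (rule smooth_map_on_imp_fun[OF smooth_map_on_subset[OF f]]) (use charts_atD[OF \<mu>] in auto)
    from tderiv_cong[OF M V this _ _ v, of "\<lambda>y. cmap \<mu> (g y)"] x charts_atD(2)[OF \<mu>] \<mu> eq
    show ?thesis by (simp add: tangent_map_def tderiv_def comp_def)
  qed (use eq[OF x] in \<open>simp add: tangent_map_def\<close>)
qed

text \<open>Together with \<open>tderiv_eqI\<close> it transfers the rules for products,
  exponentials and constants from ordinary derivatives in a chart.\<close>

lemma tderiv_has_derivative:
  assumes M: "smooth_manifold d M" and U: "openin (mtop M) U" and f: "smooth_fun_on M U f"
    and x: "x \<in> U" and \<kappa>: "\<kappa> \<in> charts_at M x"
  obtains f' where "((\<lambda>p. f (cinv \<kappa> p)) has_derivative f') (at (cmap \<kappa> x) within cmap \<kappa> ` (U \<inter> cdom \<kappa>))"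
    "\<And>v. v \<in> tangent_space M x \<Longrightarrow> tderiv M f x v = f' (v \<kappa>)"
proof -
  note c = atlas_chart_on[OF M charts_atD(1)[OF \<kappa>]]
  have "cmap \<kappa> x \<in> cmap \<kappa> ` (U \<inter> cdom \<kappa>)" using x charts_atD(2)[OF \<kappa>] by blast
  from smooth_on_has_dir_deriv[OF chart_on_subspace[OF c] chart_on_image_openin[OF c U] this
      smooth_fun_on_rep[OF f charts_atD(1)[OF \<kappa>]]]
  show ?thesis using that tderiv_chart[OF M U f x \<kappa>] tangent_spaceD(1)[OF _ \<kappa>] by metis
qed

lemma tderiv_eqI:
  assumes M: "smooth_manifold d M" and U: "openin (mtop M) U" and f: "smooth_fun_on M U f"
    and x: "x \<in> U" and \<kappa>: "\<kappa> \<in> charts_at M x" and v: "v \<in> tangent_space M x"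
    and "((\<lambda>p. f (cinv \<kappa> p)) has_derivative f') (at (cmap \<kappa> x) within cmap \<kappa> ` (U \<inter> cdom \<kappa>))"
  shows "tderiv M f x v = f' (v \<kappa>)"
proof -
  note c = atlas_chart_on[OF M charts_atD(1)[OF \<kappa>]]
  have "cmap \<kappa> x \<in> cmap \<kappa> ` (U \<inter> cdom \<kappa>)" using x charts_atD(2)[OF \<kappa>] by blast
  from dir_deriv_eq[OF chart_on_subspace[OF c] chart_on_image_openin[OF c U] this tangent_spaceD(1)[OF v \<kappa>] assms(7)]
  show ?thesis by (simp add: tderiv_chart[OF M U f x \<kappa> v])
qed

lemma tderiv_mult:
  fixes f g :: "'a \<Rightarrow> complex"
  assumes M: "smooth_manifold d M" and U: "openin (mtop M) U" and f: "smooth_fun_on M U f" and g: "smooth_fun_on M U g"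
    and x: "x \<in> U" and v: "v \<in> tangent_space M x"
  shows "tderiv M (\<lambda>y. f y * g y) x v = f x * tderiv M g x v + tderiv M f x v * g x"
proof -
  obtain \<kappa> where \<kappa>: "\<kappa> \<in> charts_at M x" using atlas_covers[OF M openin_in_pts[OF U x]] by blast
  obtain f' where f': "((\<lambda>p. f (cinv \<kappa> p)) has_derivative f') (at (cmap \<kappa> x) within cmap \<kappa> ` (U \<inter> cdom \<kappa>))"
    "\<And>v. v \<in> tangent_space M x \<Longrightarrow> tderiv M f x v = f' (v \<kappa>)"
    using tderiv_has_derivative[OF M U f x \<kappa>] by blast
  obtain g' where g': "((\<lambda>p. g (cinv \<kappa> p)) has_derivative g') (at (cmap \<kappa> x) within cmap \<kappa> ` (U \<inter> cdom \<kappa>))"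
    "\<And>v. v \<in> tangent_space M x \<Longrightarrow> tderiv M g x v = g' (v \<kappa>)"
    using tderiv_has_derivative[OF M U g x \<kappa>] by blast
  show ?thesis
    using tderiv_eqI[OF M U smooth_fun_on_mult[OF f g] x \<kappa> v has_derivative_mult[OF f'(1) g'(1)]]
      f'(2)[OF v] g'(2)[OF v] by (simp add: charts_at_cinv[OF M \<kappa>])
qed

lemma tderiv_exp:
  fixes f :: "'a \<Rightarrow> complex"
  assumes M: "smooth_manifold d M" and U: "openin (mtop M) U" and f: "smooth_fun_on M U f"
    and x: "x \<in> U" and v: "v \<in> tangent_space M x"
  shows "tderiv M (\<lambda>y. exp (f y)) x v = exp (f x) * tderiv M f x v"
proof -
  obtain \<kappa> where \<kappa>: "\<kappa> \<in> charts_at M x" using atlas_covers[OF M openin_in_pts[OF U x]] by blast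
  obtain f' where f': "((\<lambda>p. f (cinv \<kappa> p)) has_derivative f') (at (cmap \<kappa> x) within cmap \<kappa> ` (U \<inter> cdom \<kappa>))"
    "\<And>v. v \<in> tangent_space M x \<Longrightarrow> tderiv M f x v = f' (v \<kappa>)"
    using tderiv_has_derivative[OF M U f x \<kappa>] by blast
  have "(exp has_derivative (\<lambda>h. exp z * h)) (at z within A)" for z :: complex and A
    using DERIV_exp[of z] has_derivative_at_withinI by (auto simp: has_field_derivative_def)
  from tderiv_eqI[OF M U smooth_fun_on_exp[OF M f] x \<kappa> v has_derivative_in_compose[OF f'(1) this]]
  show ?thesis using f'(2)[OF v] by (simp add: charts_at_cinv[OF M \<kappa>])
qed

lemma tderiv_const:
  assumes M: "smooth_manifold d M" and x: "x \<in> pts M" and v: "v \<in> tangent_space M x"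
  shows "tderiv M (\<lambda>y. c) x v = 0"
proof -
  obtain \<kappa> where \<kappa>: "\<kappa> \<in> charts_at M x" using atlas_covers[OF M x] by blast
  show ?thesis
    using tderiv_eqI[OF M _ smooth_fun_on_const x \<kappa> v has_derivative_const] by simp
qed

text \<open>A ball in \<open>cspace \<kappa>\<close> around the image of \<open>x\<close> is convex,
  and all directional derivatives vanish on it because every vector of
  \<open>cspace \<kappa>\<close> is the component of a \<open>tvec\<close>.\<close>

lemma locally_constant_if_tderiv_zero:
  assumes M: "smooth_manifold d M" and U: "openin (mtop M) U" and f: "smooth_fun_on M U f"
    and zero: "\<And>x v. x \<in> U \<Longrightarrow> v \<in> tangent_space M x \<Longrightarrow> tderiv M f x v = 0" and x: "x \<in> U"
  obtains W where "openin (mtop M) W" "x \<in> W" "W \<subseteq> U" "\<And>y. y \<in> W \<Longrightarrow> f y = f x"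
proof -
  obtain \<kappa> where \<kappa>: "\<kappa> \<in> charts_at M x" using atlas_covers[OF M openin_in_pts[OF U x]] by blast
  note c = atlas_chart_on[OF M charts_atD(1)[OF \<kappa>]]
  let ?D = "cmap \<kappa> ` (U \<inter> cdom \<kappa>)"
  note S = chart_on_subspace[OF c]
  have D: "openin (top_of_set (cspace \<kappa>)) ?D" by (rule chart_on_image_openin[OF c U])
  have p: "cmap \<kappa> x \<in> ?D" using x charts_atD(2)[OF \<kappa>] by blast
  then obtain e where e: "e > 0" "ball (cmap \<kappa> x) e \<inter> cspace \<kappa> \<subseteq> ?D"
    using D[unfolded openin_contains_ball, THEN conjunct2] by (elim bspec[elim_format] exE conjE)
  let ?E = "ball (cmap \<kappa> x) e \<inter> cspace \<kappa>" and ?W = "{y \<in> cdom \<kappa>. cmap \<kappa> y \<in> ball (cmap \<kappa> x) e \<inter> cspace \<kappa>}"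
  have E: "openin (top_of_set (cspace \<kappa>)) ?E" by (simp add: Int_commute openin_open_Int)
  have dz: "dir_deriv (\<lambda>p. f (cinv \<kappa> p)) q v = 0" if q: "q \<in> ?E" and v: "v \<in> cspace \<kappa>" for q v
  proof -
    obtain y where y: "y \<in> U" "y \<in> cdom \<kappa>" "q = cmap \<kappa> y" using q e(2) by blast
    then have \<kappa>y: "\<kappa> \<in> charts_at M y" using charts_atD(1)[OF \<kappa>] by (simp add: charts_at_def)
    show ?thesis using tderiv_chart[OF M U f y(1) \<kappa>y tvec_in[OF M \<kappa>y v]] zero[OF y(1) tvec_in[OF M \<kappa>y v]]
      by (simp add: tvec_self[OF M \<kappa>y v] y(3))
  qed
  have WU: "?W \<subseteq> U"
  proof
    fix y assume y: "y \<in> ?W"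
    then obtain z where "z \<in> U" "z \<in> cdom \<kappa>" "cmap \<kappa> y = cmap \<kappa> z" using e(2) by blast
    then show "y \<in> U" using y chart_on_inj[OF c] by (metis (mono_tags, lifting) inj_onD mem_Collect_eq)
  qed
  have xE: "cmap \<kappa> x \<in> ?E" using e(1) p D openin_imp_subset by fastforce
  show ?thesis
  proof (rule that[of ?W])
    show "openin (mtop M) ?W" using chart_on_preimage_openin[OF c E] .
    show "x \<in> ?W" using xE charts_atD(2)[OF \<kappa>] by simp
    fix y assume y: "y \<in> ?W"
    have "f (cinv \<kappa> (cmap \<kappa> y)) = f (cinv \<kappa> (cmap \<kappa> x))"
      by (rule locally_constant_if_dir_deriv_zero[OF S E _ _ dz])
        (use y xE e(2) S in \<open>auto intro!: convex_Int subspace_imp_convex[of "cspace \<kappa>"]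
           intro: smooth_on_subset[OF smooth_fun_on_rep[OF f charts_atD(1)[OF \<kappa>]]]\<close>)
    then show "f y = f x" using y charts_atD(2)[OF \<kappa>] cinv_cmap[OF c] by simp
  qed (rule WU)
qed

text \<open>In another chart the component is a derivative of the transition map in the fixed
  direction \<open>v\<close>, hence smooth in the base point.\<close>

lemma tvec_vector_field:
  assumes M: "smooth_manifold d M" and \<kappa>: "\<kappa> \<in> atlas M" and U: "U \<subseteq> cdom \<kappa>" and v: "v \<in> cspace \<kappa>"
  shows "(\<lambda>x. tvec M \<kappa> x v) \<in> vector_fields M U"
  unfolding vector_fields_def
proof (intro CollectI conjI ballI)
  note c = atlas_chart_on[OF M \<kappa>]
  show "tvec M \<kappa> x v \<in> tangent_space M x" if "x \<in> U" for x
    using tvec_in[OF M _ v] that U \<kappa> by (auto simp: charts_at_def)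
  fix \<kappa>' assume \<kappa>': "\<kappa>' \<in> atlas M"
  note c' = atlas_chart_on[OF M \<kappa>']
  let ?D = "cmap \<kappa> ` (cdom \<kappa> \<inter> cdom \<kappa>')"
  have "openin (top_of_set (cspace \<kappa>)) ?D"
    using chart_on_image_openin[OF c chart_on_openin[OF c']] by (simp add: Int_commute)
  then have s: "smooth_on ?D (\<lambda>p. dir_deriv (\<lambda>p. cmap \<kappa>' (cinv \<kappa> p)) p v)"
    by (rule smooth_on_dir_deriv[OF chart_on_subspace[OF c] _ _ v])
      (use atlas_compatible[OF M \<kappa> \<kappa>'] in \<open>simp add: comp_def\<close>)
  have "smooth_on (cmap \<kappa>' ` (U \<inter> cdom \<kappa>')) (\<lambda>p. dir_deriv (\<lambda>p. cmap \<kappa>' (cinv \<kappa> p)) (cmap \<kappa> (cinv \<kappa>' p)) v)"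
  proof (rule smooth_on_compose[OF s])
    show "smooth_on (cmap \<kappa>' ` (U \<inter> cdom \<kappa>')) (\<lambda>p. cmap \<kappa> (cinv \<kappa>' p))"
      using smooth_on_subset[OF atlas_compatible[OF M \<kappa>' \<kappa>], of "cmap \<kappa>' ` (U \<inter> cdom \<kappa>')"] U by (auto simp: comp_def)
  qed (use U cinv_cmap[OF c'] in auto)
  then show "smooth_on (cmap \<kappa>' ` (U \<inter> cdom \<kappa>')) (\<lambda>p. tvec M \<kappa> (cinv \<kappa>' p) v \<kappa>')"
    by (rule smooth_on_cong[THEN iffD1, rotated])
      (use \<kappa>' cinv_cmap[OF c'] in \<open>auto simp: tvec_def charts_at_def\<close>)
qed

section \<open>Diffeomorphisms\<close>

lemma
  assumes "diffeomorphism M N \<Phi>"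
  shows diffeo_in: "x \<in> pts M \<Longrightarrow> \<Phi> x \<in> pts N"
    and diffeo_inv_in: "y \<in> pts N \<Longrightarrow> inv_on M \<Phi> y \<in> pts M"
    and diffeo_inv1: "x \<in> pts M \<Longrightarrow> inv_on M \<Phi> (\<Phi> x) = x"
    and diffeo_inv2: "y \<in> pts N \<Longrightarrow> \<Phi> (inv_on M \<Phi> y) = y"
    and diffeo_smooth: "smooth_map_on M (pts M) N \<Phi>"
    and diffeo_smooth_inv: "smooth_map_on N (pts N) M (inv_on M \<Phi>)"
  using assms unfolding diffeomorphism_def inv_on_def
  by (auto simp: bij_betw_def inv_into_into f_inv_into_f)

lemma diffeo_inv_inv: "diffeomorphism M N \<Phi> \<Longrightarrow> x \<in> pts M \<Longrightarrow> inv_on N (inv_on M \<Phi>) x = \<Phi> x"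
  unfolding inv_on_def[of N]
  by (rule inv_into_f_eq) (auto simp: diffeo_inv1 diffeo_in intro!: inj_on_inverseI[of _ \<Phi>] diffeo_inv2)

lemma diffeomorphism_inv:
  assumes M: "smooth_manifold d M" and N: "smooth_manifold d' N" and \<Phi>: "diffeomorphism M N \<Phi>"
  shows "diffeomorphism N M (inv_on M \<Phi>)"
  unfolding diffeomorphism_def
proof (intro conjI)
  show "bij_betw (inv_on M \<Phi>) (pts N) (pts M)"
    by (rule bij_betwI[of _ _ _ \<Phi>]) (auto simp: diffeo_inv1[OF \<Phi>] diffeo_inv2[OF \<Phi>] diffeo_in[OF \<Phi>] diffeo_inv_in[OF \<Phi>])
  show "smooth_map_on M (pts M) N (inv_on N (inv_on M \<Phi>))"
    by (rule smooth_map_on_cong[OF M _ _ diffeo_smooth[OF \<Phi>]]) (auto simp: diffeo_inv_inv[OF \<Phi>])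
qed (rule diffeo_smooth_inv[OF \<Phi>])

lemma diffeo_image_eq:
  assumes "diffeomorphism M N \<Phi>" "U \<subseteq> pts M"
  shows "\<Phi> ` U = pts N \<inter> inv_on M \<Phi> -` U"
  using assms diffeo_in[OF assms(1)] diffeo_inv1[OF assms(1)] diffeo_inv2[OF assms(1)]
  by (auto simp: subset_iff image_iff) metis

lemma diffeo_image_openin:
  assumes "diffeomorphism M N \<Phi>" "openin (mtop M) U"
  shows "openin (mtop N) (\<Phi> ` U)"
  unfolding diffeo_image_eq[OF assms(1) openin_subset[OF assms(2)]]
  by (rule smooth_map_on_vimage[OF diffeo_smooth_inv[OF assms(1)] _ assms(2)]) simp

text \<open>Used with mutually inverse homeomorphisms \<open>f\<close> and \<open>g\<close>: points
  are renamed while coordinates stay the same. The restriction keeps the chart extensional, as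
  \<open>chart_on\<close> demands. Both \<open>push_chart\<close> and the charts of a pulled back
  leaf are instances.\<close>

definition tchart :: "('a \<Rightarrow> 'b) \<Rightarrow> ('b \<Rightarrow> 'a) \<Rightarrow> ('b, 'e) chart \<Rightarrow> ('a, 'e) chart" where
  "tchart f g \<kappa> = \<lparr>cdom = g ` cdom \<kappa>, cmap = restrict (cmap \<kappa> \<circ> f) (g ` cdom \<kappa>), cspace = cspace \<kappa>\<rparr>"

lemma tchart_simps [simp]:
  "cdom (tchart f g \<kappa>) = g ` cdom \<kappa>" "cspace (tchart f g \<kappa>) = cspace \<kappa>"
  by (simp_all add: tchart_def)

lemma homeomorphic_mapsD:
  assumes "homeomorphic_maps X Y f g"
  shows "x \<in> topspace X \<Longrightarrow> f x \<in> topspace Y" "y \<in> topspace Y \<Longrightarrow> g y \<in> topspace X"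
    "x \<in> topspace X \<Longrightarrow> g (f x) = x" "y \<in> topspace Y \<Longrightarrow> f (g y) = y"
  using assms unfolding homeomorphic_maps_def continuous_map_def Pi_iff by blast+

lemma tchart_cmap:
  assumes "homeomorphic_maps X Y f g" "cdom \<kappa> \<subseteq> topspace Y" "y \<in> cdom \<kappa>"
  shows "cmap (tchart f g \<kappa>) (g y) = cmap \<kappa> y"
  using assms homeomorphic_mapsD(4)[OF assms(1)] by (auto simp: tchart_def)

lemma tchart_image:
  assumes "homeomorphic_maps X Y f g" "cdom \<kappa> \<subseteq> topspace Y" "A \<subseteq> cdom \<kappa>"
  shows "cmap (tchart f g \<kappa>) ` (g ` A) = cmap \<kappa> ` A"
  unfolding image_image by (rule image_cong) (use tchart_cmap[OF assms(1,2)] assms(3) in auto)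

lemma tchart_chart_on:
  assumes h: "homeomorphic_maps X Y f g" and c: "chart_on d Y \<kappa>"
  shows "chart_on d X (tchart f g \<kappa>)"
  unfolding chart_on_def
proof (intro conjI)
  have dom: "cdom \<kappa> \<subseteq> topspace Y" by (rule openin_subset[OF chart_on_openin[OF c]])
  have im: "cmap (tchart f g \<kappa>) ` cdom (tchart f g \<kappa>) = cmap \<kappa> ` cdom \<kappa>"
    using tchart_image[OF h dom order_refl] by simp
  have "homeomorphic_map Y X g" using h homeomorphic_maps_map homeomorphic_maps_sym by metis
  then show "openin X (cdom (tchart f g \<kappa>))"
    using homeomorphic_map_openness[of Y X g "cdom \<kappa>"] dom chart_on_openin[OF c] by simp
  show "subspace (cspace (tchart f g \<kappa>))" using chart_on_subspace[OF c] by simp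
  show "openin (top_of_set (cspace (tchart f g \<kappa>))) (cmap (tchart f g \<kappa>) ` cdom (tchart f g \<kappa>))"
    unfolding im using chart_on_openin_image[OF c] by simp
  show "dim (cspace (tchart f g \<kappa>)) = d" using c by (simp add: chart_on_def)
  show "cmap (tchart f g \<kappa>) \<in> extensional (cdom (tchart f g \<kappa>))" by (simp add: tchart_def)
  have "f ` (topspace X \<inter> g ` cdom \<kappa>) = topspace Y \<inter> cdom \<kappa>"
    using homeomorphic_mapsD[OF h] dom by force
  then have "homeomorphic_maps (subtopology X (g ` cdom \<kappa>)) (subtopology Y (cdom \<kappa>)) f g"
    by (rule homeomorphic_maps_subtopologies[OF h])
  then have "homeomorphic_map (subtopology X (g ` cdom \<kappa>)) (subtopology Y (cdom \<kappa>)) f"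
    using homeomorphic_map_maps by blast
  moreover have "homeomorphic_map (subtopology Y (cdom \<kappa>)) (top_of_set (cmap \<kappa> ` cdom \<kappa>)) (cmap \<kappa>)"
    using c by (simp add: chart_on_def)
  ultimately have "homeomorphic_map (subtopology X (g ` cdom \<kappa>)) (top_of_set (cmap \<kappa> ` cdom \<kappa>)) (cmap \<kappa> \<circ> f)"
    by (rule homeomorphic_map_compose)
  then show "homeomorphic_map (subtopology X (cdom (tchart f g \<kappa>)))
      (top_of_set (cmap (tchart f g \<kappa>) ` cdom (tchart f g \<kappa>))) (cmap (tchart f g \<kappa>))"
    unfolding im unfolding tchart_simps by (rule homeomorphic_map_eq) (auto simp: tchart_def)
qed

lemma tchart_cinv:
  assumes h: "homeomorphic_maps X Y f g" and c: "chart_on d Y \<kappa>" and p: "p \<in> cmap \<kappa> ` cdom \<kappa>"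
  shows "cinv (tchart f g \<kappa>) p = g (cinv \<kappa> p)"
proof -
  have dom: "cdom \<kappa> \<subseteq> topspace Y" by (rule openin_subset[OF chart_on_openin[OF c]])
  obtain y where y: "y \<in> cdom \<kappa>" "p = cmap \<kappa> y" using p by blast
  have "cinv (tchart f g \<kappa>) (cmap (tchart f g \<kappa>) (g y)) = g y"
    by (rule cinv_cmap[OF tchart_chart_on[OF h c]]) (use y in simp)
  then show ?thesis using tchart_cmap[OF h dom y(1)] cinv_cmap[OF c y(1)] y(2) by simp
qed

lemma diffeo_homeomorphic_maps:
  assumes "diffeomorphism M N \<Phi>"
  shows "homeomorphic_maps (mtop N) (mtop M) (inv_on M \<Phi>) \<Phi>"
  unfolding homeomorphic_maps_def
  using smooth_map_on_continuous[OF diffeo_smooth[OF assms]] smooth_map_on_continuous[OF diffeo_smooth_inv[OF assms]]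
    diffeo_inv1[OF assms] diffeo_inv2[OF assms] by simp

definition push_chart :: "('a, 'e) mfd \<Rightarrow> ('a \<Rightarrow> 'b) \<Rightarrow> ('a, 'e) chart \<Rightarrow> ('b, 'e) chart" where
  "push_chart M \<Phi> \<kappa> = tchart (inv_on M \<Phi>) \<Phi> \<kappa>"

text \<open>Compatibility with the charts of \<open>N\<close> amounts to smoothness of the
  representatives of \<open>\<Phi>\<close> and its inverse; the maximality of the atlas then admits
  the chart.\<close>

lemma push_chart_in_atlas:
  assumes M: "smooth_manifold d M" and N: "smooth_manifold d N" and \<Phi>: "diffeomorphism M N \<Phi>" and \<kappa>: "\<kappa> \<in> atlas M"
  shows "push_chart M \<Phi> \<kappa> \<in> atlas N"
    and "p \<in> cmap \<kappa> ` cdom \<kappa> \<Longrightarrow> cinv (push_chart M \<Phi> \<kappa>) p = \<Phi> (cinv \<kappa> p)"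
proof -
  let ?\<kappa> = "push_chart M \<Phi> \<kappa>"
  note c = atlas_chart_on[OF M \<kappa>] and h = diffeo_homeomorphic_maps[OF \<Phi>]
  have dom: "cdom \<kappa> \<subseteq> pts M" by (rule atlas_dom[OF M \<kappa>])
  have cd: "cdom ?\<kappa> = \<Phi> ` cdom \<kappa>" by (simp add: push_chart_def)
  have con: "chart_on d (mtop N) ?\<kappa>" unfolding push_chart_def by (rule tchart_chart_on[OF h c])
  have inv: "cinv ?\<kappa> p = \<Phi> (cinv \<kappa> p)" if "p \<in> cmap \<kappa> ` cdom \<kappa>" for p
    unfolding push_chart_def by (rule tchart_cinv[OF h c that])
  then show "p \<in> cmap \<kappa> ` cdom \<kappa> \<Longrightarrow> cinv ?\<kappa> p = \<Phi> (cinv \<kappa> p)" .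
  have "charts_compatible ?\<kappa> \<mu>" if \<mu>: "\<mu> \<in> atlas N" for \<mu>
    unfolding charts_compatible_def
  proof
    note c\<mu> = atlas_chart_on[OF N \<mu>]
    have e1: "cmap ?\<kappa> ` (cdom ?\<kappa> \<inter> cdom \<mu>) = cmap \<kappa> ` (pts M \<inter> cdom \<kappa> \<inter> \<Phi> -` cdom \<mu>)"
    proof -
      have "cdom ?\<kappa> \<inter> cdom \<mu> = \<Phi> ` (pts M \<inter> cdom \<kappa> \<inter> \<Phi> -` cdom \<mu>)" using dom by (auto simp: cd)
      moreover have "pts M \<inter> cdom \<kappa> \<inter> \<Phi> -` cdom \<mu> \<subseteq> cdom \<kappa>" by auto
      ultimately show ?thesis using tchart_image[OF h dom] by (simp add: push_chart_def)
    qed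
    show "smooth_on (cmap ?\<kappa> ` (cdom ?\<kappa> \<inter> cdom \<mu>)) (cmap \<mu> \<circ> cinv ?\<kappa>)"
      unfolding e1
      by (rule smooth_on_cong[THEN iffD1, OF _ smooth_map_on_rep[OF diffeo_smooth[OF \<Phi>] \<kappa> \<mu>]]) (use inv in auto)
    have e2: "cdom ?\<kappa> \<inter> cdom \<mu> = pts N \<inter> cdom \<mu> \<inter> inv_on M \<Phi> -` cdom \<kappa>"
      using diffeo_image_eq[OF \<Phi> dom] by (auto simp: cd)
    show "smooth_on (cmap \<mu> ` (cdom ?\<kappa> \<inter> cdom \<mu>)) (cmap ?\<kappa> \<circ> cinv \<mu>)"
      unfolding e2
      by (rule smooth_on_cong[THEN iffD1, OF _ smooth_map_on_rep[OF diffeo_smooth_inv[OF \<Phi>] \<mu> \<kappa>]])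
        (use cinv_cmap[OF c\<mu>] e2 in \<open>auto simp: push_chart_def tchart_def\<close>)
  qed
  then show "?\<kappa> \<in> atlas N" using N con unfolding smooth_manifold_def by blast
qed

lemma push_chart_simps:
  assumes "smooth_manifold d M" "diffeomorphism M N \<Phi>" "\<kappa> \<in> atlas M"
  shows "cdom (push_chart M \<Phi> \<kappa>) = \<Phi> ` cdom \<kappa>" "cspace (push_chart M \<Phi> \<kappa>) = cspace \<kappa>"
    "x \<in> cdom \<kappa> \<Longrightarrow> cmap (push_chart M \<Phi> \<kappa>) (\<Phi> x) = cmap \<kappa> x"
  unfolding push_chart_def
  using tchart_cmap[OF diffeo_homeomorphic_maps[OF assms(2)] atlas_dom[OF assms(1,3)]] by simp_all

text \<open>In \<open>\<kappa>\<close> and its push-forward, \<open>\<Phi>\<close> has the identity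
  as representative, so coordinate vectors correspond.\<close>

lemma tangent_map_tvec:
  assumes M: "smooth_manifold d M" and N: "smooth_manifold d N" and \<Phi>: "diffeomorphism M N \<Phi>"
    and \<kappa>: "\<kappa> \<in> charts_at M x" and v: "v \<in> cspace \<kappa>"
  shows "tangent_map M N \<Phi> x (tvec M \<kappa> x v) = tvec N (push_chart M \<Phi> \<kappa>) (\<Phi> x) v"
proof -
  let ?\<kappa> = "push_chart M \<Phi> \<kappa>"
  note \<kappa>' = charts_atD[OF \<kappa>]
  note c = atlas_chart_on[OF M \<kappa>'(1)]
  note p = push_chart_in_atlas[OF M N \<Phi> \<kappa>'(1)] and s = push_chart_simps[OF M \<Phi> \<kappa>'(1)]
  have x: "x \<in> pts M" using atlas_dom[OF M \<kappa>'(1)] \<kappa>'(2) by blast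
  have k: "?\<kappa> \<in> charts_at N (\<Phi> x)" using p(1) s(1) \<kappa>'(2) by (simp add: charts_at_def)
  have o: "openin (mtop M) (pts M)" by simp
  note t = tvec_in[OF M \<kappa> v]
  have "dir_deriv (\<lambda>p. cmap ?\<kappa> (\<Phi> (cinv \<kappa> p))) (cmap \<kappa> x) v = v"
    by (rule dir_deriv_id[OF chart_on_subspace[OF c] chart_on_openin_image[OF c] _ v])
      (use \<kappa>'(2) s(3) cinv_cmap[OF c] in auto)
  then show ?thesis
    using tangent_map_chart[OF M N o diffeo_smooth[OF \<Phi>] x \<kappa> k t] tvec_self[OF N k] v
    by (intro tangent_space_eqI[OF tangent_map_in[OF M N o diffeo_smooth[OF \<Phi>] x t] tvec_in[OF N k] k])
      (auto simp: s(2) tvec_self[OF M \<kappa> v])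
qed

section \<open>Line bundles\<close>

text \<open>The quotient of \<open>a\<close> by \<open>e\<close> in a complex line. It has the form
  of the \<open>THE\<close> term in \<open>leaf_connection\<close>; computations with sections are
  reduced to such coefficients.\<close>

definition fcoef :: "('a, 'l, 'e) line_bundle \<Rightarrow> 'l \<Rightarrow> 'l \<Rightarrow> complex" where
  "fcoef L e a = (THE z. a = lscale L z e)"

locale line_bundle_over =
  fixes d :: nat and M :: "('a, 'e::euclidean_space) mfd" and L :: "('a, 'l, 'e) line_bundle"
  assumes M: "smooth_manifold d M" and L: "complex_line_bundle d M L"
begin

lemma total_mfd: "smooth_manifold (d + 2) (ltotal L)"
  and proj_smooth: "smooth_map_on (ltotal L) (pts (ltotal L)) M (lproj L)"
  and lzero_in: "x \<in> pts M \<Longrightarrow> lzero L x \<in> fibre L x"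
  and ladd_in: "x \<in> pts M \<Longrightarrow> a \<in> fibre L x \<Longrightarrow> b \<in> fibre L x \<Longrightarrow> ladd L a b \<in> fibre L x"
  and lscale_in: "x \<in> pts M \<Longrightarrow> a \<in> fibre L x \<Longrightarrow> lscale L z a \<in> fibre L x"
  and bundle_chart_at: "x \<in> pts M \<Longrightarrow> \<exists>\<kappa>\<in>charts_at M x. \<exists>\<mu>\<in>atlas (ltotal L). bundle_chart L \<kappa> \<mu>"
  using L unfolding complex_line_bundle_def by blast+

lemma bundle_chartD:
  assumes "bundle_chart L \<kappa> \<mu>"
  shows "cdom \<mu> = {l \<in> pts (ltotal L). lproj L l \<in> cdom \<kappa>}"
    and "l \<in> cdom \<mu> \<Longrightarrow> fst (cmap \<mu> l) = cmap \<kappa> (lproj L l)"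
    and "x \<in> cdom \<kappa> \<Longrightarrow> bij_betw (\<lambda>l. snd (cmap \<mu> l)) (fibre L x) UNIV"
    and "x \<in> cdom \<kappa> \<Longrightarrow> snd (cmap \<mu> (lzero L x)) = 0"
    and "x \<in> cdom \<kappa> \<Longrightarrow> a \<in> fibre L x \<Longrightarrow> b \<in> fibre L x \<Longrightarrow>
      snd (cmap \<mu> (ladd L a b)) = snd (cmap \<mu> a) + snd (cmap \<mu> b)"
    and "x \<in> cdom \<kappa> \<Longrightarrow> a \<in> fibre L x \<Longrightarrow> snd (cmap \<mu> (lscale L z a)) = z * snd (cmap \<mu> a)"
  using assms unfolding bundle_chart_def by blast+

text \<open>The fibres come without explicit vector space axioms; these are read off in the complex
  numbers through the fibre coordinate of a bundle chart.\<close>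

lemma fibre_coordinate:
  assumes "x \<in> pts M"
  obtains c :: "'l \<Rightarrow> complex" where "bij_betw c (fibre L x) UNIV" "c (lzero L x) = 0"
    "\<And>a b. a \<in> fibre L x \<Longrightarrow> b \<in> fibre L x \<Longrightarrow> c (ladd L a b) = c a + c b"
    "\<And>z a. a \<in> fibre L x \<Longrightarrow> c (lscale L z a) = z * c a"
proof -
  obtain \<kappa> \<mu> where "\<kappa> \<in> charts_at M x" and b: "bundle_chart L \<kappa> \<mu>"
    using bundle_chart_at[OF assms] by blast
  then have x: "x \<in> cdom \<kappa>" by (auto simp: charts_at_def)
  show ?thesis
    by (rule that[of "\<lambda>l. snd (cmap \<mu> l)"]) (use bundle_chartD(3-6)[OF b x] in auto)
qed

lemma fibre_eqI:
  assumes "bij_betw c (fibre L x) UNIV" "a \<in> fibre L x" "b \<in> fibre L x" "c a = (c b :: complex)"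
  shows "a = b"
  using assms by (metis bij_betw_imp_inj_on inj_onD)

lemma
  assumes x: "x \<in> pts M" and a: "a \<in> fibre L x"
  shows lscale_lscale: "lscale L z (lscale L w a) = lscale L (z * w) a"
    and lscale_add: "ladd L (lscale L z a) (lscale L w a) = lscale L (z + w) a"
    and lscale_zero: "lscale L 0 a = lzero L x"
    and lscale_eq_lzero: "lscale L z a = lzero L x \<longleftrightarrow> z = 0 \<or> a = lzero L x"
proof -
  obtain c :: "'l \<Rightarrow> complex" where c: "bij_betw c (fibre L x) UNIV" "c (lzero L x) = 0"
    "\<And>a b. a \<in> fibre L x \<Longrightarrow> b \<in> fibre L x \<Longrightarrow> c (ladd L a b) = c a + c b"
    "\<And>z a. a \<in> fibre L x \<Longrightarrow> c (lscale L z a) = z * c a"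
    using fibre_coordinate[OF x] by blast
  note [simp] = lscale_in[OF x] ladd_in[OF x] lzero_in[OF x] a c(2-4)
  show "lscale L z (lscale L w a) = lscale L (z * w) a" "ladd L (lscale L z a) (lscale L w a) = lscale L (z + w) a"
    "lscale L 0 a = lzero L x"
    by (rule fibre_eqI[OF c(1)]; simp add: algebra_simps)+
  have inj: "u = w \<longleftrightarrow> c u = c w" if "u \<in> fibre L x" "w \<in> fibre L x" for u w
    using fibre_eqI[OF c(1) that] by blast
  show "lscale L z a = lzero L x \<longleftrightarrow> z = 0 \<or> a = lzero L x"
    by (simp add: inj)
qed

lemma
  assumes x: "x \<in> pts M" and e: "e \<in> fibre L x" "e \<noteq> lzero L x" and a: "a \<in> fibre L x"
  shows fcoef_scale: "lscale L (fcoef L e a) e = a"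
    and fcoef_unique: "a = lscale L z e \<Longrightarrow> fcoef L e a = z"
    and fcoef_chart: "x \<in> cdom \<kappa> \<Longrightarrow> bundle_chart L \<kappa> \<mu> \<Longrightarrow> fcoef L e a = snd (cmap \<mu> a) / snd (cmap \<mu> e)"
    and bundle_chart_nonzero: "x \<in> cdom \<kappa> \<Longrightarrow> bundle_chart L \<kappa> \<mu> \<Longrightarrow> snd (cmap \<mu> e) \<noteq> 0"
proof -
  \<comment> \<open>Proved for every fibre coordinate \<open>c\<close>, so that it applies both to
    one obtained at \<open>x\<close> and to that of a given bundle chart.\<close>
  have *: "c e \<noteq> 0 \<and> lscale L (c a / c e) e = a \<and> (\<forall>z. a = lscale L z e \<longrightarrow> z = c a / c e)"
    if c: "bij_betw c (fibre L x) UNIV" "c (lzero L x) = 0" "\<And>z a. a \<in> fibre L x \<Longrightarrow> c (lscale L z a) = z * c a"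
    for c :: "'l \<Rightarrow> complex"
  proof -
    have ce: "c e \<noteq> 0" using fibre_eqI[OF c(1) e(1) lzero_in[OF x]] c(2) e(2) by auto
    have "lscale L (c a / c e) e = a"
      by (rule fibre_eqI[OF c(1) lscale_in[OF x e(1)] a]) (simp add: c(3) e(1) ce)
    then show ?thesis using ce c(3)[OF e(1)] by auto
  qed
  have F: "lscale L (c a / c e) e = a \<and> fcoef L e a = c a / c e"
    if c: "bij_betw c (fibre L x) UNIV" "c (lzero L x) = 0" "\<And>z a. a \<in> fibre L x \<Longrightarrow> c (lscale L z a) = z * c a"
    for c :: "'l \<Rightarrow> complex"
    using *[OF c] unfolding fcoef_def by (auto intro!: the_equality)
  obtain c :: "'l \<Rightarrow> complex" where c: "bij_betw c (fibre L x) UNIV" "c (lzero L x) = 0"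
    "\<And>z a. a \<in> fibre L x \<Longrightarrow> c (lscale L z a) = z * c a"
    using fibre_coordinate[OF x] by metis
  show "lscale L (fcoef L e a) e = a" using F[OF c] by metis
  show "a = lscale L z e \<Longrightarrow> fcoef L e a = z" using F[OF c] *[OF c] by metis
  show "x \<in> cdom \<kappa> \<Longrightarrow> bundle_chart L \<kappa> \<mu> \<Longrightarrow> fcoef L e a = snd (cmap \<mu> a) / snd (cmap \<mu> e)"
    using F[of "\<lambda>l. snd (cmap \<mu> l)"] bundle_chartD(3,4,6)[of \<kappa> \<mu> x] by blast
  show "x \<in> cdom \<kappa> \<Longrightarrow> bundle_chart L \<kappa> \<mu> \<Longrightarrow> snd (cmap \<mu> e) \<noteq> 0"
    using *[of "\<lambda>l. snd (cmap \<mu> l)"] bundle_chartD(3,4,6)[of \<kappa> \<mu> x] by blast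
qed

lemma fcoef_lscale:
  "x \<in> pts M \<Longrightarrow> e \<in> fibre L x \<Longrightarrow> e \<noteq> lzero L x \<Longrightarrow> fcoef L e (lscale L z e) = z"
  by (rule fcoef_unique[OF _ _ _ lscale_in]) auto

lemma fcoef_lscale2:
  assumes "x \<in> pts M" "e \<in> fibre L x" "e \<noteq> lzero L x" "a \<in> fibre L x"
  shows "fcoef L e (lscale L z a) = z * fcoef L e a"
  by (rule fcoef_unique[OF assms(1-3) lscale_in[OF assms(1,4)]])
    (simp add: lscale_lscale[OF assms(1,2), symmetric] fcoef_scale[OF assms])

lemma fcoef_ladd:
  assumes "x \<in> pts M" "e \<in> fibre L x" "e \<noteq> lzero L x" "a \<in> fibre L x" "b \<in> fibre L x"
  shows "fcoef L e (ladd L a b) = fcoef L e a + fcoef L e b"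
  by (rule fcoef_unique[OF assms(1-3) ladd_in[OF assms(1,4,5)]])
    (simp add: lscale_add[OF assms(1,2), symmetric] fcoef_scale[OF assms(1-4)] fcoef_scale[OF assms(1-3,5)])

lemma fcoef_eq_0:
  assumes "x \<in> pts M" "e \<in> fibre L x" "e \<noteq> lzero L x" "a \<in> fibre L x"
  shows "fcoef L e a = 0 \<longleftrightarrow> a = lzero L x"
  using lscale_eq_lzero[OF assms(1,2), of "fcoef L e a"] fcoef_scale[OF assms] assms(3) by simp

lemma fibreD: "l \<in> fibre L x \<Longrightarrow> l \<in> pts (ltotal L)" "l \<in> fibre L x \<Longrightarrow> lproj L l = x"
  by (auto simp: fibre_def)

lemma proj_in: "l \<in> pts (ltotal L) \<Longrightarrow> lproj L l \<in> pts M"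
  using smooth_map_on_in_pts[OF proj_smooth] by simp

lemma in_fibre_proj: "l \<in> pts (ltotal L) \<Longrightarrow> l \<in> fibre L (lproj L l)"
  by (simp add: fibre_def)

text \<open>The first component of \<open>t\<close> in a bundle chart is \<open>h\<close> read in
  \<open>\<kappa>\<close>, which is smooth already; only the fibre coordinate has to be tested. The
  base map \<open>h\<close> admits sections along maps, as needed on leaves.\<close>

lemma smooth_into_total_iff:
  assumes N: "smooth_manifold d' N" and W: "openin (mtop N) W"
    and h: "smooth_map_on N W M h" "h ` W \<subseteq> cdom \<kappa>" and t: "\<And>y. y \<in> W \<Longrightarrow> t y \<in> fibre L (h y)"
    and b: "bundle_chart L \<kappa> \<mu>" "\<kappa> \<in> atlas M" "\<mu> \<in> atlas (ltotal L)"
  shows "smooth_map_on N W (ltotal L) t \<longleftrightarrow> smooth_fun_on N W (\<lambda>y. snd (cmap \<mu> (t y)))"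
proof
  have dom: "t ` W \<subseteq> cdom \<mu>" using h(2) t fibreD bundle_chartD(1)[OF b(1)] by fastforce
  show "smooth_fun_on N W (\<lambda>y. snd (cmap \<mu> (t y)))" if "smooth_map_on N W (ltotal L) t"
    by (rule smooth_fun_on_snd[OF smooth_map_on_imp_fun[OF that dom b(3)]])
  assume "smooth_fun_on N W (\<lambda>y. snd (cmap \<mu> (t y)))"
  with smooth_map_on_imp_fun[OF h b(2)]
  have "smooth_fun_on N W (\<lambda>y. (cmap \<kappa> (h y), snd (cmap \<mu> (t y))))" by (rule smooth_fun_on_Pair)
  then have "smooth_fun_on N W (\<lambda>y. cmap \<mu> (t y))"
    by (rule smooth_fun_on_cong[OF N, THEN iffD1, rotated])
      (use dom fibreD(2)[OF t] bundle_chartD(2)[OF b(1)] in \<open>auto simp: prod_eq_iff image_subset_iff\<close>)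
  then show "smooth_map_on N W (ltotal L) t"
    by (rule smooth_map_onI_fun[OF N total_mfd W dom b(3)])
qed

section \<open>Sections and frames\<close>

lemma sectionsD:
  "s \<in> sections N L U \<Longrightarrow> smooth_map_on N U (ltotal L) s" "s \<in> sections N L U \<Longrightarrow> x \<in> U \<Longrightarrow> s x \<in> fibre L x"
  by (auto simp: sections_def)

lemma framesD:
  "s \<in> frames M L U \<Longrightarrow> s \<in> sections M L U" "s \<in> frames M L U \<Longrightarrow> x \<in> U \<Longrightarrow> s x \<in> fibre L x"
  "s \<in> frames M L U \<Longrightarrow> x \<in> U \<Longrightarrow> s x \<noteq> lzero L x"
  by (auto simp: sections_def frames_def)

lemma sections_subset: "s \<in> sections N L U \<Longrightarrow> V \<subseteq> U \<Longrightarrow> s \<in> sections N L V"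
  by (auto simp: sections_def intro: smooth_map_on_subset)

lemma frames_subset: "s \<in> frames M L U \<Longrightarrow> V \<subseteq> U \<Longrightarrow> s \<in> frames M L V"
  by (auto simp: frames_def intro: sections_subset)

text \<open>Locally the coefficient is a quotient of two fibre coordinates. Stated along a map
  \<open>h\<close>, it covers sections over \<open>M\<close>, sections over a leaf (\<open>h\<close>
  the inclusion) and the tautological section over the total space (\<open>h\<close> the
  projection).\<close>

lemma fcoef_smooth:
  assumes N: "smooth_manifold d' N" and W: "openin (mtop N) W" and U: "openin (mtop M) U"
    and s: "s \<in> frames M L U" and h: "smooth_map_on N W M h" "h ` W \<subseteq> U"
    and t: "smooth_map_on N W (ltotal L) t" "\<And>y. y \<in> W \<Longrightarrow> t y \<in> fibre L (h y)"
  shows "smooth_fun_on N W (\<lambda>y. fcoef L (s (h y)) (t y))"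
proof (rule smooth_fun_on_local[OF N])
  fix y assume y: "y \<in> W"
  then have "h y \<in> pts M" using h(2) openin_in_pts[OF U] by blast
  then obtain \<kappa> \<mu> where \<kappa>: "\<kappa> \<in> charts_at M (h y)" and \<mu>: "\<mu> \<in> atlas (ltotal L)" and b: "bundle_chart L \<kappa> \<mu>"
    using bundle_chart_at by blast
  let ?V = "W \<inter> h -` cdom \<kappa>"
  have V: "openin (mtop N) ?V" by (rule smooth_map_on_vimage[OF h(1) W charts_at_openin[OF M \<kappa>]])
  have hV: "smooth_map_on N ?V M h" by (rule smooth_map_on_subset[OF h(1)]) auto
  have dom: "h ` ?V \<subseteq> cdom \<kappa>" by auto
  have 1: "smooth_fun_on N ?V (\<lambda>y. snd (cmap \<mu> (t y)))"
    by (rule smooth_into_total_iff[OF N V hV dom _ b charts_atD(1)[OF \<kappa>] \<mu>, THEN iffD1])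
      (use t in \<open>auto intro: smooth_map_on_subset\<close>)
  have "smooth_map_on N W (ltotal L) (\<lambda>y. s (h y))"
    by (rule smooth_map_on_compose[OF N M total_mfd W U h sectionsD(1)[OF framesD(1)[OF s]]])
  then have 2: "smooth_fun_on N ?V (\<lambda>y. snd (cmap \<mu> (s (h y))))"
    by (intro smooth_into_total_iff[OF N V hV dom _ b charts_atD(1)[OF \<kappa>] \<mu>, THEN iffD1])
      (use h(2) framesD(2)[OF s] in \<open>auto intro: smooth_map_on_subset\<close>)
  have p: "h y \<in> pts M" if "y \<in> W" for y using h(2) openin_in_pts[OF U] that by blast
  have U': "h y \<in> U" if "y \<in> W" for y using h(2) that by blast
  have "smooth_fun_on N ?V (\<lambda>y. snd (cmap \<mu> (t y)) / snd (cmap \<mu> (s (h y))))"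
    by (rule smooth_fun_on_divide[OF N 1 2])
      (use bundle_chart_nonzero[OF p framesD(2,3)[OF s U'] t(2) _ b] framesD(3)[OF s U'] in auto)
  then have "smooth_fun_on N ?V (\<lambda>y. fcoef L (s (h y)) (t y))"
    by (rule smooth_fun_on_cong[OF N, THEN iffD1, rotated])
      (use fcoef_chart[OF p framesD(2,3)[OF s U'] t(2) _ b] in auto)
  then show "\<exists>V. openin (mtop N) V \<and> y \<in> V \<and> smooth_fun_on N V (\<lambda>y. fcoef L (s (h y)) (t y))"
    using V y charts_atD(2)[OF \<kappa>] by blast
qed

lemma lscale_smooth:
  assumes N: "smooth_manifold d' N" and W: "openin (mtop N) W" and U: "openin (mtop M) U"
    and s: "s \<in> sections M L U" and h: "smooth_map_on N W M h" "h ` W \<subseteq> U"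
    and f: "smooth_fun_on N W f"
  shows "smooth_map_on N W (ltotal L) (\<lambda>y. lscale L (f y) (s (h y)))"
proof (rule smooth_map_on_local[OF N total_mfd W])
  fix y assume y: "y \<in> W"
  then have "h y \<in> pts M" using h(2) openin_in_pts[OF U] by blast
  then obtain \<kappa> \<mu> where \<kappa>: "\<kappa> \<in> charts_at M (h y)" and \<mu>: "\<mu> \<in> atlas (ltotal L)" and b: "bundle_chart L \<kappa> \<mu>"
    using bundle_chart_at by blast
  let ?V = "W \<inter> h -` cdom \<kappa>"
  have V: "openin (mtop N) ?V" by (rule smooth_map_on_vimage[OF h(1) W charts_at_openin[OF M \<kappa>]])
  have hV: "smooth_map_on N ?V M h" by (rule smooth_map_on_subset[OF h(1)]) auto
  have dom: "h ` ?V \<subseteq> cdom \<kappa>" by auto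
  have p: "h y \<in> pts M" if "y \<in> W" for y using h(2) openin_in_pts[OF U] that by blast
  have sf: "s (h y) \<in> fibre L (h y)" if "y \<in> W" for y using sectionsD(2)[OF s] h(2) that by blast
  have "smooth_map_on N W (ltotal L) (\<lambda>y. s (h y))"
    by (rule smooth_map_on_compose[OF N M total_mfd W U h sectionsD(1)[OF s]])
  then have "smooth_fun_on N ?V (\<lambda>y. snd (cmap \<mu> (s (h y))))"
    by (intro smooth_into_total_iff[OF N V hV dom _ b charts_atD(1)[OF \<kappa>] \<mu>, THEN iffD1])
      (use sf in \<open>auto intro: smooth_map_on_subset\<close>)
  with smooth_fun_on_subset[OF f, of ?V] have "smooth_fun_on N ?V (\<lambda>y. f y * snd (cmap \<mu> (s (h y))))"
    by (intro smooth_fun_on_mult) auto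
  then have "smooth_fun_on N ?V (\<lambda>y. snd (cmap \<mu> (lscale L (f y) (s (h y)))))"
    by (rule smooth_fun_on_cong[OF N, THEN iffD1, rotated])
      (use bundle_chartD(6)[OF b _ sf] in auto)
  then have "smooth_map_on N ?V (ltotal L) (\<lambda>y. lscale L (f y) (s (h y)))"
    by (intro smooth_into_total_iff[OF N V hV dom _ b charts_atD(1)[OF \<kappa>] \<mu>, THEN iffD2])
      (use lscale_in[OF p sf] in auto)
  then show "\<exists>V. openin (mtop N) V \<and> y \<in> V \<and> smooth_map_on N V (ltotal L) (\<lambda>y. lscale L (f y) (s (h y)))"
    using V y charts_atD(2)[OF \<kappa>] by blast
qed

lemma fcoef_section_smooth:
  assumes "openin (mtop M) U" "s \<in> frames M L U" "t \<in> sections M L U"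
  shows "smooth_fun_on M U (\<lambda>y. fcoef L (s y) (t y))"
  by (rule fcoef_smooth[OF M assms(1,1,2) smooth_map_on_id[OF M assms(1)]])
    (use sectionsD[OF assms(3)] in auto)

lemma lscale_section:
  assumes "openin (mtop M) U" "s \<in> sections M L U" "smooth_fun_on M U f"
  shows "(\<lambda>y. lscale L (f y) (s y)) \<in> sections M L U"
  unfolding sections_def
proof (intro CollectI conjI ballI)
  show "smooth_map_on M U (ltotal L) (\<lambda>y. lscale L (f y) (s y))"
    by (rule lscale_smooth[OF M assms(1,1,2) smooth_map_on_id[OF M assms(1)] _ assms(3)]) simp
  show "lscale L (f x) (s x) \<in> fibre L x" if "x \<in> U" for x
    by (rule lscale_in[OF openin_in_pts[OF assms(1) that] sectionsD(2)[OF assms(2) that]])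
qed

lemma lscale_frame:
  assumes "openin (mtop M) U" "s \<in> frames M L U" "smooth_fun_on M U f" "\<And>x. x \<in> U \<Longrightarrow> f x \<noteq> 0"
  shows "(\<lambda>y. lscale L (f y) (s y)) \<in> frames M L U"
  using lscale_section[OF assms(1) framesD(1)[OF assms(2)] assms(3)] assms(4)
    lscale_eq_lzero[OF openin_in_pts[OF assms(1)] framesD(2)[OF assms(2)]] framesD(3)[OF assms(2)]
  by (auto simp: frames_def)

text \<open>The witness is the section whose fibre coordinate in a bundle chart is constantly
  1.\<close>

lemma local_frame:
  assumes x: "x \<in> pts M"
  obtains U s where "openin (mtop M) U" "x \<in> U" "s \<in> frames M L U"
proof -
  obtain \<kappa> \<mu> where \<kappa>: "\<kappa> \<in> charts_at M x" and \<mu>: "\<mu> \<in> atlas (ltotal L)" and b: "bundle_chart L \<kappa> \<mu>"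
    using bundle_chart_at[OF x] by blast
  define s where "s y = inv_into (fibre L y) (\<lambda>l. snd (cmap \<mu> l)) 1" for y
  have im: "(1::complex) \<in> (\<lambda>l. snd (cmap \<mu> l)) ` fibre L y" if "y \<in> cdom \<kappa>" for y
    using bundle_chartD(3)[OF b that] by (auto simp: bij_betw_def)
  have s: "s y \<in> fibre L y" "snd (cmap \<mu> (s y)) = 1" if "y \<in> cdom \<kappa>" for y
    using inv_into_into[OF im[OF that]] f_inv_into_f[OF im[OF that]] by (auto simp: s_def)
  have o: "openin (mtop M) (cdom \<kappa>)" by (rule charts_at_openin[OF M \<kappa>])
  have "smooth_fun_on M (cdom \<kappa>) (\<lambda>y. snd (cmap \<mu> (s y)))"
    by (rule smooth_fun_on_cong[OF M, THEN iffD1, OF _ smooth_fun_on_const]) (simp add: s)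
  then have "smooth_map_on M (cdom \<kappa>) (ltotal L) s"
    by (intro smooth_into_total_iff[OF M o smooth_map_on_id[OF M o] _ _ b charts_atD(1)[OF \<kappa>] \<mu>, THEN iffD2])
      (auto simp: s)
  moreover have "s y \<noteq> lzero L y" if "y \<in> cdom \<kappa>" for y
    using s(2)[OF that] bundle_chartD(4)[OF b that] by auto
  ultimately have "s \<in> frames M L (cdom \<kappa>)" using s by (auto simp: frames_def sections_def)
  then show ?thesis using that[OF o charts_atD(2)[OF \<kappa>]] by blast
qed

end

section \<open>Connections\<close>

locale prequantum = line_bundle_over d M L
  for d and M :: "('a, 'e::euclidean_space) mfd" and L :: "('a, 'l, 'e) line_bundle" +
  fixes nab :: "('a, 'l, 'e) connection" and \<omega> :: "('a, 'e) form2"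
  assumes nab: "is_connection M L nab" and curv: "has_curvature M L nab \<omega>"
begin

lemma
  assumes U: "openin (mtop M) U" and s: "s \<in> sections M L U"
  shows nab_smooth: "X \<in> vector_fields M U \<Longrightarrow> (\<lambda>x. nab s x (X x)) \<in> sections M L U"
    and nab_in: "x \<in> U \<Longrightarrow> v \<in> tangent_space M x \<Longrightarrow> nab s x v \<in> fibre L x"
    and nab_tv_add: "x \<in> U \<Longrightarrow> v \<in> tangent_space M x \<Longrightarrow> w \<in> tangent_space M x \<Longrightarrow>
      nab s x (tv_add v w) = ladd L (nab s x v) (nab s x w)"
    and nab_tv_scale: "x \<in> U \<Longrightarrow> v \<in> tangent_space M x \<Longrightarrow>
      nab s x (tv_scale r v) = lscale L (of_real r) (nab s x v)"
    and nab_leibniz: "smooth_fun_on M U f \<Longrightarrow> x \<in> U \<Longrightarrow> v \<in> tangent_space M x \<Longrightarrow>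
      nab (\<lambda>y. lscale L (f y) (s y)) x v = ladd L (lscale L (tderiv M f x v) (s x)) (lscale L (f x) (nab s x v))"
    and nab_germ: "openin (mtop M) V \<Longrightarrow> V \<subseteq> U \<Longrightarrow> t \<in> sections M L V \<Longrightarrow> (\<And>y. y \<in> V \<Longrightarrow> t y = s y) \<Longrightarrow>
      x \<in> V \<Longrightarrow> v \<in> tangent_space M x \<Longrightarrow> nab t x v = nab s x v"
proof -
  note n = nab[unfolded is_connection_def, THEN spec, THEN mp, OF U, THEN bspec, OF s]
  note n1 = conjunct2[OF n] note n2 = conjunct2[OF n1] note n3 = conjunct2[OF n2]
  note n4 = conjunct2[OF n3] note n5 = conjunct2[OF n4] note n6 = conjunct2[OF n5]
  show "X \<in> vector_fields M U \<Longrightarrow> (\<lambda>x. nab s x (X x)) \<in> sections M L U"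
    by (rule conjunct1[OF n, THEN bspec])
  show "x \<in> U \<Longrightarrow> v \<in> tangent_space M x \<Longrightarrow> nab s x v \<in> fibre L x"
    by (rule conjunct1[OF n1, THEN bspec, THEN bspec])
  show "x \<in> U \<Longrightarrow> v \<in> tangent_space M x \<Longrightarrow> w \<in> tangent_space M x \<Longrightarrow>
      nab s x (tv_add v w) = ladd L (nab s x v) (nab s x w)"
    by (rule conjunct1[OF n2, THEN bspec, THEN bspec, THEN bspec])
  show "x \<in> U \<Longrightarrow> v \<in> tangent_space M x \<Longrightarrow> nab s x (tv_scale r v) = lscale L (of_real r) (nab s x v)"
    by (rule conjunct1[OF n3, THEN bspec, THEN bspec, THEN spec])
  show "smooth_fun_on M U f \<Longrightarrow> x \<in> U \<Longrightarrow> v \<in> tangent_space M x \<Longrightarrow>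
      nab (\<lambda>y. lscale L (f y) (s y)) x v = ladd L (lscale L (tderiv M f x v) (s x)) (lscale L (f x) (nab s x v))"
    by (rule conjunct1[OF n5, THEN spec, THEN mp, THEN bspec, THEN bspec])
  show "nab t x v = nab s x v" if "openin (mtop M) V" "V \<subseteq> U" "t \<in> sections M L V" "\<And>y. y \<in> V \<Longrightarrow> t y = s y"
      "x \<in> V" "v \<in> tangent_space M x"
    by (rule n6[THEN spec, THEN spec, THEN mp, THEN bspec, THEN bspec]) (use that in blast)+
qed

text \<open>This is \<open>\<i>\<close> times the form \<open>\<alpha>\<close> of
  \<open>has_curvature\<close>, the logarithmic derivative of the frame.\<close>

definition conn_form :: "('a \<Rightarrow> 'l) \<Rightarrow> 'a \<Rightarrow> ('a, 'e) tvec \<Rightarrow> complex" where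
  "conn_form s x v = fcoef L (s x) (nab s x v)"

lemma nab_frame:
  assumes "openin (mtop M) U" "s \<in> frames M L U" "x \<in> U" "v \<in> tangent_space M x"
  shows "nab s x v = lscale L (conn_form s x v) (s x)"
  unfolding conn_form_def
  by (rule fcoef_scale[symmetric, OF openin_in_pts[OF assms(1,3)] framesD(2,3)[OF assms(2,3)] nab_in[OF assms(1) framesD(1)[OF assms(2)] assms(3,4)]])

lemma nab_lscale_frame:
  assumes U: "openin (mtop M) U" and s: "s \<in> frames M L U" and f: "smooth_fun_on M U f"
    and x: "x \<in> U" and v: "v \<in> tangent_space M x"
  shows "nab (\<lambda>y. lscale L (f y) (s y)) x v = lscale L (tderiv M f x v + f x * conn_form s x v) (s x)"
  using nab_leibniz[OF U framesD(1)[OF s] f x v] nab_frame[OF U s x v]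
    lscale_lscale[OF openin_in_pts[OF U x] framesD(2)[OF s x]] lscale_add[OF openin_in_pts[OF U x] framesD(2)[OF s x]]
  by simp

text \<open>The Leibniz rule for coefficient times frame. Since \<open>t\<close> agrees with that
  product only on \<open>U\<close>, the connection has to be compared through germs.\<close>

lemma nab_section:
  assumes U: "openin (mtop M) U" and s: "s \<in> frames M L U" and t: "t \<in> sections M L U"
    and x: "x \<in> U" and v: "v \<in> tangent_space M x"
  shows "nab t x v = lscale L (tderiv M (\<lambda>y. fcoef L (s y) (t y)) x v + fcoef L (s x) (t x) * conn_form s x v) (s x)"
proof -
  let ?f = "\<lambda>y. fcoef L (s y) (t y)"
  have f: "smooth_fun_on M U ?f" by (rule fcoef_section_smooth[OF U s t])
  have "nab (\<lambda>y. lscale L (?f y) (s y)) x v = nab t x v"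
    by (rule nab_germ[OF U t U order_refl lscale_section[OF U framesD(1)[OF s] f] _ x v])
      (rule fcoef_scale[OF openin_in_pts[OF U] framesD(2,3)[OF s] sectionsD(2)[OF t]])
  then show ?thesis using nab_lscale_frame[OF U s f x v] by simp
qed

text \<open>The gauge transformation rule, obtained by differentiating \<open>t\<close> as
  coefficient times \<open>s\<close>; kept in product form, it avoids dividing by the
  coefficient.\<close>

lemma conn_form_change:
  assumes U: "openin (mtop M) U" and s: "s \<in> frames M L U" and t: "t \<in> frames M L U"
    and x: "x \<in> U" and v: "v \<in> tangent_space M x"
  shows "conn_form t x v * fcoef L (s x) (t x) =
    tderiv M (\<lambda>y. fcoef L (s y) (t y)) x v + fcoef L (s x) (t x) * conn_form s x v"
proof -
  note p = openin_in_pts[OF U x] and sx = framesD(2,3)[OF s x]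
  have "fcoef L (s x) (nab t x v) = conn_form t x v * fcoef L (s x) (t x)"
    unfolding nab_frame[OF U t x v] by (rule fcoef_lscale2[OF p sx framesD(2)[OF t x]])
  then show ?thesis
    unfolding nab_section[OF U s framesD(1)[OF t] x v] fcoef_lscale[OF p sx] by simp
qed

lemma conn_form_smooth:
  assumes U: "openin (mtop M) U" and s: "s \<in> frames M L U" and X: "X \<in> vector_fields M U"
  shows "smooth_fun_on M U (\<lambda>x. conn_form s x (X x))"
  unfolding conn_form_def
  by (rule fcoef_section_smooth[OF U s nab_smooth[OF U framesD(1)[OF s] X]])

lemma conn_form_linear:
  assumes U: "openin (mtop M) U" and s: "s \<in> frames M L U" and x: "x \<in> U"
    and v: "v \<in> tangent_space M x" and w: "w \<in> tangent_space M x"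
  shows "conn_form s x (tv_add v w) = conn_form s x v + conn_form s x w"
    and "conn_form s x (tv_scale r v) = r *\<^sub>R conn_form s x v"
proof -
  note p = openin_in_pts[OF U x] and sx = framesD(2,3)[OF s x] and n = nab_in[OF U framesD(1)[OF s] x]
  show "conn_form s x (tv_add v w) = conn_form s x v + conn_form s x w"
    unfolding conn_form_def nab_tv_add[OF U framesD(1)[OF s] x v w] by (rule fcoef_ladd[OF p sx n[OF v] n[OF w]])
  show "conn_form s x (tv_scale r v) = r *\<^sub>R conn_form s x v"
    unfolding conn_form_def nab_tv_scale[OF U framesD(1)[OF s] x v] fcoef_lscale2[OF p sx n[OF v]]
    by (simp add: scaleR_conv_of_real)
qed

text \<open>The form \<open>\<alpha>\<close> below reads a vector only through its component in \<open>\<kappa>\<close>, so that on coordinate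
  fields the bracket term of \<open>d\<alpha>\<close> vanishes without computing brackets in other charts.\<close>

lemma conn_form_curvature:
  assumes U: "openin (mtop M) U" and s: "s \<in> frames M L U" and \<kappa>: "\<kappa> \<in> atlas M" and dom: "U \<subseteq> cdom \<kappa>"
    and x: "x \<in> U" and u: "u \<in> cspace \<kappa>" and v: "v \<in> cspace \<kappa>"
  shows "dir_deriv (\<lambda>p. conn_form s (cinv \<kappa> p) (tvec M \<kappa> (cinv \<kappa> p) v)) (cmap \<kappa> x) u -
      dir_deriv (\<lambda>p. conn_form s (cinv \<kappa> p) (tvec M \<kappa> (cinv \<kappa> p) u)) (cmap \<kappa> x) v =
    \<i> * complex_of_real (\<omega> x (tvec M \<kappa> x u) (tvec M \<kappa> x v))"
proof -
  define \<alpha> where "\<alpha> y w = - \<i> * conn_form s y (tvec M \<kappa> y (w \<kappa>))" for y and w :: "('a, 'e) tvec"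
  define X where "X w y = tvec M \<kappa> y w" for w y
  have \<kappa>y: "\<kappa> \<in> charts_at M y" if "y \<in> U" for y using that dom \<kappa> by (auto simp: charts_at_def)
  note c = atlas_chart_on[OF M \<kappa>]
  have D: "openin (top_of_set (cspace \<kappa>)) (cmap \<kappa> ` U)" by (rule chart_on_image_openin_subset[OF c U dom])
  have p: "cmap \<kappa> x \<in> cmap \<kappa> ` U" using x by blast
  have XV: "X w \<in> vector_fields M U" if "w \<in> cspace \<kappa>" for w
    unfolding X_def by (rule tvec_vector_field[OF M \<kappa> dom that])
  have Xk: "X w y \<kappa> = w" if "y \<in> U" "w \<in> cspace \<kappa>" for w y
    unfolding X_def by (rule tvec_self[OF M \<kappa>y[OF that(1)] that(2)])
  \<comment> \<open>On tangent vectors \<open>tvec_eq\<close> restores \<open>w\<close> from its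
    component in \<open>\<kappa>\<close>, so \<open>\<alpha>\<close> meets the hypothesis of
    \<open>has_curvature\<close>.\<close>
  have \<alpha>: "\<forall>y\<in>U. \<forall>w\<in>tangent_space M y. nab s y w = lscale L (\<i> * \<alpha> y w) (s y)"
    using nab_frame[OF U s] tvec_eq[OF M _ \<kappa>y] by (simp add: \<alpha>_def)
  have eq: "ext_deriv1 M \<alpha> (X u) (X v) x = complex_of_real (\<omega> x (X u x) (X v x))"
    using curv[unfolded has_curvature_def, rule_format, of U s \<alpha>] U s \<alpha> XV[OF u] XV[OF v] x by blast
  have sm: "smooth_fun_on M U (\<lambda>y. conn_form s y (X w y))" if "w \<in> cspace \<kappa>" for w
    by (rule conn_form_smooth[OF U s XV[OF that]])
  have \<alpha>X: "\<alpha> y (X w y) = - \<i> * conn_form s y (X w y)" if "y \<in> U" "w \<in> cspace \<kappa>" for y w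
    by (simp add: \<alpha>_def Xk[OF that]) (simp add: X_def)
  have td: "tderiv M (\<lambda>y. \<alpha> y (X w y)) x (X w' x) =
      - \<i> * dir_deriv (\<lambda>p. conn_form s (cinv \<kappa> p) (tvec M \<kappa> (cinv \<kappa> p) w)) (cmap \<kappa> x) w'"
    if w: "w \<in> cspace \<kappa>" "w' \<in> cspace \<kappa>" for w w'
  proof -
    note t = tvec_in[OF M \<kappa>y[OF x] w(2), folded X_def]
    have "tderiv M (\<lambda>y. \<alpha> y (X w y)) x (X w' x) = tderiv M (\<lambda>y. - \<i> * conn_form s y (X w y)) x (X w' x)"
      by (rule tderiv_cong[OF M U _ x _ t, symmetric])
        (use smooth_fun_on_mult[OF smooth_fun_on_const sm[OF w(1)], of "- \<i>"] \<alpha>X[OF _ w(1)] in auto)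
    also have "\<dots> = - \<i> * tderiv M (\<lambda>y. conn_form s y (X w y)) x (X w' x)"
      using tderiv_mult[OF M U smooth_fun_on_const sm[OF w(1)] x t, of "- \<i>"]
        tderiv_const[OF M openin_in_pts[OF U x] t, of "- \<i>"] by simp
    also have "tderiv M (\<lambda>y. conn_form s y (X w y)) x (X w' x) =
        dir_deriv (\<lambda>p. conn_form s (cinv \<kappa> p) (tvec M \<kappa> (cinv \<kappa> p) w)) (cmap \<kappa> x) w'"
      using tderiv_chart[OF M U sm[OF w(1)] x \<kappa>y[OF x] t] Xk[OF x w(2)] by (simp add: X_def)
    finally show ?thesis .
  qed
  have "lie_bracket M (X u) (X v) x \<kappa> = 0"
  proof -
    have z: "dir_deriv (\<lambda>p. X w (cinv \<kappa> p) \<kappa>) (cmap \<kappa> x) w' = 0" if w: "w \<in> cspace \<kappa>" "w' \<in> cspace \<kappa>" for w w'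
      by (rule dir_deriv_const[OF chart_on_subspace[OF c] D p w(2), of _ w])
        (use Xk[OF _ w(1)] cinv_cmap[OF c] dom in auto)
    show ?thesis using \<kappa>y[OF x] by (simp add: lie_bracket_def Xk[OF x u] Xk[OF x v] z u v)
  qed
  moreover have "conn_form s x (tvec M \<kappa> x 0) = 0"
  proof -
    have "0 \<in> cspace \<kappa>" using chart_on_subspace[OF c] subspace_0 by blast
    then show ?thesis
      using conn_form_linear(2)[OF U s x tvec_in[OF M \<kappa>y[OF x] u] tvec_in[OF M \<kappa>y[OF x] u], of 0]
        tvec_add(2)[OF M \<kappa>y[OF x] u u, of 0] by simp
  qed
  ultimately have "\<alpha> x (lie_bracket M (X u) (X v) x) = 0" by (simp add: \<alpha>_def)
  then have "ext_deriv1 M \<alpha> (X u) (X v) x =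
      - \<i> * (dir_deriv (\<lambda>p. conn_form s (cinv \<kappa> p) (tvec M \<kappa> (cinv \<kappa> p) v)) (cmap \<kappa> x) u -
      dir_deriv (\<lambda>p. conn_form s (cinv \<kappa> p) (tvec M \<kappa> (cinv \<kappa> p) u)) (cmap \<kappa> x) v)"
    using td[OF v u] td[OF u v] by (simp add: ext_deriv1_def right_diff_distrib)
  from this[unfolded eq] show ?thesis unfolding X_def
    by (metis (no_types, lifting) mult.assoc mult_minus_left complex_i_mult_minus i_squared mult_minus_right minus_minus mult_1)
qed

end

section \<open>Local flat lifts\<close>

text \<open>By reflexivity, witnessed by the cover itself and the cochain 1, the class of
  \<open>c\<close> contains \<open>c\<close>. As this class is the trivial one, \<open>c\<close> is
  related to the cochain 1 on some refinement.\<close>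

lemma cech_H1_trivialD:
  assumes H: "cech_H1 X G = {cech_trivial_class X G}" and c: "cech_cocycle G \<U> c" and \<U>: "open_cover X \<U>"
    and G: "\<And>U. openin X U \<Longrightarrow> (\<lambda>_. 1) \<in> G U"
  obtains \<W> r b where "open_cover X \<W>" "refinement \<W> \<U> r" "\<And>W. W \<in> \<W> \<Longrightarrow> b W \<in> G W"
    "\<And>W W' x. W \<in> \<W> \<Longrightarrow> W' \<in> \<W> \<Longrightarrow> x \<in> W \<inter> W' \<Longrightarrow> 1 = c (r W) (r W') x * (b W' x / b W x)"
proof -
  have mem: "(\<U>, c) \<in> cech_cocycles X G" using c \<U> by (simp add: cech_cocycles_def)
  have o: "openin X U" if "U \<in> \<U>" for U using \<U> that by (simp add: open_cover_def)
  have "cech_cohomologous G \<U> (\<lambda>W W'. c (id W) (id W')) (\<lambda>W W'. c (id W) (id W'))"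
    unfolding cech_cohomologous_def using G[OF o] by (intro exI[of _ "\<lambda>_ _. 1"]) simp
  then have "((\<U>, c), (\<U>, c)) \<in> cech_rel X G"
    unfolding cech_rel_def using mem \<U>
    by (auto simp: refinement_def intro!: exI[of _ \<U>] exI[of _ id])
  moreover have "cech_rel X G `` {(\<U>, c)} \<in> cech_H1 X G"
    unfolding cech_H1_def by (rule quotientI[OF mem])
  then have "cech_rel X G `` {(\<U>, c)} = cech_rel X G `` {({topspace X}, \<lambda>U V x. 1)}"
    using H by (simp add: cech_trivial_class_def)
  ultimately have "(({topspace X}, \<lambda>U V x. 1), (\<U>, c)) \<in> cech_rel X G" by blast
  then obtain \<W> r r' where W: "open_cover X \<W>" "refinement \<W> \<U> r'"
    "cech_cohomologous G \<W> (\<lambda>W W' x. 1) (\<lambda>W W'. c (r' W) (r' W'))"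
    unfolding cech_rel_def by auto
  from W(3) obtain b where g: "\<forall>U\<in>\<W>. b U \<in> G U"
    and e: "\<forall>U\<in>\<W>. \<forall>V\<in>\<W>. \<forall>x\<in>U \<inter> V. 1 = c (r' U) (r' V) x * (b V x / b U x)"
    unfolding cech_cohomologous_def by (elim exE conjE)
  show ?thesis
    by (rule that[OF W(1,2) g[THEN bspec] e[THEN bspec, THEN bspec, THEN bspec]])
qed

context prequantum
begin

definition matched :: "('a \<Rightarrow> 'a) \<Rightarrow> 'a set \<Rightarrow> ('a \<Rightarrow> 'l) \<Rightarrow> ('a \<Rightarrow> 'l) \<Rightarrow> bool" where
  "matched \<Phi> U s s' \<longleftrightarrow> openin (mtop M) U \<and> s \<in> frames M L U \<and> s' \<in> frames M L (\<Phi> ` U) \<and>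
     (\<forall>x\<in>U. \<forall>v\<in>tangent_space M x. conn_form s' (\<Phi> x) (tangent_map M M \<Phi> x v) = conn_form s x v)"

definition frame_lift :: "('a \<Rightarrow> 'a) \<Rightarrow> ('a \<Rightarrow> 'l) \<Rightarrow> ('a \<Rightarrow> 'l) \<Rightarrow> 'l \<Rightarrow> 'l" where
  "frame_lift \<Phi> s s' l = lscale L (fcoef L (s (lproj L l)) l) (s' (\<Phi> (lproj L l)))"

text \<open>Flatness is recorded through matched frames and not as \<open>F^*nabla = nabla\<close>:
  in this form it passes to the inverse by exchanging the frames, and fibrewise linearity,
  smoothness and invariance of the connection can all be read off.\<close>

definition locally_flat_lift :: "('a \<Rightarrow> 'a) \<Rightarrow> ('l \<Rightarrow> 'l) \<Rightarrow> bool" where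
  "locally_flat_lift \<Phi> F \<longleftrightarrow> (\<forall>x\<in>pts M. \<exists>U s s'. x \<in> U \<and> matched \<Phi> U s s' \<and>
     (\<forall>l\<in>pts (ltotal L). lproj L l \<in> U \<longrightarrow> F l = frame_lift \<Phi> s s' l))"

section \<open>Matched pairs of frames\<close>

lemma matchedD:
  assumes "matched \<Phi> U s s'"
  shows "openin (mtop M) U" "s \<in> frames M L U" "s' \<in> frames M L (\<Phi> ` U)"
    "x \<in> U \<Longrightarrow> v \<in> tangent_space M x \<Longrightarrow> conn_form s' (\<Phi> x) (tangent_map M M \<Phi> x v) = conn_form s x v"
  using assms by (auto simp: matched_def)

lemma diffeo_tangent_in:
  assumes "diffeomorphism M M \<Phi>" "x \<in> pts M" "v \<in> tangent_space M x"
  shows "tangent_map M M \<Phi> x v \<in> tangent_space M (\<Phi> x)"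
  by (rule tangent_map_in[OF M M _ diffeo_smooth[OF assms(1)] assms(2,3)]) simp

lemma matched_subset:
  assumes \<Phi>: "diffeomorphism M M \<Phi>" and m: "matched \<Phi> U s s'" and V: "openin (mtop M) V" "V \<subseteq> U"
  shows "matched \<Phi> V s s'"
  using matchedD[OF m] V frames_subset[OF matchedD(3)[OF m] image_mono[OF V(2)]]
  by (auto simp: matched_def intro: frames_subset)

text \<open>The chain rule for \<open>g\<close> written as its transport followed by
  \<open>\<Phi>\<close>. It serves for the exponent of the rescaling factor and for the coefficients
  of pushed forward sections.\<close>

lemma tderiv_inv:
  assumes \<Phi>: "diffeomorphism M M \<Phi>" and U: "openin (mtop M) U" and g: "smooth_fun_on M U g"
    and x: "x \<in> U" and v: "v \<in> tangent_space M x"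
  shows "smooth_fun_on M (\<Phi> ` U) (\<lambda>z. g (inv_on M \<Phi> z))"
    and "tderiv M (\<lambda>z. g (inv_on M \<Phi> z)) (\<Phi> x) (tangent_map M M \<Phi> x v) = tderiv M g x v"
proof -
  let ?\<Psi> = "inv_on M \<Phi>"
  have UM: "U \<subseteq> pts M" by (rule openin_subset[OF U])
  have xM: "x \<in> pts M" using x UM by blast
  have \<Psi>: "?\<Psi> ` (\<Phi> ` U) \<subseteq> U" using diffeo_inv1[OF \<Phi>] UM by auto
  have oU: "openin (mtop M) (\<Phi> ` U)" by (rule diffeo_image_openin[OF \<Phi> U])
  show sm: "smooth_fun_on M (\<Phi> ` U) (\<lambda>z. g (?\<Psi> z))"
    by (rule smooth_fun_on_compose[OF M M oU smooth_map_on_subset[OF diffeo_smooth_inv[OF \<Phi>] openin_subset[OF oU]] \<Psi> g])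
  have "tderiv M g x v = tderiv M (\<lambda>y. g (?\<Psi> (\<Phi> y))) x v"
    by (rule tderiv_cong[OF M U g x _ v]) (use diffeo_inv1[OF \<Phi>] UM in auto)
  also have "\<dots> = tderiv M (\<lambda>z. g (?\<Psi> z)) (\<Phi> x) (tangent_map M M \<Phi> x v)"
    by (rule tderiv_compose[OF M M _ diffeo_smooth[OF \<Phi>] xM oU sm _ v]) (use x in auto)
  finally show "tderiv M (\<lambda>z. g (?\<Psi> z)) (\<Phi> x) (tangent_map M M \<Phi> x v) = tderiv M g x v" ..
qed

lemma matched_exists:
  assumes \<Phi>: "diffeomorphism M M \<Phi>"
    and sym: "\<And>x v w. x \<in> pts M \<Longrightarrow> v \<in> tangent_space M x \<Longrightarrow> w \<in> tangent_space M x \<Longrightarrow>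
      \<omega> (\<Phi> x) (tangent_map M M \<Phi> x v) (tangent_map M M \<Phi> x w) = \<omega> x v w"
    and x0: "x0 \<in> pts M"
  obtains U s s' where "x0 \<in> U" "matched \<Phi> U s s'"
proof -
  let ?\<Psi> = "inv_on M \<Phi>"
  obtain U1 s where U1: "openin (mtop M) U1" "x0 \<in> U1" "s \<in> frames M L U1" using local_frame[OF x0] .
  obtain U2 s1 where U2: "openin (mtop M) U2" "\<Phi> x0 \<in> U2" "s1 \<in> frames M L U2"
    using local_frame[OF diffeo_in[OF \<Phi> x0]] .
  obtain \<kappa> where \<kappa>: "\<kappa> \<in> charts_at M x0" using atlas_covers[OF M x0] by blast
  note \<kappa>a = charts_atD(1)[OF \<kappa>]
  note c = atlas_chart_on[OF M \<kappa>a]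
  \<comment> \<open>In \<open>\<kappa>\<close> around \<open>x0\<close> and its push-forward around \<open>\<Phi> x0\<close> both connection forms live on the same open
    set and \<open>\<Phi>\<close> is the identity, so that no form has to be pulled back.\<close>
  define \<kappa>' where "\<kappa>' = push_chart M \<Phi> \<kappa>"
  have \<kappa>'a: "\<kappa>' \<in> atlas M" unfolding \<kappa>'_def by (rule push_chart_in_atlas(1)[OF M M \<Phi> \<kappa>a])
  note ps = push_chart_simps[OF M \<Phi> \<kappa>a, folded \<kappa>'_def]
  define S where "S = cspace \<kappa>"
  let ?U0 = "U1 \<inter> (pts M \<inter> \<Phi> -` U2)"
  have "openin (mtop M) ?U0"
    using U1(1) smooth_map_on_vimage[OF diffeo_smooth[OF \<Phi>] _ U2(1)] by auto
  then have "openin (top_of_set S) (cmap \<kappa> ` (?U0 \<inter> cdom \<kappa>))"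
    unfolding S_def by (rule chart_on_image_openin[OF c])
  note op = this[unfolded openin_contains_ball]
  have im0: "cmap \<kappa> x0 \<in> cmap \<kappa> ` (?U0 \<inter> cdom \<kappa>)" using U1(2) U2(2) x0 charts_atD(2)[OF \<kappa>] by blast
  obtain e where e: "e > 0" "ball (cmap \<kappa> x0) e \<inter> S \<subseteq> cmap \<kappa> ` (?U0 \<inter> cdom \<kappa>)"
    using bspec[OF op[THEN conjunct2] im0] by (elim exE conjE)
  have p0S: "cmap \<kappa> x0 \<in> S" by (rule subsetD[OF op[THEN conjunct1] im0])
  define D where "D = ball (cmap \<kappa> x0) e \<inter> S"
  define U where "U = {y \<in> cdom \<kappa>. cmap \<kappa> y \<in> D}"
  have S: "subspace S" unfolding S_def by (rule chart_on_subspace[OF c])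
  have Do: "openin (top_of_set S) D" unfolding D_def by (simp add: Int_commute openin_open_Int)
  have Dc: "convex D" unfolding D_def by (intro convex_Int convex_ball subspace_imp_convex S)
  have p0: "cmap \<kappa> x0 \<in> D" using e(1) p0S by (simp add: D_def)
  have Uo: "openin (mtop M) U" unfolding U_def by (rule chart_on_preimage_openin[OF c Do[unfolded S_def]])
  have x0U: "x0 \<in> U" using p0 charts_atD(2)[OF \<kappa>] by (simp add: U_def)
  have Udom: "U \<subseteq> cdom \<kappa>" by (auto simp: U_def)
  have UU0: "U \<subseteq> ?U0"
  proof
    fix y assume y: "y \<in> U"
    then have "cmap \<kappa> y \<in> cmap \<kappa> ` (?U0 \<inter> cdom \<kappa>)" using e(2) by (auto simp: U_def D_def)
    then obtain z where "z \<in> ?U0" "z \<in> cdom \<kappa>" "cmap \<kappa> y = cmap \<kappa> z" by blast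
    then show "y \<in> ?U0" using inj_onD[OF chart_on_inj[OF c], of y z] y Udom by auto
  qed
  have imU: "cmap \<kappa> ` U = D"
  proof
    show "D \<subseteq> cmap \<kappa> ` U"
    proof
      fix p assume p: "p \<in> D"
      then obtain z where "z \<in> cdom \<kappa>" "p = cmap \<kappa> z" using e(2) by (auto simp: D_def)
      then show "p \<in> cmap \<kappa> ` U" using p by (auto simp: U_def)
    qed
  qed (auto simp: U_def)
  have UM: "U \<subseteq> pts M" by (rule openin_subset[OF Uo])
  have Vo: "openin (mtop M) (\<Phi> ` U)" by (rule diffeo_image_openin[OF \<Phi> Uo])
  have Vdom: "\<Phi> ` U \<subseteq> cdom \<kappa>'" using Udom by (auto simp: ps)
  have s: "s \<in> frames M L U" by (rule frames_subset[OF U1(3)]) (use UU0 in auto)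
  have s1: "s1 \<in> frames M L (\<Phi> ` U)" by (rule frames_subset[OF U2(3)]) (use UU0 in auto)
  have \<kappa>y: "\<kappa> \<in> charts_at M y" if "y \<in> U" for y using that Udom \<kappa>a by (auto simp: charts_at_def)
  have \<kappa>'y: "\<kappa>' \<in> charts_at M (\<Phi> y)" if "y \<in> U" for y using that Vdom \<kappa>'a by (auto simp: charts_at_def)
  have ci: "cinv \<kappa> p \<in> U" "cmap \<kappa> (cinv \<kappa> p) = p" "cinv \<kappa>' p = \<Phi> (cinv \<kappa> p)" if "p \<in> D" for p
  proof -
    obtain y where y: "y \<in> U" "p = cmap \<kappa> y" using \<open>p \<in> D\<close> imU by auto
    then have "p \<in> cmap \<kappa> ` cdom \<kappa>" using Udom by blast
    then show "cinv \<kappa>' p = \<Phi> (cinv \<kappa> p)" unfolding \<kappa>'_def by (rule push_chart_in_atlas(2)[OF M M \<Phi> \<kappa>a])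
    show "cinv \<kappa> p \<in> U" "cmap \<kappa> (cinv \<kappa> p) = p" using y cinv_cmap[OF c] Udom by auto
  qed
  define A where "A p v = conn_form s (cinv \<kappa> p) (tvec M \<kappa> (cinv \<kappa> p) v)" for p v
  define A' where "A' p v = conn_form s1 (cinv \<kappa>' p) (tvec M \<kappa>' (cinv \<kappa>' p) v)" for p v
  \<comment> \<open>The difference of the two connection forms in common coordinates, written as a
    sum to fit \<open>smooth_on_add\<close>.\<close>
  define B where "B p v = A p v + (-1) *\<^sub>R A' p v" for p v
  have cs': "cspace \<kappa>' = S" by (simp add: S_def ps)
  have Asm: "smooth_on D (\<lambda>p. A p v)" if "v \<in> S" for v
    using smooth_fun_on_rep[OF conn_form_smooth[OF Uo s tvec_vector_field[OF M \<kappa>a Udom that[unfolded S_def]]] \<kappa>a] Udom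
    by (simp add: A_def imU inf_absorb1)
  have imV: "cmap \<kappa>' ` (\<Phi> ` U) = D"
  proof -
    have "cmap \<kappa>' ` (\<Phi> ` U) = cmap \<kappa> ` U"
      unfolding image_image by (rule image_cong) (use ps(3) Udom in auto)
    then show ?thesis using imU by simp
  qed
  have A'sm: "smooth_on D (\<lambda>p. A' p v)" if "v \<in> S" for v
    using smooth_fun_on_rep[OF conn_form_smooth[OF Vo s1 tvec_vector_field[OF M \<kappa>'a Vdom that[folded cs']]] \<kappa>'a] Vdom
    by (simp add: A'_def imV inf_absorb1)
  have Alin: "A p (u + v) = A p u + A p v" "A p (r *\<^sub>R u) = r *\<^sub>R A p u"
    if "p \<in> D" "u \<in> S" "v \<in> S" for p u v r
    using tvec_add[OF M \<kappa>y[OF ci(1)[OF that(1)]] that(2,3)[unfolded S_def]]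
      conn_form_linear[OF Uo s ci(1)[OF that(1)] tvec_in[OF M \<kappa>y[OF ci(1)[OF that(1)]] that(2)[unfolded S_def]]
        tvec_in[OF M \<kappa>y[OF ci(1)[OF that(1)]] that(3)[unfolded S_def]]]
    by (simp_all add: A_def)
  have A'lin: "A' p (u + v) = A' p u + A' p v" "A' p (r *\<^sub>R u) = r *\<^sub>R A' p u"
    if "p \<in> D" "u \<in> S" "v \<in> S" for p u v r
  proof -
    have i: "cinv \<kappa>' p \<in> \<Phi> ` U" using ci[OF that(1)] by auto
    have k: "\<kappa>' \<in> charts_at M (cinv \<kappa>' p)" using \<kappa>'y ci[OF that(1)] by auto
    show "A' p (u + v) = A' p u + A' p v" "A' p (r *\<^sub>R u) = r *\<^sub>R A' p u"
      using tvec_add[OF M k that(2,3)[folded cs']]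
        conn_form_linear[OF Vo s1 i tvec_in[OF M k that(2)[folded cs']] tvec_in[OF M k that(3)[folded cs']]]
      by (simp_all add: A'_def)
  qed
  have tm: "tangent_map M M \<Phi> y (tvec M \<kappa> y v) = tvec M \<kappa>' (\<Phi> y) v" if "y \<in> U" "v \<in> S" for y v
    unfolding \<kappa>'_def by (rule tangent_map_tvec[OF M M \<Phi> \<kappa>y[OF that(1)] that(2)[unfolded S_def]])
  have dB: "dir_deriv (\<lambda>p. B p v) p u = dir_deriv (\<lambda>p. A p v) p u - dir_deriv (\<lambda>p. A' p v) p u"
    if p: "p \<in> D" and u: "u \<in> S" and v: "v \<in> S" for p u v
  proof -
    obtain f where f: "((\<lambda>p. A p v) has_derivative f) (at p within D)" "\<And>u. u \<in> S \<Longrightarrow> dir_deriv (\<lambda>p. A p v) p u = f u"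
      using smooth_on_has_dir_deriv[OF S Do p Asm[OF v]] by blast
    obtain f' where f': "((\<lambda>p. A' p v) has_derivative f') (at p within D)" "\<And>u. u \<in> S \<Longrightarrow> dir_deriv (\<lambda>p. A' p v) p u = f' u"
      using smooth_on_has_dir_deriv[OF S Do p A'sm[OF v]] by blast
    have "((\<lambda>p. B p v) has_derivative (\<lambda>u. f u - f' u)) (at p within D)"
      unfolding B_def using has_derivative_diff[OF f(1) f'(1)] by simp
    from dir_deriv_eq[OF S Do p u this] show ?thesis using f(2) f'(2) u by simp
  qed
  obtain G where G: "smooth_on D G" "\<And>p v. p \<in> D \<Longrightarrow> v \<in> S \<Longrightarrow> dir_deriv G p v = B p v"
  proof (rule poincare_subspace[OF S Do Dc p0, of B])
    fix p u v assume p: "p \<in> D" and u: "u \<in> S" and v: "v \<in> S"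
    let ?y = "cinv \<kappa> p"
    note y = ci(1)[OF p]
    have "dir_deriv (\<lambda>p. A p v) p u - dir_deriv (\<lambda>p. A p u) p v = \<i> * complex_of_real (\<omega> ?y (tvec M \<kappa> ?y u) (tvec M \<kappa> ?y v))"
      using conn_form_curvature[OF Uo s \<kappa>a Udom y u[unfolded S_def] v[unfolded S_def]] ci(2)[OF p] by (simp add: A_def)
    moreover have "dir_deriv (\<lambda>p. A' p v) p u - dir_deriv (\<lambda>p. A' p u) p v =
        \<i> * complex_of_real (\<omega> (\<Phi> ?y) (tvec M \<kappa>' (\<Phi> ?y) u) (tvec M \<kappa>' (\<Phi> ?y) v))"
      using conn_form_curvature[OF Vo s1 \<kappa>'a Vdom imageI[OF y] u[folded cs'] v[folded cs']] ci(2)[OF p] ps(3)[of ?y] y Udom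
      by (auto simp: A'_def)
    \<comment> \<open>Here \<open>\<Phi>\<close> is used as a symplectomorphism: the curvatures of
      both frames agree on corresponding coordinate vectors, so \<open>B\<close> is closed.\<close>
    moreover have "\<omega> (\<Phi> ?y) (tvec M \<kappa>' (\<Phi> ?y) u) (tvec M \<kappa>' (\<Phi> ?y) v) = \<omega> ?y (tvec M \<kappa> ?y u) (tvec M \<kappa> ?y v)"
      using sym[of ?y "tvec M \<kappa> ?y u" "tvec M \<kappa> ?y v"] y UM tm[OF y u] tm[OF y v]
        tvec_in[OF M \<kappa>y[OF y] u[unfolded S_def]] tvec_in[OF M \<kappa>y[OF y] v[unfolded S_def]] by auto
    ultimately show "dir_deriv (\<lambda>p. B p u) p v = dir_deriv (\<lambda>p. B p v) p u"
      unfolding dB[OF p u v] dB[OF p v u] by (simp add: algebra_simps)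
  next
    show "smooth_on D (\<lambda>p. B p v)" if "v \<in> S" for v
      unfolding B_def by (intro smooth_on_add smooth_on_scaleR smooth_on_const Asm A'sm that)
  qed (auto simp: B_def Alin A'lin scaleR_add_right scaleR_diff_right)
  define g where "g y = G (cmap \<kappa> y)" for y
  have gsm: "smooth_fun_on M U g"
    unfolding g_def
    by (rule smooth_fun_on_comp[OF M smooth_fun_on_subset[OF smooth_fun_on_cmap[OF M \<kappa>a] Udom] _ G(1)]) (use imU in auto)
  have gd: "tderiv M g y v = conn_form s y v - conn_form s1 (\<Phi> y) (tangent_map M M \<Phi> y v)"
    if y: "y \<in> U" and v: "v \<in> tangent_space M y" for y v
  proof -
    have vS: "v \<kappa> \<in> S" unfolding S_def by (rule tangent_spaceD(1)[OF v \<kappa>y[OF y]])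
    have py: "cmap \<kappa> y \<in> D" using y imU by blast
    have cy: "cinv \<kappa> (cmap \<kappa> y) = y" by (rule charts_at_cinv[OF M \<kappa>y[OF y]])
    have "tderiv M g y v = dir_deriv (\<lambda>p. g (cinv \<kappa> p)) (cmap \<kappa> y) (v \<kappa>)"
      by (rule tderiv_chart[OF M Uo gsm y \<kappa>y[OF y] v])
    also have "\<dots> = dir_deriv G (cmap \<kappa> y) (v \<kappa>)"
      by (rule dir_deriv_cong[OF S Do py vS, symmetric, OF _ G(1)]) (simp add: g_def ci)
    also have "\<dots> = A (cmap \<kappa> y) (v \<kappa>) - A' (cmap \<kappa> y) (v \<kappa>)" by (simp add: G(2)[OF py vS] B_def)
    also have "A (cmap \<kappa> y) (v \<kappa>) = conn_form s y v"
      by (simp add: A_def cy tvec_eq[OF M v \<kappa>y[OF y]])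
    also have "A' (cmap \<kappa> y) (v \<kappa>) = conn_form s1 (\<Phi> y) (tangent_map M M \<Phi> y v)"
      using tm[OF y vS] by (simp add: A'_def ci(3)[OF py] cy tvec_eq[OF M v \<kappa>y[OF y]])
    finally show ?thesis .
  qed
  define E where "E z = exp (g (inv_on M \<Phi> z))" for z
  define s' where "s' z = lscale L (E z) (s1 z)" for z
  \<comment> \<open>The rule also asks for a tangent vector at a point of \<open>U\<close>; the
    coordinate vector of \<open>cmap \<kappa> x0\<close>, which lies in \<open>S\<close>, is
    supplied.\<close>
  have gV: "smooth_fun_on M (\<Phi> ` U) (\<lambda>z. g (inv_on M \<Phi> z))"
    by (rule tderiv_inv(1)[OF \<Phi> Uo gsm x0U]) (rule tvec_in[OF M \<kappa> p0S[unfolded S_def]])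
  have Esm: "smooth_fun_on M (\<Phi> ` U) E" unfolding E_def by (rule smooth_fun_on_exp[OF M gV])
  have s': "s' \<in> frames M L (\<Phi> ` U)"
    unfolding s'_def by (rule lscale_frame[OF Vo s1 Esm]) (simp add: E_def)
  have "conn_form s' (\<Phi> y) (tangent_map M M \<Phi> y v) = conn_form s y v"
    if y: "y \<in> U" and v: "v \<in> tangent_space M y" for y v
  proof -
    let ?z = "\<Phi> y" and ?w = "tangent_map M M \<Phi> y v"
    have z: "?z \<in> \<Phi> ` U" using y by blast
    have yM: "y \<in> pts M" using y UM by blast
    note w = diffeo_tangent_in[OF \<Phi> yM v]
    have fc: "fcoef L (s1 z) (s' z) = E z" if "z \<in> \<Phi> ` U" for z
      unfolding s'_def by (rule fcoef_lscale[OF openin_in_pts[OF Vo that] framesD(2,3)[OF s1 that]])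
    have "conn_form s' ?z ?w * E ?z = tderiv M (\<lambda>z. fcoef L (s1 z) (s' z)) ?z ?w + E ?z * conn_form s1 ?z ?w"
      using conn_form_change[OF Vo s1 s' z w] fc[OF z] by simp
    also have "tderiv M (\<lambda>z. fcoef L (s1 z) (s' z)) ?z ?w = tderiv M E ?z ?w"
      by (rule tderiv_cong[OF M Vo Esm z _ w, symmetric]) (simp add: fc)
    also have "\<dots> = E ?z * tderiv M g y v"
      using tderiv_exp[OF M Vo gV z w] tderiv_inv(2)[OF \<Phi> Uo gsm y v] by (simp add: E_def[abs_def])
    finally have "conn_form s' ?z ?w * E ?z = conn_form s y v * E ?z"
      using gd[OF y v] by (simp add: algebra_simps)
    then show ?thesis by (simp add: E_def)
  qed
  then have "matched \<Phi> U s s'" using Uo s s' by (simp add: matched_def)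
  then show ?thesis using that x0U by blast
qed

text \<open>The multiplicative rule for quotients in a line, from which the Cech cocycle condition
  of the lift ratios follows.\<close>

lemma fcoef_trans:
  assumes x: "x \<in> pts M" and e: "e \<in> fibre L x" "e \<noteq> lzero L x" and f: "f \<in> fibre L x" "f \<noteq> lzero L x"
    and a: "a \<in> fibre L x"
  shows "fcoef L e a = fcoef L e f * fcoef L f a" "fcoef L e f \<noteq> 0"
proof -
  have "fcoef L e (lscale L (fcoef L f a) f) = fcoef L f a * fcoef L e f"
    by (rule fcoef_lscale2[OF x e f(1)])
  then show "fcoef L e a = fcoef L e f * fcoef L f a"
    using fcoef_scale[OF x f a] by simp
  show "fcoef L e f \<noteq> 0" using fcoef_eq_0[OF x e f(1)] f(2) by simp
qed

text \<open>The factor between the local lift of \<open>(t, t')\<close> and that of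
  \<open>(s, s')\<close>, as \<open>frame_lift_ratio\<close> confirms: change of frame in the target
  over change of frame in the source.\<close>

definition lift_ratio :: "('a \<Rightarrow> 'a) \<Rightarrow> ('a \<Rightarrow> 'l) \<Rightarrow> ('a \<Rightarrow> 'l) \<Rightarrow> ('a \<Rightarrow> 'l) \<Rightarrow> ('a \<Rightarrow> 'l) \<Rightarrow> 'a \<Rightarrow> complex" where
  "lift_ratio \<Phi> s s' t t' x = fcoef L (s' (\<Phi> x)) (t' (\<Phi> x)) / fcoef L (s x) (t x)"

text \<open>By the gauge rule, the changes of frame in source and target have as logarithmic
  derivatives the differences of connection forms. Matching makes these differences equal, so the
  quotient of the two functions has derivative 0.\<close>

lemma lift_ratio_locally_constant:
  assumes \<Phi>: "diffeomorphism M M \<Phi>" and ms: "matched \<Phi> U s s'" and mt: "matched \<Phi> V t t'"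
  shows "lift_ratio \<Phi> s s' t t' \<in> locally_constant_units (mtop M) (U \<inter> V)"
proof -
  let ?W = "U \<inter> V"
  have Wo: "openin (mtop M) ?W" using matchedD(1)[OF ms] matchedD(1)[OF mt] by blast
  have ms: "matched \<Phi> ?W s s'" and mt: "matched \<Phi> ?W t t'"
    using matched_subset[OF \<Phi> ms Wo] matched_subset[OF \<Phi> mt Wo] by auto
  note s = matchedD[OF ms] and t = matchedD[OF mt]
  have Vo: "openin (mtop M) (\<Phi> ` ?W)" by (rule diffeo_image_openin[OF \<Phi> Wo])
  define g where "g x = fcoef L (s x) (t x)" for x
  define h' where "h' z = fcoef L (s' z) (t' z)" for z
  define h where "h x = h' (\<Phi> x)" for x
  define k where "k x = h x / g x" for x
  have pW: "x \<in> pts M" if "x \<in> ?W" for x using that by (rule openin_in_pts[OF Wo])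
  have pV: "\<Phi> x \<in> pts M" "\<Phi> x \<in> \<Phi> ` ?W" if "x \<in> ?W" for x using that diffeo_in[OF \<Phi> pW] by auto
  have g0: "g x \<noteq> 0" if "x \<in> ?W" for x
    unfolding g_def by (rule fcoef_trans(2)[OF pW[OF that] framesD(2,3)[OF s(2) that] framesD(2,3)[OF t(2) that] framesD(2)[OF t(2) that]])
  have h0: "h x \<noteq> 0" if "x \<in> ?W" for x
    unfolding h_def h'_def
    by (rule fcoef_trans(2)[OF pV(1)[OF that] framesD(2,3)[OF s(3) pV(2)[OF that]] framesD(2,3)[OF t(3) pV(2)[OF that]]
          framesD(2)[OF t(3) pV(2)[OF that]]])
  have gs: "smooth_fun_on M ?W g" unfolding g_def by (rule fcoef_section_smooth[OF Wo s(2) framesD(1)[OF t(2)]])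
  have h's: "smooth_fun_on M (\<Phi> ` ?W) h'" unfolding h'_def by (rule fcoef_section_smooth[OF Vo s(3) framesD(1)[OF t(3)]])
  have \<Phi>s: "smooth_map_on M ?W M \<Phi>"
    by (rule smooth_map_on_subset[OF diffeo_smooth[OF \<Phi>] openin_subset[OF Wo]])
  have hs: "smooth_fun_on M ?W h" unfolding h_def by (rule smooth_fun_on_compose[OF M M Wo \<Phi>s order_refl h's])
  have ks: "smooth_fun_on M ?W k" unfolding k_def by (rule smooth_fun_on_divide[OF M hs gs g0])
  have zero: "tderiv M k x v = 0" if x: "x \<in> ?W" and v: "v \<in> tangent_space M x" for x v
  proof -
    let ?w = "tangent_map M M \<Phi> x v"
    note w = diffeo_tangent_in[OF \<Phi> pW[OF x] v]
    have 1: "conn_form t x v * g x = tderiv M g x v + g x * conn_form s x v"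
      using conn_form_change[OF Wo s(2) t(2) x v] by (simp add: g_def[abs_def])
    have "tderiv M h' (\<Phi> x) ?w = tderiv M h x v"
      unfolding h_def by (rule tderiv_compose[OF M M Wo \<Phi>s x Vo h's pV(2)[OF x] v, symmetric])
    then have "conn_form t' (\<Phi> x) ?w * h x = tderiv M h x v + h x * conn_form s' (\<Phi> x) ?w"
      using conn_form_change[OF Vo s(3) t(3) pV(2)[OF x] w] by (simp add: h'_def[abs_def] h_def)
    then have 2: "conn_form t x v * h x = tderiv M h x v + h x * conn_form s x v"
      using s(4)[OF x v] t(4)[OF x v] by simp
    \<comment> \<open>The product \<open>k\<close> times \<open>g\<close> is differentiated in place
      of the quotient \<open>k\<close>, so the product rule suffices.\<close>
    have "tderiv M h x v = tderiv M (\<lambda>y. k y * g y) x v"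
      by (rule tderiv_cong[OF M Wo hs x _ v]) (use g0 in \<open>simp add: k_def\<close>)
    also have "\<dots> = k x * tderiv M g x v + tderiv M k x v * g x" by (rule tderiv_mult[OF M Wo ks gs x v])
    finally have 3: "tderiv M h x v = k x * tderiv M g x v + tderiv M k x v * g x" .
    have hk: "h x = k x * g x" using g0[OF x] by (simp add: k_def)
    have "tderiv M k x v * g x = (conn_form t x v * h x - h x * conn_form s x v) - k x * (conn_form t x v * g x - g x * conn_form s x v)"
      using 1 2 3 by simp
    also have "\<dots> = 0" unfolding hk by (simp add: algebra_simps)
    finally show ?thesis using g0[OF x] by simp
  qed
  have eq: "lift_ratio \<Phi> s s' t t' = k" by (auto simp: fun_eq_iff lift_ratio_def k_def h_def h'_def g_def)
  show ?thesis
    unfolding eq locally_constant_units_def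
  proof (intro CollectI conjI ballI)
    fix x assume x: "x \<in> ?W"
    show "k x \<noteq> 0" using g0[OF x] h0[OF x] by (simp add: k_def)
    show "\<exists>W. openin (mtop M) W \<and> x \<in> W \<and> W \<subseteq> ?W \<and> (\<forall>y\<in>W. k y = k x)"
      using locally_constant_if_tderiv_zero[OF M Wo ks zero x] by metis
  qed
qed

lemma frame_lift_ratio:
  assumes \<Phi>: "diffeomorphism M M \<Phi>" and ms: "matched \<Phi> U s s'" and mt: "matched \<Phi> V t t'"
    and l: "l \<in> pts (ltotal L)" "lproj L l \<in> U" "lproj L l \<in> V"
  shows "frame_lift \<Phi> t t' l = lscale L (lift_ratio \<Phi> s s' t t' (lproj L l)) (frame_lift \<Phi> s s' l)"
proof -
  let ?x = "lproj L l"
  note x = proj_in[OF l(1)] and lf = in_fibre_proj[OF l(1)]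
  note s = matchedD[OF ms] and t = matchedD[OF mt]
  have y: "\<Phi> ?x \<in> pts M" "\<Phi> ?x \<in> \<Phi> ` U" "\<Phi> ?x \<in> \<Phi> ` V" using diffeo_in[OF \<Phi> x] l by auto
  note sx = framesD(2,3)[OF s(2) l(2)] and tx = framesD(2,3)[OF t(2) l(3)]
  note sy = framesD(2,3)[OF s(3) y(2)] and ty = framesD(2,3)[OF t(3) y(3)]
  have "fcoef L (t ?x) l = fcoef L (s ?x) l / fcoef L (s ?x) (t ?x)"
    using fcoef_trans[OF x sx tx lf] by simp
  moreover have "t' (\<Phi> ?x) = lscale L (fcoef L (s' (\<Phi> ?x)) (t' (\<Phi> ?x))) (s' (\<Phi> ?x))"
    by (rule fcoef_scale[OF y(1) sy ty(1), symmetric])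
  ultimately show ?thesis
    unfolding frame_lift_def lift_ratio_def
    by (metis (no_types, lifting) lscale_lscale[OF y(1) sy(1)] mult.commute times_divide_eq_left times_divide_eq_right)
qed

text \<open>A constant factor has derivative 0 and leaves the connection form unchanged; this is
  what allows locally constant units to be absorbed into local lifts.\<close>

lemma matched_scale:
  assumes \<Phi>: "diffeomorphism M M \<Phi>" and m: "matched \<Phi> U s s'" and z: "z \<noteq> 0"
  shows "matched \<Phi> U s (\<lambda>y. lscale L z (s' y))"
    and "l \<in> pts (ltotal L) \<Longrightarrow> lproj L l \<in> U \<Longrightarrow>
      frame_lift \<Phi> s (\<lambda>y. lscale L z (s' y)) l = lscale L z (frame_lift \<Phi> s s' l)"
proof -
  note s = matchedD[OF m]
  have Vo: "openin (mtop M) (\<Phi> ` U)" by (rule diffeo_image_openin[OF \<Phi> s(1)])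
  have f: "(\<lambda>y. lscale L z (s' y)) \<in> frames M L (\<Phi> ` U)"
    by (rule lscale_frame[OF Vo s(3) smooth_fun_on_const]) (rule z)
  have "conn_form (\<lambda>y. lscale L z (s' y)) y w = conn_form s' y w"
    if y: "y \<in> \<Phi> ` U" and w: "w \<in> tangent_space M y" for y w
  proof -
    have fc: "fcoef L (s' y) (lscale L z (s' y)) = z" if "y \<in> \<Phi> ` U" for y
      by (rule fcoef_lscale[OF openin_in_pts[OF Vo that] framesD(2,3)[OF s(3) that]])
    have "tderiv M (\<lambda>y. fcoef L (s' y) (lscale L z (s' y))) y w = 0"
      using tderiv_cong[OF M Vo smooth_fun_on_const y fc[symmetric] w] tderiv_const[OF M openin_in_pts[OF Vo y] w, of z] by simp
    then show ?thesis using conn_form_change[OF Vo s(3) f y w] fc[OF y] z by simp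
  qed
  then show "matched \<Phi> U s (\<lambda>y. lscale L z (s' y))"
    using s f diffeo_tangent_in[OF \<Phi> openin_in_pts[OF s(1)]] by (simp add: matched_def)
  assume l: "l \<in> pts (ltotal L)" "lproj L l \<in> U"
  have y: "\<Phi> (lproj L l) \<in> pts M" "\<Phi> (lproj L l) \<in> \<Phi> ` U" using diffeo_in[OF \<Phi> proj_in[OF l(1)]] l by auto
  show "frame_lift \<Phi> s (\<lambda>y. lscale L z (s' y)) l = lscale L z (frame_lift \<Phi> s s' l)"
    unfolding frame_lift_def lscale_lscale[OF y(1) framesD(2)[OF s(3) y(2)]] by (simp add: mult.commute)
qed

lemma frame_lift_in:
  assumes \<Phi>: "diffeomorphism M M \<Phi>" and m: "matched \<Phi> U s s'" and l: "l \<in> pts (ltotal L)" "lproj L l \<in> U"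
  shows "frame_lift \<Phi> s s' l \<in> fibre L (\<Phi> (lproj L l))"
  unfolding frame_lift_def
  by (rule lscale_in[OF diffeo_in[OF \<Phi> proj_in[OF l(1)]] framesD(2)[OF matchedD(3)[OF m]]]) (use l in auto)

lemma locally_flat_lift_exists:
  assumes \<Phi>: "diffeomorphism M M \<Phi>"
    and sym: "\<And>x v w. x \<in> pts M \<Longrightarrow> v \<in> tangent_space M x \<Longrightarrow> w \<in> tangent_space M x \<Longrightarrow>
      \<omega> (\<Phi> x) (tangent_map M M \<Phi> x v) (tangent_map M M \<Phi> x w) = \<omega> x v w"
    and H: "cech_H1 (mtop M) (locally_constant_units (mtop M)) =
         {cech_trivial_class (mtop M) (locally_constant_units (mtop M))}"
  obtains F where "locally_flat_lift \<Phi> F"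
proof -
  let ?G = "locally_constant_units (mtop M)"
  \<comment> \<open>The cover consists of all open sets that carry a matched pair. Cochains are
    indexed by the members of the cover, so one pair is chosen for each member.\<close>
  define \<U> where "\<U> = {U. \<exists>s s'. matched \<Phi> U s s'}"
  have "\<forall>U\<in>\<U>. \<exists>s s'. matched \<Phi> U s s'" by (simp add: \<U>_def)
  then obtain S S' where S: "\<And>U. U \<in> \<U> \<Longrightarrow> matched \<Phi> U (S U) (S' U)" by metis
  define c where "c U V = lift_ratio \<Phi> (S U) (S' U) (S V) (S' V)" for U V
  have cover: "open_cover (mtop M) \<U>"
    unfolding open_cover_def
  proof (intro conjI ballI equalityI)
    show "openin (mtop M) U" if "U \<in> \<U>" for U using matchedD(1)[OF S[OF that]] .
    then show "\<Union>\<U> \<subseteq> pts M" using openin_subset by blast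
    show "pts M \<subseteq> \<Union>\<U>" using matched_exists[OF \<Phi> sym] by (auto simp: \<U>_def) metis
  qed
  have coc: "cech_cocycle ?G \<U> c"
    unfolding cech_cocycle_def
  proof (intro conjI ballI)
    show "c U V \<in> ?G (U \<inter> V)" if "U \<in> \<U>" "V \<in> \<U>" for U V
      unfolding c_def by (rule lift_ratio_locally_constant[OF \<Phi> S[OF that(1)] S[OF that(2)]])
    fix U V W x assume U: "U \<in> \<U>" and V: "V \<in> \<U>" and W: "W \<in> \<U>" and x: "x \<in> U \<inter> V \<inter> W"
    have x': "x \<in> U" "x \<in> V" "x \<in> W" and y: "\<Phi> x \<in> \<Phi> ` U" "\<Phi> x \<in> \<Phi> ` V" "\<Phi> x \<in> \<Phi> ` W" using x by auto
    note u = matchedD[OF S[OF U]] and v = matchedD[OF S[OF V]] and w = matchedD[OF S[OF W]]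
    note p = openin_in_pts[OF u(1) x'(1)]
    note a = fcoef_trans[OF p framesD(2,3)[OF u(2) x'(1)] framesD(2,3)[OF v(2) x'(2)] framesD(2)[OF w(2) x'(3)]]
    note b = fcoef_trans[OF diffeo_in[OF \<Phi> p] framesD(2,3)[OF u(3) y(1)] framesD(2,3)[OF v(3) y(2)] framesD(2)[OF w(3) y(3)]]
    show "c U V x * c V W x = c U W x" unfolding c_def lift_ratio_def a(1) b(1) by simp
  qed
  have one: "(\<lambda>_. 1) \<in> ?G U" if "openin (mtop M) U" for U
    using that by (auto simp: locally_constant_units_def)
  obtain \<W> r b where \<W>: "open_cover (mtop M) \<W>" and r: "refinement \<W> \<U> r"
    and b: "\<And>W. W \<in> \<W> \<Longrightarrow> b W \<in> ?G W"
      "\<And>W W' x. W \<in> \<W> \<Longrightarrow> W' \<in> \<W> \<Longrightarrow> x \<in> W \<inter> W' \<Longrightarrow> 1 = c (r W) (r W') x * (b W' x / b W x)"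
    using cech_H1_trivialD[OF H coc cover one] by metis
  have b0: "b W x \<noteq> 0" if "W \<in> \<W>" "x \<in> W" for W x
    using b(1)[OF that(1)] that(2) by (simp add: locally_constant_units_def)
  have rW: "r W \<in> \<U>" "W \<subseteq> r W" if "W \<in> \<W>" for W using r that by (auto simp: refinement_def)
  have "\<forall>x\<in>pts M. \<exists>W. W \<in> \<W> \<and> x \<in> W" using \<W> by (auto simp: open_cover_def)
  then obtain w where w: "\<And>x. x \<in> pts M \<Longrightarrow> w x \<in> \<W>" "\<And>x. x \<in> pts M \<Longrightarrow> x \<in> w x" by metis
  define fl where "fl W = frame_lift \<Phi> (S (r W)) (S' (r W))" for W
  \<comment> \<open>Over each point an arbitrary member \<open>w\<close> of the refinement is used.
    By the coboundary relation, \<open>b W\<close> times \<open>fl W\<close> takes the same values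
    on overlaps, so the choice does not affect \<open>F\<close>.\<close>
  define F where "F l = lscale L (b (w (lproj L l)) (lproj L l)) (fl (w (lproj L l)) l)" for l
  have "locally_flat_lift \<Phi> F"
    unfolding locally_flat_lift_def
  proof
    fix x0 assume x0: "x0 \<in> pts M"
    define W0 where "W0 = w x0"
    have W0: "W0 \<in> \<W>" "x0 \<in> W0" unfolding W0_def using w[OF x0] by auto
    \<comment> \<open>\<open>b W0\<close> is only locally constant; on \<open>V\<close> it is
      constant and can be absorbed into the target frame by \<open>matched_scale\<close>.\<close>
    obtain V where V: "openin (mtop M) V" "x0 \<in> V" "V \<subseteq> W0" "\<forall>y\<in>V. b W0 y = b W0 x0"
      using b(1)[OF W0(1)] W0(2) unfolding locally_constant_units_def by blast
    note m0 = S[OF rW(1)[OF W0(1)]]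
    have m: "matched \<Phi> V (S (r W0)) (S' (r W0))"
      by (rule matched_subset[OF \<Phi> m0 V(1)]) (use V(3) rW(2)[OF W0(1)] in blast)
    note ms = matched_scale[OF \<Phi> m b0[OF W0]]
    have "F l = frame_lift \<Phi> (S (r W0)) (\<lambda>y. lscale L (b W0 x0) (S' (r W0) y)) l"
      if l: "l \<in> pts (ltotal L)" "lproj L l \<in> V" for l
    proof -
      let ?x = "lproj L l"
      note x = proj_in[OF l(1)]
      let ?W = "w ?x"
      note W = w[OF x]
      have x0': "?x \<in> W0" using l(2) V(3) by blast
      have fi: "fl W0 l \<in> fibre L (\<Phi> ?x)"
        unfolding fl_def by (rule frame_lift_in[OF \<Phi> m0 l(1)]) (use x0' rW(2)[OF W0(1)] in blast)
      have "fl ?W l = lscale L (c (r W0) (r ?W) ?x) (fl W0 l)"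
        unfolding fl_def c_def
        by (rule frame_lift_ratio[OF \<Phi> m0 S[OF rW(1)[OF W(1)]] l(1)]) (use x0' W(2) rW(2)[OF W0(1)] rW(2)[OF W(1)] in auto)
      then have "F l = lscale L (b ?W ?x * c (r W0) (r ?W) ?x) (fl W0 l)"
        unfolding F_def by (simp add: lscale_lscale[OF diffeo_in[OF \<Phi> x] fi])
      also have "b ?W ?x * c (r W0) (r ?W) ?x = b W0 ?x"
        using b(2)[OF W0(1) W(1), of ?x] x0' W(2) b0[OF W0(1) x0'] by (simp add: field_simps)
      also have "b W0 ?x = b W0 x0" using V(4) l(2) by blast
      finally show ?thesis using ms(2)[OF l] by (simp add: fl_def)
    qed
    then show "\<exists>U s s'. x0 \<in> U \<and> matched \<Phi> U s s' \<and> (\<forall>l\<in>pts (ltotal L). lproj L l \<in> U \<longrightarrow> F l = frame_lift \<Phi> s s' l)"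
      using ms(1) V(2) by blast
  qed
  then show ?thesis using that by blast
qed

section \<open>Global properties of locally flat lifts\<close>

lemma locally_flat_liftE:
  assumes "locally_flat_lift \<Phi> F" "x \<in> pts M"
  obtains U s s' where "x \<in> U" "matched \<Phi> U s s'"
    "\<And>l. l \<in> pts (ltotal L) \<Longrightarrow> lproj L l \<in> U \<Longrightarrow> F l = frame_lift \<Phi> s s' l"
proof -
  from bspec[OF assms(1)[unfolded locally_flat_lift_def] assms(2)]
  obtain U s s' where "x \<in> U" "matched \<Phi> U s s'"
    and e: "\<forall>l\<in>pts (ltotal L). lproj L l \<in> U \<longrightarrow> F l = frame_lift \<Phi> s s' l"
    by (elim exE conjE)
  then show ?thesis by (intro that[of U s s'] e[THEN bspec, THEN mp])
qed

text \<open>On a single fibre \<open>F\<close> is the complex linear map that sends the basis vector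
  \<open>e\<close> to the basis vector \<open>e'\<close>.\<close>

lemma
  assumes \<Phi>: "diffeomorphism M M \<Phi>" and F: "locally_flat_lift \<Phi> F" and x: "x \<in> pts M"
  shows flat_lift_bij: "bij_betw F (fibre L x) (fibre L (\<Phi> x))"
    and flat_lift_add: "a \<in> fibre L x \<Longrightarrow> b \<in> fibre L x \<Longrightarrow> F (ladd L a b) = ladd L (F a) (F b)"
    and flat_lift_scale: "a \<in> fibre L x \<Longrightarrow> F (lscale L z a) = lscale L z (F a)"
    and flat_lift_zero: "F (lzero L x) = lzero L (\<Phi> x)"
proof -
  obtain U s s' where U: "x \<in> U" and m: "matched \<Phi> U s s'"
    and eq: "\<And>l. l \<in> pts (ltotal L) \<Longrightarrow> lproj L l \<in> U \<Longrightarrow> F l = frame_lift \<Phi> s s' l"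
    using locally_flat_liftE[OF F x] by blast
  define e where "e = s x"
  define e' where "e' = s' (\<Phi> x)"
  note y = diffeo_in[OF \<Phi> x]
  have e: "e \<in> fibre L x" "e \<noteq> lzero L x" using framesD(2,3)[OF matchedD(2)[OF m] U] by (auto simp: e_def)
  have e': "e' \<in> fibre L (\<Phi> x)" "e' \<noteq> lzero L (\<Phi> x)"
    using framesD(2,3)[OF matchedD(3)[OF m] imageI[OF U]] by (auto simp: e'_def)
  have Fl: "F l = lscale L (fcoef L e l) e'" if "l \<in> fibre L x" for l
    using eq[OF fibreD(1)[OF that]] fibreD(2)[OF that] U by (simp add: frame_lift_def e_def e'_def)
  show "bij_betw F (fibre L x) (fibre L (\<Phi> x))"
  proof (rule bij_betwI[of _ _ _ "\<lambda>l. lscale L (fcoef L e' l) e"])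
    show "F \<in> fibre L x \<rightarrow> fibre L (\<Phi> x)" using Fl lscale_in[OF y e'(1)] by auto
    show "(\<lambda>l. lscale L (fcoef L e' l) e) \<in> fibre L (\<Phi> x) \<rightarrow> fibre L x" using lscale_in[OF x e(1)] by auto
    show "lscale L (fcoef L e' (F l)) e = l" if "l \<in> fibre L x" for l
      using Fl[OF that] fcoef_lscale[OF y e'] fcoef_scale[OF x e that] by simp
    show "F (lscale L (fcoef L e' l) e) = l" if "l \<in> fibre L (\<Phi> x)" for l
      using Fl[OF lscale_in[OF x e(1)]] fcoef_lscale[OF x e] fcoef_scale[OF y e' that] by simp
  qed
  show "F (ladd L a b) = ladd L (F a) (F b)" if "a \<in> fibre L x" "b \<in> fibre L x"
    using Fl that ladd_in[OF x] fcoef_ladd[OF x e] lscale_add[OF y e'(1)] by simp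
  show "F (lscale L z a) = lscale L z (F a)" if "a \<in> fibre L x"
    using Fl that lscale_in[OF x] fcoef_lscale2[OF x e] lscale_lscale[OF y e'(1)] by simp
  have "fcoef L e (lzero L x) = 0" using fcoef_eq_0[OF x e lzero_in[OF x]] by simp
  then show "F (lzero L x) = lzero L (\<Phi> x)" using Fl[OF lzero_in[OF x]] lscale_zero[OF y e'(1)] by simp
qed

lemma flat_lift_in:
  "diffeomorphism M M \<Phi> \<Longrightarrow> locally_flat_lift \<Phi> F \<Longrightarrow> x \<in> pts M \<Longrightarrow> l \<in> fibre L x \<Longrightarrow> F l \<in> fibre L (\<Phi> x)"
  using flat_lift_bij bij_betwE by blast

text \<open>\<open>F\<close> permutes the fibres as \<open>\<Phi>\<close> permutes the points and is
  bijective on each of them.\<close>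

lemma flat_lift_bij_total:
  assumes \<Phi>: "diffeomorphism M M \<Phi>" and F: "locally_flat_lift \<Phi> F"
  shows "bij_betw F (pts (ltotal L)) (pts (ltotal L))"
  unfolding bij_betw_def
proof
  have fib: "F l \<in> fibre L (\<Phi> (lproj L l))" if "l \<in> pts (ltotal L)" for l
    by (rule flat_lift_in[OF \<Phi> F proj_in[OF that] in_fibre_proj[OF that]])
  show "inj_on F (pts (ltotal L))"
  proof (rule inj_onI)
    fix l l' assume l: "l \<in> pts (ltotal L)" "l' \<in> pts (ltotal L)" "F l = F l'"
    then have "\<Phi> (lproj L l) = \<Phi> (lproj L l')" using fib fibreD(2) by metis
    then have "lproj L l = lproj L l'" using diffeo_inv1[OF \<Phi>] proj_in l by metis
    then have "l \<in> fibre L (lproj L l)" "l' \<in> fibre L (lproj L l)" using in_fibre_proj l by metis+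
    then show "l = l'"
      using bij_betw_imp_inj_on[OF flat_lift_bij[OF \<Phi> F proj_in[OF l(1)]]] l(3) by (metis inj_onD)
  qed
  show "F ` pts (ltotal L) = pts (ltotal L)"
  proof (intro equalityI subsetI)
    fix l assume "l \<in> F ` pts (ltotal L)"
    then show "l \<in> pts (ltotal L)" using fib fibreD(1) by blast
  next
    fix l assume l: "l \<in> pts (ltotal L)"
    let ?x = "inv_on M \<Phi> (lproj L l)"
    have x: "?x \<in> pts M" "\<Phi> ?x = lproj L l"
      using diffeo_inv_in[OF \<Phi> proj_in[OF l]] diffeo_inv2[OF \<Phi> proj_in[OF l]] by auto
    then have "l \<in> F ` fibre L ?x"
      using flat_lift_bij[OF \<Phi> F x(1)] in_fibre_proj[OF l] by (simp add: bij_betw_def)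
    then show "l \<in> F ` pts (ltotal L)" using fibreD(1) by blast
  qed
qed

text \<open>Near \<open>l\<close>, \<open>F\<close> is a multiple of the frame \<open>s'\<close>
  along the projection followed by \<open>\<Phi>\<close>, and the factor is the coefficient of the
  tautological section, which \<open>fcoef_smooth\<close> covers.\<close>

lemma flat_lift_smooth:
  assumes \<Phi>: "diffeomorphism M M \<Phi>" and F: "locally_flat_lift \<Phi> F"
  shows "smooth_map_on (ltotal L) (pts (ltotal L)) (ltotal L) F"
proof (rule smooth_map_on_local[OF total_mfd total_mfd])
  fix l assume l: "l \<in> pts (ltotal L)"
  obtain U s s' where U: "lproj L l \<in> U" and m: "matched \<Phi> U s s'"
    and eq: "\<And>l. l \<in> pts (ltotal L) \<Longrightarrow> lproj L l \<in> U \<Longrightarrow> F l = frame_lift \<Phi> s s' l"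
    using locally_flat_liftE[OF F proj_in[OF l]] by blast
  note s = matchedD[OF m]
  let ?W = "pts (ltotal L) \<inter> lproj L -` U"
  have Wo: "openin (mtop (ltotal L)) ?W" by (rule smooth_map_on_vimage[OF proj_smooth _ s(1)]) simp
  have Vo: "openin (mtop M) (\<Phi> ` U)" by (rule diffeo_image_openin[OF \<Phi> s(1)])
  have \<pi>: "smooth_map_on (ltotal L) ?W M (lproj L)" by (rule smooth_map_on_subset[OF proj_smooth]) auto
  have f: "smooth_fun_on (ltotal L) ?W (\<lambda>l. fcoef L (s (lproj L l)) l)"
    by (rule fcoef_smooth[OF total_mfd Wo s(1,2) \<pi> _ smooth_map_on_id[OF total_mfd Wo]])
      (auto intro: in_fibre_proj)
  have h: "smooth_map_on (ltotal L) ?W M (\<lambda>l. \<Phi> (lproj L l))"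
    by (rule smooth_map_on_compose[OF total_mfd M M Wo _ \<pi> _ diffeo_smooth[OF \<Phi>]]) (auto intro: proj_in)
  have "smooth_map_on (ltotal L) ?W (ltotal L) (\<lambda>l. lscale L (fcoef L (s (lproj L l)) l) (s' (\<Phi> (lproj L l))))"
    by (rule lscale_smooth[OF total_mfd Wo Vo framesD(1)[OF s(3)] h _ f]) auto
  then have "smooth_map_on (ltotal L) ?W (ltotal L) F"
    by (rule smooth_map_on_cong[OF total_mfd Wo, rotated]) (use eq in \<open>auto simp: frame_lift_def\<close>)
  then show "\<exists>V. openin (mtop (ltotal L)) V \<and> l \<in> V \<and> smooth_map_on (ltotal L) V (ltotal L) F"
    using Wo l U by blast
qed simp

lemma flat_lift_inv_eq:
  assumes \<Phi>: "diffeomorphism M M \<Phi>" and F: "locally_flat_lift \<Phi> F"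
  shows "l \<in> pts (ltotal L) \<Longrightarrow> inv_on (ltotal L) F (F l) = l"
    and "l \<in> pts (ltotal L) \<Longrightarrow> F (inv_on (ltotal L) F l) = l"
    and "l \<in> pts (ltotal L) \<Longrightarrow> inv_on (ltotal L) F l \<in> pts (ltotal L)"
  using flat_lift_bij_total[OF \<Phi> F] unfolding inv_on_def
  by (auto simp: bij_betw_def inv_into_into f_inv_into_f)

text \<open>Locally the inverse is the lift of the exchanged pair \<open>(s', s)\<close>; its forms
  match because the tangent maps of \<open>\<Phi>\<close> and its inverse cancel.\<close>

lemma flat_lift_inverse:
  assumes \<Phi>: "diffeomorphism M M \<Phi>" and F: "locally_flat_lift \<Phi> F"
  shows "locally_flat_lift (inv_on M \<Phi>) (inv_on (ltotal L) F)"
  unfolding locally_flat_lift_def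
proof
  let ?\<Psi> = "inv_on M \<Phi>"
  note \<Psi> = diffeomorphism_inv[OF M M \<Phi>]
  fix y assume y: "y \<in> pts M"
  let ?x = "?\<Psi> y"
  obtain U s s' where U: "?x \<in> U" and m: "matched \<Phi> U s s'"
    and eq: "\<And>l. l \<in> pts (ltotal L) \<Longrightarrow> lproj L l \<in> U \<Longrightarrow> F l = frame_lift \<Phi> s s' l"
    using locally_flat_liftE[OF F diffeo_inv_in[OF \<Phi> y]] by blast
  note s = matchedD[OF m]
  have UM: "U \<subseteq> pts M" by (rule openin_subset[OF s(1)])
  have im: "?\<Psi> ` \<Phi> ` U = U" using diffeo_inv1[OF \<Phi>] UM by (force simp: image_iff)
  have yU: "y \<in> \<Phi> ` U" using U diffeo_inv2[OF \<Phi> y] by (metis imageI)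
  have Vo: "openin (mtop M) (\<Phi> ` U)" by (rule diffeo_image_openin[OF \<Phi> s(1)])
  have "conn_form s (?\<Psi> z) (tangent_map M M ?\<Psi> z w) = conn_form s' z w"
    if z: "z \<in> \<Phi> ` U" and w: "w \<in> tangent_space M z" for z w
  proof -
    have zM: "z \<in> pts M" by (rule openin_in_pts[OF Vo z])
    have "tangent_map M M \<Phi> (?\<Psi> z) (tangent_map M M ?\<Psi> z w) = tangent_map M M (\<lambda>z. \<Phi> (?\<Psi> z)) z w"
      by (rule tangent_map_compose[OF M M M _ diffeo_smooth[OF \<Psi>] zM _ diffeo_smooth[OF \<Phi>] diffeo_inv_in[OF \<Phi> zM] w, symmetric]) auto
    also have "\<dots> = tangent_map M M (\<lambda>z. z) z w"
      by (rule tangent_map_cong[OF M M _ smooth_map_on_id[OF M] zM _ w, symmetric]) (auto simp: diffeo_inv2[OF \<Phi>])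
    also have "\<dots> = w" by (rule tangent_map_id[OF M zM w])
    finally have "tangent_map M M \<Phi> (?\<Psi> z) (tangent_map M M ?\<Psi> z w) = w" .
    then show ?thesis
      using s(4)[of "?\<Psi> z" "tangent_map M M ?\<Psi> z w"] im z diffeo_tangent_in[OF \<Psi> zM w] diffeo_inv2[OF \<Phi> zM] by (metis imageI)
  qed
  then have m': "matched ?\<Psi> (\<Phi> ` U) s' s" unfolding matched_def im using s Vo by blast
  have "inv_on (ltotal L) F l = frame_lift ?\<Psi> s' s l" if l: "l \<in> pts (ltotal L)" "lproj L l \<in> \<Phi> ` U" for l
  proof -
    let ?z = "lproj L l"
    note z = proj_in[OF l(1)]
    have x: "?\<Psi> ?z \<in> U" "?\<Psi> ?z \<in> pts M" using im l(2) UM by blast+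
    note sf = framesD(2,3)[OF s(2) x(1)] and sf' = framesD(2,3)[OF s(3) l(2)]
    define k where "k = frame_lift ?\<Psi> s' s l"
    have k: "k = lscale L (fcoef L (s' ?z) l) (s (?\<Psi> ?z))" by (simp add: k_def frame_lift_def)
    have kf: "k \<in> fibre L (?\<Psi> ?z)" unfolding k by (rule lscale_in[OF x(2) sf(1)])
    have "F k = frame_lift \<Phi> s s' k" by (rule eq) (use fibreD[OF kf] x in auto)
    also have "\<dots> = lscale L (fcoef L (s' ?z) l) (s' ?z)"
      unfolding frame_lift_def fibreD(2)[OF kf] diffeo_inv2[OF \<Phi> z] by (simp add: k fcoef_lscale[OF x(2) sf])
    also have "\<dots> = l" by (rule fcoef_scale[OF z sf' in_fibre_proj[OF l(1)]])
    finally have "F k = l" .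
    then show ?thesis using flat_lift_inv_eq(1)[OF \<Phi> F fibreD(1)[OF kf]] by (simp add: k_def)
  qed
  then show "\<exists>U s s'. y \<in> U \<and> matched ?\<Psi> U s s' \<and>
      (\<forall>l\<in>pts (ltotal L). lproj L l \<in> U \<longrightarrow> inv_on (ltotal L) F l = frame_lift ?\<Psi> s s' l)"
    using yU m' by blast
qed

text \<open>The inverse is again a locally flat lift, so \<open>flat_lift_smooth\<close> also
  provides the smoothness of the inverse.\<close>

lemma flat_lift_is_lift:
  assumes \<Phi>: "diffeomorphism M M \<Phi>" and F: "locally_flat_lift \<Phi> F"
  shows "is_lift M L \<Phi> F"
  unfolding is_lift_def diffeomorphism_def
proof (intro conjI ballI allI)
  show "smooth_map_on (ltotal L) (pts (ltotal L)) (ltotal L) (inv_on (ltotal L) F)"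
    by (rule flat_lift_smooth[OF diffeomorphism_inv[OF M M \<Phi>] flat_lift_inverse[OF \<Phi> F]])
  show "lproj L (F l) = \<Phi> (lproj L l)" if "l \<in> pts (ltotal L)" for l
    by (rule fibreD(2)[OF flat_lift_in[OF \<Phi> F proj_in[OF that] in_fibre_proj[OF that]]])
qed (blast intro: flat_lift_bij_total[OF \<Phi> F] flat_lift_smooth[OF \<Phi> F] flat_lift_bij[OF \<Phi> F]
    flat_lift_add[OF \<Phi> F] flat_lift_scale[OF \<Phi> F])+

text \<open>If \<open>t\<close> is \<open>f\<close> times \<open>s\<close>, then its push-forward is
  the transport of \<open>f\<close> times \<open>s'\<close>. The Leibniz rule and the matched forms
  give both derivatives the same coefficient, and \<open>F\<close> carries \<open>s\<close> to
  \<open>s'\<close>.\<close>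

lemma flat_lift_connection_eq:
  assumes \<Phi>: "diffeomorphism M M \<Phi>" and F: "locally_flat_lift \<Phi> F"
  shows "connection_eq M L (pullback_connection M L \<Phi> F nab) nab"
  unfolding connection_eq_def
proof (intro allI impI ballI)
  fix U0 t x v assume U0: "openin (mtop M) U0" and t0: "t \<in> sections M L U0" and x0: "x \<in> U0"
    and v: "v \<in> tangent_space M x"
  note xM = openin_in_pts[OF U0 x0]
  obtain U1 s s' where U1: "x \<in> U1" and m1: "matched \<Phi> U1 s s'"
    and eq1: "\<And>l. l \<in> pts (ltotal L) \<Longrightarrow> lproj L l \<in> U1 \<Longrightarrow> F l = frame_lift \<Phi> s s' l"
    using locally_flat_liftE[OF F xM] by blast
  define U where "U = U0 \<inter> U1"
  have Uo: "openin (mtop M) U" using U0 matchedD(1)[OF m1] by (auto simp: U_def)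
  have x: "x \<in> U" using x0 U1 by (simp add: U_def)
  note m = matched_subset[OF \<Phi> m1 Uo]
  have m: "matched \<Phi> U s s'" by (rule m) (simp add: U_def)
  note s = matchedD[OF m]
  have t: "t \<in> sections M L U" by (rule sections_subset[OF t0]) (simp add: U_def)
  have Vo: "openin (mtop M) (\<Phi> ` U)" by (rule diffeo_image_openin[OF \<Phi> Uo])
  have UM: "U \<subseteq> pts M" by (rule openin_subset[OF Uo])
  define f where "f y = fcoef L (s y) (t y)" for y
  have fs: "smooth_fun_on M U f" unfolding f_def by (rule fcoef_section_smooth[OF Uo s(2) t])
  define p where "p = push_section M \<Phi> F t"
  note fi = tderiv_inv[OF \<Phi> Uo fs x v]
  have Fl: "F l = lscale L (fcoef L (s y) l) (s' (\<Phi> y))" if "y \<in> U" "l \<in> fibre L y" for l y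
    using eq1[OF fibreD(1)[OF that(2)]] fibreD(2)[OF that(2)] that(1) by (simp add: frame_lift_def U_def)
  have p: "p z = lscale L (f (inv_on M \<Phi> z)) (s' z)" if z: "z \<in> \<Phi> ` U" for z
  proof -
    obtain y where y: "y \<in> U" "z = \<Phi> y" using z by blast
    then have "inv_on M \<Phi> z = y" using diffeo_inv1[OF \<Phi>] UM by auto
    then show ?thesis using Fl[OF y(1) sectionsD(2)[OF t y(1)]] y by (simp add: p_def push_section_def f_def)
  qed
  have q: "(\<lambda>z. lscale L (f (inv_on M \<Phi> z)) (s' z)) \<in> sections M L (\<Phi> ` U)"
    by (rule lscale_section[OF Vo framesD(1)[OF s(3)] fi(1)])
  have ps: "p \<in> sections M L (\<Phi> ` U)"
    unfolding sections_def
  proof (intro CollectI conjI ballI)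
    show "smooth_map_on M (\<Phi> ` U) (ltotal L) p"
      by (rule smooth_map_on_cong[OF M Vo _ sectionsD(1)[OF q]]) (simp add: p)
    show "p z \<in> fibre L z" if "z \<in> \<Phi> ` U" for z using sectionsD(2)[OF q that] p[OF that] by simp
  qed
  let ?w = "tangent_map M M \<Phi> x v"
  have z: "\<Phi> x \<in> \<Phi> ` U" using x by blast
  note w = diffeo_tangent_in[OF \<Phi> xM v]
  note sx = framesD(2,3)[OF s(2) x]
  have nt: "nab t x v = lscale L (tderiv M f x v + f x * conn_form s x v) (s x)"
    using nab_section[OF Uo s(2) t x v] by (simp add: f_def[abs_def])
  have "nab p (\<Phi> x) ?w = nab (\<lambda>z. lscale L (f (inv_on M \<Phi> z)) (s' z)) (\<Phi> x) ?w"
    by (rule nab_germ[OF Vo q Vo order_refl ps p z w])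
  also have "\<dots> = lscale L (tderiv M f x v + f x * conn_form s x v) (s' (\<Phi> x))"
    unfolding nab_lscale_frame[OF Vo s(3) fi(1) z w] fi(2) diffeo_inv1[OF \<Phi> xM] s(4)[OF x v] ..
  also have "\<dots> = F (nab t x v)"
    using Fl[OF x nab_in[OF Uo t x v]] unfolding nt fcoef_lscale[OF xM sx] by simp
  finally have "nab p (\<Phi> x) ?w = F (nab t x v)" .
  then show "pullback_connection M L \<Phi> F nab t x v = nab t x v"
    using flat_lift_inv_eq(1)[OF \<Phi> F fibreD(1)[OF nab_in[OF Uo t x v]]]
    by (simp add: pullback_connection_def p_def)
qed

end

section \<open>Transport of a smooth structure along a homeomorphism\<close>

definition tmfd :: "'a topology \<Rightarrow> ('a \<Rightarrow> 'b) \<Rightarrow> ('b \<Rightarrow> 'a) \<Rightarrow> ('b, 'e) mfd \<Rightarrow> ('a, 'e) mfd" where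
  "tmfd X f g B = \<lparr>mtop = X, atlas = tchart f g ` atlas B\<rparr>"

text \<open>Extensionality makes this an equality of charts and not only of coordinates on the
  domain.\<close>

lemma tchart_tchart:
  assumes "cmap \<kappa> \<in> extensional (cdom \<kappa>)"
    and "\<And>y. y \<in> cdom \<kappa> \<Longrightarrow> g' (g y) = y" "\<And>y. y \<in> cdom \<kappa> \<Longrightarrow> f' y = g y" "\<And>y. y \<in> cdom \<kappa> \<Longrightarrow> f (g y) = y"
  shows "tchart f' g' (tchart f g \<kappa>) = (\<kappa> :: ('a, 'e) chart)"
proof -
  have d: "g' ` g ` cdom \<kappa> = cdom \<kappa>" using assms(2) by (force simp: image_image)
  have "restrict (restrict (cmap \<kappa> \<circ> f) (g ` cdom \<kappa>) \<circ> f') (cdom \<kappa>) = cmap \<kappa>"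
  proof (rule extensionalityI[OF _ assms(1)])
    show "restrict (restrict (cmap \<kappa> \<circ> f) (g ` cdom \<kappa>) \<circ> f') (cdom \<kappa>) y = cmap \<kappa> y" if "y \<in> cdom \<kappa>" for y
      using that assms(3,4) by simp
  qed simp
  then show ?thesis by (simp add: tchart_def d)
qed

text \<open>Transported charts have the same transition maps on the same images.\<close>

lemma tchart_compatible:
  assumes h: "homeomorphic_maps X Y f g" and c: "chart_on d Y \<kappa>" "chart_on d Y \<kappa>'"
  shows "charts_compatible (tchart f g \<kappa>) (tchart f g \<kappa>') \<longleftrightarrow> charts_compatible \<kappa> \<kappa>'"
proof -
  have *: "smooth_on (cmap (tchart f g \<kappa>) ` (cdom (tchart f g \<kappa>) \<inter> cdom (tchart f g \<kappa>'))) (cmap (tchart f g \<kappa>') \<circ> cinv (tchart f g \<kappa>))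
      \<longleftrightarrow> smooth_on (cmap \<kappa> ` (cdom \<kappa> \<inter> cdom \<kappa>')) (cmap \<kappa>' \<circ> cinv \<kappa>)"
    if c: "chart_on d Y \<kappa>" "chart_on d Y \<kappa>'" for \<kappa> \<kappa>'
  proof -
    have dom: "cdom \<kappa> \<subseteq> topspace Y" "cdom \<kappa>' \<subseteq> topspace Y"
      using openin_subset[OF chart_on_openin[OF c(1)]] openin_subset[OF chart_on_openin[OF c(2)]] by auto
    have "cdom (tchart f g \<kappa>) \<inter> cdom (tchart f g \<kappa>') = g ` (cdom \<kappa> \<inter> cdom \<kappa>')"
    proof
      show "cdom (tchart f g \<kappa>) \<inter> cdom (tchart f g \<kappa>') \<subseteq> g ` (cdom \<kappa> \<inter> cdom \<kappa>')"
      proof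
        fix x assume "x \<in> cdom (tchart f g \<kappa>) \<inter> cdom (tchart f g \<kappa>')"
        then obtain y y' where y: "y \<in> cdom \<kappa>" "x = g y" "y' \<in> cdom \<kappa>'" "x = g y'" by auto
        then have "y = y'" using homeomorphic_mapsD(4)[OF h] dom by (metis subsetD)
        then show "x \<in> g ` (cdom \<kappa> \<inter> cdom \<kappa>')" using y by blast
      qed
    qed auto
    then have im: "cmap (tchart f g \<kappa>) ` (cdom (tchart f g \<kappa>) \<inter> cdom (tchart f g \<kappa>')) = cmap \<kappa> ` (cdom \<kappa> \<inter> cdom \<kappa>')"
      using tchart_image[OF h dom(1), of "cdom \<kappa> \<inter> cdom \<kappa>'"] by simp
    show ?thesis unfolding im
    proof (rule smooth_on_cong)
      fix p assume "p \<in> cmap \<kappa> ` (cdom \<kappa> \<inter> cdom \<kappa>')"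
      then obtain y where y: "y \<in> cdom \<kappa>" "y \<in> cdom \<kappa>'" "p = cmap \<kappa> y" by blast
      then show "(cmap (tchart f g \<kappa>') \<circ> cinv (tchart f g \<kappa>)) p = (cmap \<kappa>' \<circ> cinv \<kappa>) p"
        using tchart_cinv[OF h c(1), of p] cinv_cmap[OF c(1)] tchart_cmap[OF h dom(2) y(2)] by simp
    qed
  qed
  show ?thesis unfolding charts_compatible_def using *[OF c] *[OF c(2,1)] by (simp add: Int_commute)
qed

lemma tmfd_smooth_manifold:
  assumes h: "homeomorphic_maps X (mtop B) f g" and B: "smooth_manifold d B"
  shows "smooth_manifold d (tmfd X f g B)"
  unfolding smooth_manifold_def
proof (intro conjI ballI allI impI)
  have hs: "X homeomorphic_space mtop B" using h unfolding homeomorphic_space_def by blast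
  have "Hausdorff_space (mtop B)" "second_countable (mtop B)"
    using B unfolding smooth_manifold_def by blast+
  then show "Hausdorff_space (mtop (tmfd X f g B))" "second_countable (mtop (tmfd X f g B))"
    using homeomorphic_Hausdorff_space[OF hs] homeomorphic_space_second_countability[OF hs]
    by (simp_all add: tmfd_def)
  show "chart_on d (mtop (tmfd X f g B)) \<kappa>" if "\<kappa> \<in> atlas (tmfd X f g B)" for \<kappa>
    using that tchart_chart_on[OF h atlas_chart_on[OF B]] by (auto simp: tmfd_def)
  have compat: "charts_compatible \<kappa> \<kappa>'" if "\<kappa> \<in> atlas B" "\<kappa>' \<in> atlas B" for \<kappa> \<kappa>'
    unfolding charts_compatible_def using atlas_compatible[OF B that] atlas_compatible[OF B that(2,1)]
    by (simp add: Int_commute)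
  show "charts_compatible \<kappa> \<kappa>'" if "\<kappa> \<in> atlas (tmfd X f g B)" "\<kappa>' \<in> atlas (tmfd X f g B)" for \<kappa> \<kappa>'
    using that tchart_compatible[OF h atlas_chart_on[OF B] atlas_chart_on[OF B]] compat by (auto simp: tmfd_def)
  have cov: "pts B = (\<Union>\<kappa>\<in>atlas B. cdom \<kappa>)"
    using atlas_dom[OF B] atlas_covers[OF B] by (fastforce simp: charts_at_def)
  have "topspace X = g ` pts B"
    using homeomorphic_mapsD[OF h] by force
  then show "pts (tmfd X f g B) = (\<Union>\<kappa>\<in>atlas (tmfd X f g B). cdom \<kappa>)"
    by (simp add: tmfd_def cov image_UN)
  fix \<kappa> assume \<kappa>: "chart_on d (mtop (tmfd X f g B)) \<kappa> \<and> (\<forall>\<kappa>'\<in>atlas (tmfd X f g B). charts_compatible \<kappa> \<kappa>')"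
  then have c: "chart_on d X \<kappa>" by (simp add: tmfd_def)
  have h': "homeomorphic_maps (mtop B) X g f" using h homeomorphic_maps_sym by blast
  have dom: "cdom \<kappa> \<subseteq> topspace X" by (rule openin_subset[OF chart_on_openin[OF c]])
  define \<kappa>2 where "\<kappa>2 = tchart g f \<kappa>"
  have c2: "chart_on d (mtop B) \<kappa>2" unfolding \<kappa>2_def by (rule tchart_chart_on[OF h' c])
  have rev: "tchart f g \<kappa>2 = \<kappa>" unfolding \<kappa>2_def
    by (rule tchart_tchart) (use c homeomorphic_mapsD(3)[OF h] dom in \<open>auto simp: chart_on_def\<close>)
  have "charts_compatible \<kappa>2 \<kappa>'" if "\<kappa>' \<in> atlas B" for \<kappa>'
    using \<kappa> that tchart_compatible[OF h c2 atlas_chart_on[OF B that]] unfolding rev by (simp add: tmfd_def)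
  then have "\<kappa>2 \<in> atlas B" using B c2 unfolding smooth_manifold_def by blast
  then show "\<kappa> \<in> atlas (tmfd X f g B)" using rev by (auto simp: tmfd_def)
qed

text \<open>Both maps have the identity as representative in \<open>\<kappa>\<close> and its
  transported chart.\<close>

lemma
  assumes h: "homeomorphic_maps X (mtop B) f g" and B: "smooth_manifold d B"
  shows tmfd_smooth: "smooth_map_on (tmfd X f g B) (pts (tmfd X f g B)) B f"
    and tmfd_smooth_inv: "smooth_map_on B (pts B) (tmfd X f g B) g"
proof -
  note B' = tmfd_smooth_manifold[OF h B]
  have X: "pts (tmfd X f g B) = topspace X" "mtop (tmfd X f g B) = X" by (simp_all add: tmfd_def)
  show "smooth_map_on (tmfd X f g B) (pts (tmfd X f g B)) B f"
  proof (rule smooth_map_on_local[OF B' B])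
    fix x assume x: "x \<in> pts (tmfd X f g B)"
    then have "f x \<in> pts B" using homeomorphic_mapsD(1)[OF h] X by auto
    then obtain \<kappa> where \<kappa>: "\<kappa> \<in> charts_at B (f x)" using atlas_covers[OF B] by blast
    note \<kappa>' = charts_atD[OF \<kappa>]
    note c = atlas_chart_on[OF B \<kappa>'(1)]
    have dom: "cdom \<kappa> \<subseteq> pts B" by (rule atlas_dom[OF B \<kappa>'(1)])
    have k: "tchart f g \<kappa> \<in> atlas (tmfd X f g B)" using \<kappa>'(1) by (simp add: tmfd_def)
    have o: "openin (mtop (tmfd X f g B)) (g ` cdom \<kappa>)"
      using chart_on_openin[OF atlas_chart_on[OF B' k]] by simp
    have "smooth_fun_on (tmfd X f g B) (g ` cdom \<kappa>) (\<lambda>x. cmap \<kappa> (f x))"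
      by (rule smooth_fun_on_cong[OF B', THEN iffD1, OF _ smooth_fun_on_cmap[OF B' k, unfolded tchart_simps]])
        (auto simp: tchart_def)
    then have "smooth_map_on (tmfd X f g B) (g ` cdom \<kappa>) B f"
      by (rule smooth_map_onI_fun[OF B' B o _ \<kappa>'(1), rotated]) (use homeomorphic_mapsD(4)[OF h] dom in auto)
    moreover have "x \<in> g ` cdom \<kappa>" using homeomorphic_mapsD(3)[OF h] x X \<kappa>'(2) by (metis imageI)
    ultimately show "\<exists>V. openin (mtop (tmfd X f g B)) V \<and> x \<in> V \<and> smooth_map_on (tmfd X f g B) V B f"
      using o by blast
  qed simp
  show "smooth_map_on B (pts B) (tmfd X f g B) g"
  proof (rule smooth_map_on_local[OF B B'])
    fix y assume y: "y \<in> pts B"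
    then obtain \<kappa> where \<kappa>: "\<kappa> \<in> charts_at B y" using atlas_covers[OF B] by blast
    note \<kappa>' = charts_atD[OF \<kappa>]
    note c = atlas_chart_on[OF B \<kappa>'(1)]
    have dom: "cdom \<kappa> \<subseteq> pts B" by (rule atlas_dom[OF B \<kappa>'(1)])
    have k: "tchart f g \<kappa> \<in> atlas (tmfd X f g B)" using \<kappa>'(1) by (simp add: tmfd_def)
    have o: "openin (mtop B) (cdom \<kappa>)" by (rule chart_on_openin[OF c])
    have "smooth_fun_on B (cdom \<kappa>) (\<lambda>y. cmap (tchart f g \<kappa>) (g y))"
      by (rule smooth_fun_on_cong[OF B, THEN iffD1, OF _ smooth_fun_on_cmap[OF B \<kappa>'(1)]])
        (rule tchart_cmap[OF h dom, symmetric])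
    then have "smooth_map_on B (cdom \<kappa>) (tmfd X f g B) g"
      by (rule smooth_map_onI_fun[OF B B' o _ k, rotated]) simp
    then show "\<exists>V. openin (mtop B) V \<and> y \<in> V \<and> smooth_map_on B V (tmfd X f g B) g"
      using o \<kappa>'(2) by blast
  qed simp
qed

lemma tangent_map_left_inverse:
  assumes M: "smooth_manifold d M" and N: "smooth_manifold d' N"
    and f: "smooth_map_on M (pts M) N f" and g: "smooth_map_on N (pts N) M g"
    and gf: "\<And>x. x \<in> pts M \<Longrightarrow> g (f x) = x" and x: "x \<in> pts M" and v: "v \<in> tangent_space M x"
  shows "tangent_map N M g (f x) (tangent_map M N f x v) = v"
proof -
  have fx: "f x \<in> pts N" by (rule smooth_map_on_in_pts[OF f _ x]) simp
  have "tangent_map N M g (f x) (tangent_map M N f x v) = tangent_map M M (\<lambda>x. g (f x)) x v"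
    by (rule tangent_map_compose[OF M N M _ f x _ g fx v, symmetric]) auto
  also have "\<dots> = tangent_map M M (\<lambda>x. x) x v"
    by (rule tangent_map_cong[OF M M _ smooth_map_on_id[OF M] x _ v, symmetric]) (auto simp: gf)
  also have "\<dots> = v" by (rule tangent_map_id[OF M x v])
  finally show ?thesis .
qed

text \<open>Flatness on a leaf is tested against fields on the whole leaf, so fields have to be
  moved between a leaf and its pullback. In corresponding charts the components do not
  change.\<close>

lemma push_vector_field:
  assumes h: "homeomorphic_maps X (mtop B) f g" and B: "smooth_manifold d B"
    and Z: "Z \<in> vector_fields (tmfd X f g B) (topspace X)"
  shows "(\<lambda>y. tangent_map (tmfd X f g B) B f (g y) (Z (g y))) \<in> vector_fields B (pts B)"
  unfolding vector_fields_def
proof (intro CollectI conjI ballI)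
  let ?B = "tmfd X f g B"
  note B' = tmfd_smooth_manifold[OF h B]
  have X: "pts ?B = topspace X" "mtop ?B = X" by (simp_all add: tmfd_def)
  note fs = tmfd_smooth[OF h B]
  have gy: "g y \<in> pts ?B" if "y \<in> pts B" for y using homeomorphic_mapsD(2)[OF h that] X by simp
  have Zt: "Z x \<in> tangent_space ?B x" if "x \<in> pts ?B" for x using Z that X by (auto simp: vector_fields_def)
  show "tangent_map ?B B f (g y) (Z (g y)) \<in> tangent_space B y" if "y \<in> pts B" for y
    using tangent_map_in[OF B' B _ fs gy[OF that] Zt[OF gy[OF that]]] homeomorphic_mapsD(4)[OF h that] by simp
  fix \<kappa> assume \<kappa>: "\<kappa> \<in> atlas B"
  let ?\<kappa> = "tchart f g \<kappa>"
  note c = atlas_chart_on[OF B \<kappa>]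
  have dom: "cdom \<kappa> \<subseteq> pts B" by (rule atlas_dom[OF B \<kappa>])
  have k: "?\<kappa> \<in> atlas ?B" using \<kappa> by (simp add: tmfd_def)
  note c' = atlas_chart_on[OF B' k]
  have domX: "g ` cdom \<kappa> \<subseteq> topspace X" using homeomorphic_mapsD(2)[OF h] dom by blast
  have im: "cmap ?\<kappa> ` (topspace X \<inter> cdom ?\<kappa>) = cmap \<kappa> ` (pts B \<inter> cdom \<kappa>)"
    using tchart_image[OF h dom order_refl] dom domX by (simp add: inf_absorb2)
  have "smooth_on (cmap ?\<kappa> ` (topspace X \<inter> cdom ?\<kappa>)) (\<lambda>p. Z (cinv ?\<kappa> p) ?\<kappa>)"
    using Z k unfolding vector_fields_def by blast
  then have "smooth_on (cmap \<kappa> ` (pts B \<inter> cdom \<kappa>)) (\<lambda>p. Z (cinv ?\<kappa> p) ?\<kappa>)" unfolding im .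
  then show "smooth_on (cmap \<kappa> ` (pts B \<inter> cdom \<kappa>)) (\<lambda>p. tangent_map ?B B f (g (cinv \<kappa> p)) (Z (g (cinv \<kappa> p))) \<kappa>)"
  proof (rule smooth_on_cong[THEN iffD1, rotated])
    fix p assume "p \<in> cmap \<kappa> ` (pts B \<inter> cdom \<kappa>)"
    then obtain y where y: "y \<in> pts B" "y \<in> cdom \<kappa>" "p = cmap \<kappa> y" by blast
    have cy: "cinv \<kappa> p = y" using cinv_cmap[OF c y(2)] y(3) by simp
    have fy: "f (g y) = y" by (rule homeomorphic_mapsD(4)[OF h y(1)])
    have k1: "?\<kappa> \<in> charts_at ?B (g y)" using k y(2) by (simp add: charts_at_def)
    have k2: "\<kappa> \<in> charts_at B (f (g y))" using \<kappa> y(2) fy by (simp add: charts_at_def)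
    note v = Zt[OF gy[OF y(1)]]
    have "tangent_map ?B B f (g y) (Z (g y)) \<kappa> =
        dir_deriv (\<lambda>q. cmap \<kappa> (f (cinv ?\<kappa> q))) (cmap ?\<kappa> (g y)) (Z (g y) ?\<kappa>)"
      by (rule tangent_map_chart[OF B' B _ fs gy[OF y(1)] k1 k2 v]) simp
    also have "\<dots> = Z (g y) ?\<kappa>"
    proof (rule dir_deriv_id[OF chart_on_subspace[OF c'] chart_on_openin_image[OF c'] _ tangent_spaceD(1)[OF v k1]])
      show "cmap ?\<kappa> (g y) \<in> cmap ?\<kappa> ` cdom ?\<kappa>" using y(2) by simp
      fix q assume "q \<in> cmap ?\<kappa> ` cdom ?\<kappa>"
      then obtain z where z: "z \<in> cdom \<kappa>" "q = cmap \<kappa> z"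
        using tchart_image[OF h dom order_refl] by auto
      then show "cmap \<kappa> (f (cinv ?\<kappa> q)) = q"
        using tchart_cinv[OF h c, of q] cinv_cmap[OF c z(1)] homeomorphic_mapsD(4)[OF h, of z] dom by auto
    qed
    finally show "Z (cinv ?\<kappa> p) ?\<kappa> = tangent_map ?B B f (g (cinv \<kappa> p)) (Z (g (cinv \<kappa> p))) \<kappa>"
      using tchart_cinv[OF h c, of p] y cy by simp
  qed
qed

section \<open>Pulling back leaves\<close>

text \<open>The inverse is a separate parameter because applying \<open>inv_on\<close> twice returns
  \<open>\<Phi>\<close> only on \<open>pts M\<close>; with two maps the assumptions are symmetric
  and can be exchanged by \<open>swap\<close>.\<close>

locale diffeo_pair =
  fixes d and M :: "('a, 'e::euclidean_space) mfd" and \<Phi> \<Psi> :: "'a \<Rightarrow> 'a"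
  assumes M: "smooth_manifold d M" and \<Phi>: "diffeomorphism M M \<Phi>" and \<Psi>: "diffeomorphism M M \<Psi>"
    and \<Psi>\<Phi>: "x \<in> pts M \<Longrightarrow> \<Psi> (\<Phi> x) = x" and \<Phi>\<Psi>: "x \<in> pts M \<Longrightarrow> \<Phi> (\<Psi> x) = x"
begin

lemma swap: "diffeo_pair d M \<Psi> \<Phi>"
  by unfold_locales (rule M \<Phi> \<Psi> \<Psi>\<Phi> \<Phi>\<Psi>; assumption)+

lemma \<Phi>_in: "x \<in> pts M \<Longrightarrow> \<Phi> x \<in> pts M" and \<Psi>_in: "x \<in> pts M \<Longrightarrow> \<Psi> x \<in> pts M"
  using diffeo_in[OF \<Phi>] diffeo_in[OF \<Psi>] by auto

lemma inv_eq: "x \<in> pts M \<Longrightarrow> inv_on M \<Phi> x = \<Psi> x"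
  using diffeo_inv1[OF \<Phi> \<Psi>_in] \<Phi>\<Psi> by simp

definition leaf_top :: "('a, 'e) mfd \<Rightarrow> 'a topology" where
  "leaf_top B = pullback_topology (\<Psi> ` pts B) \<Phi> (mtop B)"

lemma pullback_leaf_eq:
  assumes "smooth_manifold d' B" "pts B \<subseteq> pts M"
  shows "pullback_leaf M \<Phi> B = tmfd (leaf_top B) \<Phi> \<Psi> B"
proof -
  have i: "inv_on M \<Phi> ` A = \<Psi> ` A" if "A \<subseteq> pts B" for A
    by (rule image_cong) (use that assms(2) inv_eq in auto)
  show ?thesis
    unfolding pullback_leaf_def tmfd_def leaf_top_def i[OF order_refl]
    by (rule arg_cong[of _ _ "mfd.make _", unfolded mfd.defs], rule image_cong)
      (simp_all add: tchart_def i[OF atlas_dom[OF assms(1)]])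
qed

lemma leaf_top_homeo:
  assumes "pts B \<subseteq> pts M"
  shows "homeomorphic_maps (leaf_top B) (mtop B) \<Phi> \<Psi>" and "topspace (leaf_top B) = \<Psi> ` pts B"
proof -
  have b: "\<Phi> (\<Psi> y) = y" if "y \<in> pts B" for y using \<Phi>\<Psi> assms that by blast
  show t: "topspace (leaf_top B) = \<Psi> ` pts B"
    using b by (auto simp: leaf_top_def topspace_pullback_topology)
  show "homeomorphic_maps (leaf_top B) (mtop B) \<Phi> \<Psi>"
    unfolding homeomorphic_maps_def
  proof (intro conjI ballI)
    show "continuous_map (leaf_top B) (mtop B) \<Phi>"
      unfolding continuous_map_def t
    proof (intro conjI allI impI)
      show "\<Phi> \<in> \<Psi> ` pts B \<rightarrow> pts B" using b by auto
      show "openin (leaf_top B) {x \<in> \<Psi> ` pts B. \<Phi> x \<in> U}" if "openin (mtop B) U" for U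
        unfolding leaf_top_def openin_pullback_topology using that by (intro exI[of _ U]) auto
    qed
    show "continuous_map (mtop B) (leaf_top B) \<Psi>"
      unfolding continuous_map_def t
    proof (intro conjI allI impI)
      fix U assume "openin (leaf_top B) U"
      then obtain V where V: "openin (mtop B) V" "U = \<Phi> -` V \<inter> \<Psi> ` pts B"
        unfolding leaf_top_def openin_pullback_topology by blast
      have "\<Psi> x \<in> U \<longleftrightarrow> x \<in> V" if "x \<in> pts B" for x using V(2) b[OF that] that by simp
      then have "{x \<in> pts B. \<Psi> x \<in> U} = V" using openin_subset[OF V(1)] by blast
      then show "openin (mtop B) {x \<in> pts B. \<Psi> x \<in> U}" using V(1) by simp
    qed auto
    show "\<Psi> (\<Phi> x) = x" if "x \<in> topspace (leaf_top B)" for x using that b t by auto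
    show "\<Phi> (\<Psi> y) = y" if "y \<in> pts B" for y by (rule b[OF that])
  qed
qed

lemma
  assumes B: "smooth_manifold d' B" and sub: "pts B \<subseteq> pts M"
  shows pullback_leaf_mfd: "smooth_manifold d' (pullback_leaf M \<Phi> B)"
    and pullback_leaf_pts: "pts (pullback_leaf M \<Phi> B) = \<Psi> ` pts B"
    and pullback_leaf_sub: "pts (pullback_leaf M \<Phi> B) \<subseteq> pts M"
    and pullback_leaf_smooth: "smooth_map_on (pullback_leaf M \<Phi> B) (pts (pullback_leaf M \<Phi> B)) B \<Phi>"
    and pullback_leaf_smooth_inv: "smooth_map_on B (pts B) (pullback_leaf M \<Phi> B) \<Psi>"
    and pullback_leaf_field: "Z \<in> vector_fields (pullback_leaf M \<Phi> B) (pts (pullback_leaf M \<Phi> B)) \<Longrightarrow>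
      (\<lambda>y. tangent_map (pullback_leaf M \<Phi> B) B \<Phi> (\<Psi> y) (Z (\<Psi> y))) \<in> vector_fields B (pts B)"
proof -
  note e = pullback_leaf_eq[OF B sub] and h = leaf_top_homeo[OF sub]
  show "smooth_manifold d' (pullback_leaf M \<Phi> B)"
    "smooth_map_on (pullback_leaf M \<Phi> B) (pts (pullback_leaf M \<Phi> B)) B \<Phi>"
    "smooth_map_on B (pts B) (pullback_leaf M \<Phi> B) \<Psi>"
    unfolding e by (rule tmfd_smooth_manifold[OF h(1) B] tmfd_smooth[OF h(1) B] tmfd_smooth_inv[OF h(1) B])+
  show p: "pts (pullback_leaf M \<Phi> B) = \<Psi> ` pts B" unfolding e by (simp add: tmfd_def h(2))
  then show "pts (pullback_leaf M \<Phi> B) \<subseteq> pts M" using \<Psi>_in sub by auto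
  show "Z \<in> vector_fields (pullback_leaf M \<Phi> B) (pts (pullback_leaf M \<Phi> B)) \<Longrightarrow>
      (\<lambda>y. tangent_map (pullback_leaf M \<Phi> B) B \<Phi> (\<Psi> y) (Z (\<Psi> y))) \<in> vector_fields B (pts B)"
    unfolding e by (rule push_vector_field[OF h(1) B]) (simp add: tmfd_def)
qed

text \<open>Needed as an equality of manifolds, topology and atlas included, because leaves
  themselves index the summands of \<open>Q_BS\<close>.\<close>

lemma pullback_leaf_back:
  assumes B: "smooth_manifold d' B" and sub: "pts B \<subseteq> pts M"
  shows "pullback_leaf M \<Psi> (pullback_leaf M \<Phi> B) = B"
proof -
  interpret s: diffeo_pair d M \<Psi> \<Phi> by (rule swap)
  let ?B = "pullback_leaf M \<Phi> B"
  note B' = pullback_leaf_mfd[OF B sub] and sub' = pullback_leaf_sub[OF B sub] and p = pullback_leaf_pts[OF B sub]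
  have im: "\<Phi> ` \<Psi> ` A = A" if "A \<subseteq> pts B" for A
    using that sub \<Phi>\<Psi> by (force simp: image_image)
  have "mtop (pullback_leaf M \<Psi> ?B) = mtop B"
    unfolding topology_eq
  proof
    fix U
    have "openin (mtop (pullback_leaf M \<Psi> ?B)) U \<longleftrightarrow> (\<exists>V. openin (mtop ?B) V \<and> U = \<Psi> -` V \<inter> pts B)"
      unfolding s.pullback_leaf_eq[OF B' sub'] by (simp add: tmfd_def s.leaf_top_def openin_pullback_topology p im)
    also have "\<dots> \<longleftrightarrow> (\<exists>W. openin (mtop B) W \<and> U = \<Psi> -` (\<Phi> -` W \<inter> \<Psi> ` pts B) \<inter> pts B)"
      unfolding pullback_leaf_eq[OF B sub] by (auto simp: tmfd_def leaf_top_def openin_pullback_topology)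
    also have "\<dots> \<longleftrightarrow> openin (mtop B) U"
    proof -
      have "\<Psi> -` (\<Phi> -` W \<inter> \<Psi> ` pts B) \<inter> pts B = W" if W: "openin (mtop B) W" for W
      proof -
        have "x \<in> \<Psi> -` (\<Phi> -` W \<inter> \<Psi> ` pts B) \<longleftrightarrow> x \<in> W" if "x \<in> pts B" for x
          using \<Phi>\<Psi>[of x] that sub by auto
        then show ?thesis using openin_subset[OF W] by blast
      qed
      then show ?thesis by metis
    qed
    finally show "openin (mtop (pullback_leaf M \<Psi> ?B)) U \<longleftrightarrow> openin (mtop B) U" .
  qed
  moreover have "atlas (pullback_leaf M \<Psi> ?B) = atlas B"
  proof -
    have "tchart \<Psi> \<Phi> (tchart \<Phi> \<Psi> \<kappa>) = \<kappa>" if "\<kappa> \<in> atlas B" for \<kappa>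
      by (rule tchart_tchart)
        (use atlas_chart_on[OF B that] atlas_dom[OF B that] sub \<Phi>\<Psi> in \<open>auto simp: chart_on_def\<close>)
    then have "(\<lambda>\<kappa>. tchart \<Psi> \<Phi> (tchart \<Phi> \<Psi> \<kappa>)) ` atlas B = atlas B" by (auto simp: image_iff)
    then show ?thesis
      unfolding s.pullback_leaf_eq[OF B' sub'] unfolding pullback_leaf_eq[OF B sub] by (simp add: tmfd_def image_image)
  qed
  ultimately show ?thesis by simp
qed

lemma tangent_\<Psi>\<Phi>:
  "x \<in> pts M \<Longrightarrow> v \<in> tangent_space M x \<Longrightarrow> tangent_map M M \<Psi> (\<Phi> x) (tangent_map M M \<Phi> x v) = v"
  by (rule tangent_map_left_inverse[OF M M diffeo_smooth[OF \<Phi>] diffeo_smooth[OF \<Psi>] \<Psi>\<Phi>])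

lemma pullback_distr_eq:
  assumes x: "x \<in> pts M" and P: "P (\<Phi> x) \<subseteq> tangent_space M (\<Phi> x)"
  shows "pullback_distr M \<Phi> P x = tangent_map M M \<Psi> (\<Phi> x) ` P (\<Phi> x)"
  unfolding pullback_distr_def
  by (rule image_cong[OF refl], rule tangent_map_cong[OF M M _ diffeo_smooth_inv[OF \<Phi>] \<Phi>_in[OF x]])
    (use P inv_eq in auto)

lemma pullback_distr_sub:
  assumes x: "x \<in> pts M" and P: "\<And>x. x \<in> pts M \<Longrightarrow> P x \<subseteq> tangent_space M x"
  shows "pullback_distr M \<Phi> P x \<subseteq> tangent_space M x"
  unfolding pullback_distr_eq[where P = P, OF x P[OF \<Phi>_in[OF x]]]
  using tangent_map_in[OF M M _ diffeo_smooth[OF \<Psi>] \<Phi>_in[OF x]] P[OF \<Phi>_in[OF x]] \<Psi>\<Phi>[OF x] by auto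

lemma pullback_distr_back:
  assumes x: "x \<in> pts M" and P: "\<And>x. x \<in> pts M \<Longrightarrow> P x \<subseteq> tangent_space M x"
  shows "pullback_distr M \<Psi> (pullback_distr M \<Phi> P) x = P x"
proof -
  interpret s: diffeo_pair d M \<Psi> \<Phi> by (rule swap)
  have y: "\<Psi> x \<in> pts M" by (rule \<Psi>_in[OF x])
  have "pullback_distr M \<Psi> (pullback_distr M \<Phi> P) x = tangent_map M M \<Phi> (\<Psi> x) ` (tangent_map M M \<Psi> x ` P x)"
    using s.pullback_distr_eq[where P = "pullback_distr M \<Phi> P", OF x pullback_distr_sub[where P = P, OF y P]]
      pullback_distr_eq[where P = P, OF y P[OF \<Phi>_in[OF y]]] \<Phi>\<Psi>[OF x] by simp
  also have "\<dots> = P x"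
    using s.tangent_\<Psi>\<Phi>[OF x] P[OF x] by (force simp: image_image)
  finally show ?thesis .
qed

text \<open>The inclusion of the pulled back leaf factors as \<open>\<Phi>\<close>, then the
  inclusion of \<open>B\<close>, then \<open>\<Psi>\<close>; the chain rule does the rest.\<close>

lemma pullback_leaf_inclusion:
  assumes B: "smooth_manifold d' B" and sub: "pts B \<subseteq> pts M" and inc: "smooth_map_on B (pts B) M (\<lambda>x. x)"
  shows "smooth_map_on (pullback_leaf M \<Phi> B) (pts (pullback_leaf M \<Phi> B)) M (\<lambda>x. x)"
    and "y \<in> pts (pullback_leaf M \<Phi> B) \<Longrightarrow> v \<in> tangent_space (pullback_leaf M \<Phi> B) y \<Longrightarrow>
      tangent_map (pullback_leaf M \<Phi> B) M (\<lambda>x. x) y v =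
      tangent_map M M \<Psi> (\<Phi> y) (tangent_map B M (\<lambda>x. x) (\<Phi> y) (tangent_map (pullback_leaf M \<Phi> B) B \<Phi> y v))"
proof -
  let ?B = "pullback_leaf M \<Phi> B"
  note B' = pullback_leaf_mfd[OF B sub] and sub' = pullback_leaf_sub[OF B sub] and fs = pullback_leaf_smooth[OF B sub]
  have o: "openin (mtop ?B) (pts ?B)" "openin (mtop B) (pts B)" "openin (mtop M) (pts M)" by simp_all
  have fi: "\<Phi> ` pts ?B \<subseteq> pts B"
    using smooth_map_on_in_pts[OF fs o(1)] by blast
  have fM: "smooth_map_on ?B (pts ?B) M \<Phi>"
    using smooth_map_on_compose[OF B' B M o(1,2) fs fi inc] .
  have c: "smooth_map_on ?B (pts ?B) M (\<lambda>y. \<Psi> (\<Phi> y))"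
    by (rule smooth_map_on_compose[OF B' M M o(1,3) fM _ diffeo_smooth[OF \<Psi>]]) (use fi sub in auto)
  show "smooth_map_on ?B (pts ?B) M (\<lambda>x. x)"
    by (rule smooth_map_on_cong[OF B' o(1) _ c]) (use \<Psi>\<Phi> sub' in auto)
  assume y: "y \<in> pts ?B" and v: "v \<in> tangent_space ?B y"
  have fy: "\<Phi> y \<in> pts B" using fi y by blast
  have "tangent_map ?B M (\<lambda>x. x) y v = tangent_map ?B M (\<lambda>y. \<Psi> (\<Phi> y)) y v"
    by (rule tangent_map_cong[OF B' M o(1) c y _ v, symmetric]) (use \<Psi>\<Phi> sub' in auto)
  also have "\<dots> = tangent_map M M \<Psi> (\<Phi> y) (tangent_map ?B M \<Phi> y v)"
    by (rule tangent_map_compose[OF B' M M o(1) fM y o(3) diffeo_smooth[OF \<Psi>] _ v]) (use fy sub in auto)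
  also have "tangent_map ?B M \<Phi> y v = tangent_map B M (\<lambda>x. x) (\<Phi> y) (tangent_map ?B B \<Phi> y v)"
    using tangent_map_compose[OF B' B M o(1) fs y o(2) inc fy v] .
  finally show "tangent_map ?B M (\<lambda>x. x) y v =
      tangent_map M M \<Psi> (\<Phi> y) (tangent_map B M (\<lambda>x. x) (\<Phi> y) (tangent_map ?B B \<Phi> y v))" .
qed

lemma integral_manifoldD:
  assumes "integral_manifold M P B"
  shows "\<exists>d. smooth_manifold d B" "pts B \<subseteq> pts M" "smooth_map_on B (pts B) M (\<lambda>x. x)"
  using assms by (auto simp: integral_manifold_def)

text \<open>In the factorization of the inclusion, the tangent map of \<open>\<Phi>\<close> is a
  bijection onto the tangent space of \<open>B\<close>, the inclusion of \<open>B\<close> is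
  injective with image \<open>P\<close>, and the tangent map of \<open>\<Psi>\<close> is injective
  on \<open>P\<close>. Injectivity and image of the composition follow.\<close>

lemma pullback_leaf_integral:
  assumes I: "integral_manifold M P B" and P: "\<And>x. x \<in> pts M \<Longrightarrow> P x \<subseteq> tangent_space M x"
  shows "integral_manifold M (pullback_distr M \<Phi> P) (pullback_leaf M \<Phi> B)"
proof -
  let ?B = "pullback_leaf M \<Phi> B"
  obtain d' where B: "smooth_manifold d' B" using integral_manifoldD(1)[OF I] by blast
  note sub = integral_manifoldD(2)[OF I] and inc = integral_manifoldD(3)[OF I]
  note B' = pullback_leaf_mfd[OF B sub] and sub' = pullback_leaf_sub[OF B sub] and p = pullback_leaf_pts[OF B sub]
  note fs = pullback_leaf_smooth[OF B sub] and gs = pullback_leaf_smooth_inv[OF B sub]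
  note inc' = pullback_leaf_inclusion[OF B sub inc]
  have o: "openin (mtop ?B) (pts ?B)" "openin (mtop B) (pts B)" "openin (mtop M) (pts M)" by simp_all
  have "mtop ?B homeomorphic_space mtop B"
    using leaf_top_homeo(1)[OF sub] unfolding pullback_leaf_eq[OF B sub] homeomorphic_space_def by (auto simp: tmfd_def)
  then have con: "connected_space (mtop ?B)" using homeomorphic_connected_space I by (auto simp: integral_manifold_def)
  have tan: "inj_on (tangent_map ?B M (\<lambda>x. x) y) (tangent_space ?B y) \<and>
      tangent_map ?B M (\<lambda>x. x) y ` tangent_space ?B y = pullback_distr M \<Phi> P y" if y: "y \<in> pts ?B" for y
  proof -
    let ?x = "\<Phi> y"
    have yM: "y \<in> pts M" using y sub' by blast
    have x: "?x \<in> pts B" using smooth_map_on_in_pts[OF fs o(1) y] .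
    then have xM: "?x \<in> pts M" using sub by blast
    have \<Psi>x: "\<Psi> ?x = y" by (rule \<Psi>\<Phi>[OF yM])
    have I': "inj_on (tangent_map B M (\<lambda>x. x) ?x) (tangent_space B ?x)"
      "tangent_map B M (\<lambda>x. x) ?x ` tangent_space B ?x = P ?x"
      using I x by (auto simp: integral_manifold_def)
    let ?f = "tangent_map ?B B \<Phi> y"
    have f1: "?f ` tangent_space ?B y = tangent_space B ?x"
    proof
      show "?f ` tangent_space ?B y \<subseteq> tangent_space B ?x" using tangent_map_in[OF B' B o(1) fs y] by blast
      show "tangent_space B ?x \<subseteq> ?f ` tangent_space ?B y"
      proof
        fix w assume w: "w \<in> tangent_space B ?x"
        have "tangent_map ?B B \<Phi> (\<Psi> ?x) (tangent_map B ?B \<Psi> ?x w) = w"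
          by (rule tangent_map_left_inverse[OF B B' gs fs _ x w]) (use \<Phi>\<Psi> sub in auto)
        moreover have "tangent_map B ?B \<Psi> ?x w \<in> tangent_space ?B y"
          using tangent_map_in[OF B B' o(2) gs x w] \<Psi>x by simp
        ultimately show "w \<in> ?f ` tangent_space ?B y" using \<Psi>x by force
      qed
    qed
    have f2: "inj_on ?f (tangent_space ?B y)"
      by (rule inj_on_inverseI[of _ "tangent_map B ?B \<Psi> ?x"], rule tangent_map_left_inverse[OF B' B fs gs _ y])
        (use \<Psi>\<Phi> sub' in auto)
    have g2: "inj_on (tangent_map M M \<Psi> ?x) (P ?x)"
    proof -
      interpret s: diffeo_pair d M \<Psi> \<Phi> by (rule swap)
      show ?thesis
        by (rule inj_on_inverseI[of _ "tangent_map M M \<Phi> (\<Psi> ?x)"], rule s.tangent_\<Psi>\<Phi>[OF xM]) (use P[OF xM] in blast)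
    qed
    have eq: "tangent_map ?B M (\<lambda>x. x) y v = (tangent_map M M \<Psi> ?x \<circ> (tangent_map B M (\<lambda>x. x) ?x \<circ> ?f)) v"
      if "v \<in> tangent_space ?B y" for v using inc'(2)[OF y that] by simp
    have "inj_on (tangent_map M M \<Psi> ?x \<circ> (tangent_map B M (\<lambda>x. x) ?x \<circ> ?f)) (tangent_space ?B y)"
    proof (rule comp_inj_on[OF comp_inj_on[OF f2]])
      show "inj_on (tangent_map M M \<Psi> ?x) ((tangent_map B M (\<lambda>x. x) ?x \<circ> ?f) ` tangent_space ?B y)"
        unfolding image_comp[symmetric] f1 I'(2) by (rule g2)
    qed (use f1 I'(1) in simp)
    then have "inj_on (tangent_map ?B M (\<lambda>x. x) y) (tangent_space ?B y)"
      by (rule inj_on_cong[THEN iffD2, rotated]) (rule eq)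
    moreover have "tangent_map ?B M (\<lambda>x. x) y ` tangent_space ?B y = tangent_map M M \<Psi> ?x ` P ?x"
    proof -
      have "tangent_map ?B M (\<lambda>x. x) y ` tangent_space ?B y =
          (tangent_map M M \<Psi> ?x \<circ> (tangent_map B M (\<lambda>x. x) ?x \<circ> ?f)) ` tangent_space ?B y"
        by (rule image_cong[OF refl eq])
      then show ?thesis unfolding image_comp[symmetric] f1 I'(2) .
    qed
    ultimately show ?thesis using pullback_distr_eq[where P = P, OF yM P[OF xM]] by simp
  qed
  show ?thesis
    unfolding integral_manifold_def
    using B' con p I sub' inc'(1) tan by (auto simp: integral_manifold_def)
qed

lemma integral_manifold_cong:
  assumes "integral_manifold M P B" "\<And>x. x \<in> pts M \<Longrightarrow> P x = P' x"
  shows "integral_manifold M P' B"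
  using assms unfolding integral_manifold_def by (metis subsetD)

text \<open>Integral manifolds see a distribution only at points of \<open>M\<close>; pulling
  \<open>P\<close> back twice is known to return \<open>P\<close> just there.\<close>

lemma leaves_cong:
  assumes "\<And>x. x \<in> pts M \<Longrightarrow> P x = P' x"
  shows "leaves M P = leaves M P'"
proof -
  have "integral_manifold M P B \<longleftrightarrow> integral_manifold M P' B" for B
    using integral_manifold_cong[of P B P'] integral_manifold_cong[of P' B P] assms by auto
  then show ?thesis by (simp add: leaves_def)
qed

lemma pullback_leaf_leaves:
  assumes B: "B \<in> leaves M P" and P: "\<And>x. x \<in> pts M \<Longrightarrow> P x \<subseteq> tangent_space M x"
  shows "pullback_leaf M \<Phi> B \<in> leaves M (pullback_distr M \<Phi> P)"
  unfolding leaves_def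
proof (intro CollectI conjI allI impI)
  interpret s: diffeo_pair d M \<Psi> \<Phi> by (rule swap)
  let ?B = "pullback_leaf M \<Phi> B" and ?P = "pullback_distr M \<Phi> P"
  have I: "integral_manifold M P B" using B by (simp add: leaves_def)
  obtain d' where Bm: "smooth_manifold d' B" using integral_manifoldD(1)[OF I] by blast
  note sub = integral_manifoldD(2)[OF I]
  note p = pullback_leaf_pts[OF Bm sub]
  show "integral_manifold M ?P ?B" by (rule pullback_leaf_integral[OF I P])
  fix C assume C: "integral_manifold M ?P C \<and> pts ?B \<subseteq> pts C"
  then have IC: "integral_manifold M ?P C" by simp
  obtain d'' where Cm: "smooth_manifold d'' C" using integral_manifoldD(1)[OF IC] by blast
  note subC = integral_manifoldD(2)[OF IC]
  \<comment> \<open>A competitor \<open>C\<close> is pulled back along \<open>\<Psi>\<close> to an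
    integral manifold of \<open>P\<close> that contains \<open>B\<close>, where the maximality of
    \<open>B\<close> applies.\<close>
  let ?C = "pullback_leaf M \<Psi> C"
  note pC = s.pullback_leaf_pts[OF Cm subC]
  have "integral_manifold M (pullback_distr M \<Psi> ?P) ?C"
    by (rule s.pullback_leaf_integral[OF IC]) (rule pullback_distr_sub[where P = P, OF _ P])
  then have "integral_manifold M P ?C"
    by (rule integral_manifold_cong) (rule pullback_distr_back[where P = P, OF _ P])
  moreover have "pts B \<subseteq> pts ?C"
  proof
    fix x assume x: "x \<in> pts B"
    then have "\<Psi> x \<in> pts C" using C p by blast
    then have "\<Phi> (\<Psi> x) \<in> pts ?C" unfolding pC by blast
    then show "x \<in> pts ?C" using \<Phi>\<Psi> sub x by auto
  qed
  ultimately have eq: "pts ?C = pts B" using B by (simp add: leaves_def)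
  show "pts C = pts ?B"
  proof
    show "pts C \<subseteq> pts ?B"
    proof
      fix x assume x: "x \<in> pts C"
      then have "\<Phi> x \<in> pts B" using eq pC by blast
      then have "\<Psi> (\<Phi> x) \<in> pts ?B" unfolding p by blast
      then show "x \<in> pts ?B" using \<Psi>\<Phi> subC x by auto
    qed
  qed (use C in simp)
qed

end

section \<open>Transport of flat sections\<close>

text \<open>\<open>leaf_connection\<close> computes with a frame picked by \<open>SOME\<close>. The
  gauge rule, restricted to the leaf by the chain rule for the inclusion, shows that an arbitrary
  frame \<open>e\<close> gives the same value.\<close>

lemma (in prequantum) leaf_connection_eq:
  assumes B: "smooth_manifold d' B" and inc: "smooth_map_on B (pts B) M (\<lambda>x. x)"
    and s: "s \<in> sections B L (pts B)" and x: "x \<in> pts B" and v: "v \<in> tangent_space B x"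
    and U: "openin (mtop M) U" and e: "e \<in> frames M L U" and xU: "x \<in> U"
  shows "leaf_connection M L nab B s x v = lscale L (tderiv B (\<lambda>y. fcoef L (e y) (s y)) x v +
      fcoef L (e x) (s x) * conn_form e x (tangent_map B M (\<lambda>x. x) x v)) (e x)"
proof -
  let ?w = "tangent_map B M (\<lambda>x. x) x v"
  define t where "t = (SOME t. \<exists>U. openin (mtop M) U \<and> x \<in> U \<and> t \<in> frames M L U)"
  have xM: "x \<in> pts M" by (rule openin_in_pts[OF U xU])
  have "\<exists>t U. openin (mtop M) U \<and> x \<in> U \<and> t \<in> frames M L U" using local_frame[OF xM] by metis
  then have "\<exists>U. openin (mtop M) U \<and> x \<in> U \<and> t \<in> frames M L U" unfolding t_def by (rule someI_ex)
  then obtain U' where U': "openin (mtop M) U'" "x \<in> U'" "t \<in> frames M L U'" by blast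
  define V where "V = U \<inter> U'"
  have V: "openin (mtop M) V" "x \<in> V" using U U' xU by (auto simp: V_def)
  have e: "e \<in> frames M L V" and t: "t \<in> frames M L V"
    using frames_subset[OF e] frames_subset[OF U'(3)] by (auto simp: V_def)
  define O' where "O' = pts B \<inter> (\<lambda>x. x) -` V"
  have O: "openin (mtop B) O'" unfolding O'_def by (rule smooth_map_on_vimage[OF inc _ V(1)]) simp
  have xO: "x \<in> O'" using x V by (simp add: O'_def)
  have OV: "(\<lambda>x. x) ` O' \<subseteq> V" and OB: "O' \<subseteq> pts B" by (auto simp: O'_def)
  note incO = smooth_map_on_subset[OF inc OB]
  note sO = sections_subset[OF s OB]
  define f where "f y = fcoef L (t y) (s y)" for y
  define h where "h y = fcoef L (e y) (s y)" for y
  define g where "g y = fcoef L (e y) (t y)" for y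
  have fs: "smooth_fun_on B O' f" unfolding f_def
    by (rule fcoef_smooth[OF B O V(1) t incO OV]) (use sectionsD[OF sO] in auto)
  have gs: "smooth_fun_on M V g" unfolding g_def by (rule fcoef_section_smooth[OF V(1) e framesD(1)[OF t]])
  have gB: "smooth_fun_on B O' g" by (rule smooth_fun_on_compose[OF B M O incO OV gs])
  have hfg: "h y = f y * g y" if "y \<in> O'" for y
  proof -
    have y: "y \<in> V" using that by (simp add: O'_def)
    show ?thesis unfolding h_def f_def g_def
      using fcoef_trans(1)[OF openin_in_pts[OF V(1) y] framesD(2,3)[OF e y] framesD(2,3)[OF t y] sectionsD(2)[OF sO that]]
      by (simp add: mult.commute)
  qed
  have w: "?w \<in> tangent_space M x" by (rule tangent_map_in[OF B M O incO xO v])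
  have "tderiv B h x v = tderiv B (\<lambda>y. f y * g y) x v"
    by (rule tderiv_cong[OF B O smooth_fun_on_mult[OF fs gB] xO _ v, symmetric]) (simp add: hfg)
  also have "\<dots> = f x * tderiv B g x v + tderiv B f x v * g x" by (rule tderiv_mult[OF B O fs gB xO v])
  also have "tderiv B g x v = tderiv M g x ?w"
    by (rule tderiv_compose[OF B M O incO xO V(1) gs V(2) v])
  also have "tderiv M g x ?w = conn_form t x ?w * g x - g x * conn_form e x ?w"
    using conn_form_change[OF V(1) e t V(2) w] by (simp add: g_def[abs_def])
  finally have key: "(tderiv B f x v + f x * conn_form t x ?w) * g x = tderiv B h x v + h x * conn_form e x ?w"
    using hfg[OF xO] by (simp add: algebra_simps)
  have tx: "t x = lscale L (g x) (e x)"
    unfolding g_def by (rule fcoef_scale[OF xM framesD(2,3)[OF e V(2)] framesD(2)[OF t V(2)], symmetric])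
  have "leaf_connection M L nab B s x v = ladd L (lscale L (tderiv B f x v) (t x)) (lscale L (f x) (nab t x ?w))"
    unfolding leaf_connection_def t_def[symmetric] Let_def f_def[abs_def] fcoef_def ..
  also have "\<dots> = lscale L (tderiv B f x v + f x * conn_form t x ?w) (t x)"
    unfolding nab_frame[OF V(1) t V(2) w] lscale_lscale[OF xM framesD(2)[OF t V(2)]] lscale_add[OF xM framesD(2)[OF t V(2)]] ..
  also have "\<dots> = lscale L (tderiv B h x v + h x * conn_form e x ?w) (e x)"
    unfolding tx lscale_lscale[OF xM framesD(2)[OF e V(2)]] key ..
  finally show ?thesis by (simp add: h_def[abs_def])
qed

text \<open>The assumptions are symmetric in \<open>(\<Phi>, F, P)\<close> and \<open>(\<Psi>, G, \<Phi>\<^sup>*P)\<close> (lemma \<open>reversed\<close>), so each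
  statement about transport along \<open>\<Phi>\<close> also applies to the inverse transport.\<close>

locale flat_lift_pair = prequantum d M L nab \<omega> + diffeo_pair d M \<Phi> \<Psi>
  for d and M :: "('a, 'e::euclidean_space) mfd" and L :: "('a, 'l, 'e) line_bundle" and nab \<omega> \<Phi> \<Psi> +
  fixes F G :: "'l \<Rightarrow> 'l" and P :: "('a, 'e) distr"
  assumes F: "locally_flat_lift \<Phi> F" and G: "locally_flat_lift \<Psi> G"
    and GF: "l \<in> pts (ltotal L) \<Longrightarrow> G (F l) = l" and FG: "l \<in> pts (ltotal L) \<Longrightarrow> F (G l) = l"
    and P: "x \<in> pts M \<Longrightarrow> P x \<subseteq> tangent_space M x"
begin

section \<open>Transport of a single leaf and its flat sections\<close>

lemma inv_F: "l \<in> pts (ltotal L) \<Longrightarrow> inv_on (ltotal L) F l = G l"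
  using flat_lift_inv_eq(1)[OF \<Phi> F] FG flat_lift_bij_total[OF \<Psi> G] bij_betwE by metis

lemma G_in: "x \<in> pts M \<Longrightarrow> l \<in> fibre L x \<Longrightarrow> G l \<in> fibre L (\<Psi> x)"
  by (rule flat_lift_in[OF \<Psi> G])

abbreviation "P' \<equiv> pullback_distr M \<Phi> P"
abbreviation "pl \<equiv> pullback_leaf M \<Phi>"
abbreviation "ps \<equiv> pullback_section M L \<Phi> F"

lemma reversed: "flat_lift_pair d M L nab \<omega> \<Psi> \<Phi> G F P'"
proof -
  interpret s: diffeo_pair d M \<Psi> \<Phi> by (rule swap)
  show ?thesis
    by unfold_locales (rule F G GF FG pullback_distr_sub[where P = P, OF _ P]; assumption)+
qed

lemma leafD:
  assumes "B \<in> leaves M P"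
  obtains d' where "smooth_manifold d' B" "pts B \<subseteq> pts M" "smooth_map_on B (pts B) M (\<lambda>x. x)"
  using assms integral_manifoldD[of P B] by (auto simp: leaves_def)

lemma ps_eq:
  assumes "B \<in> leaves M P" "y \<in> pts (pl B)" "s (\<Phi> y) \<in> pts (ltotal L)"
  shows "ps B s y = G (s (\<Phi> y))"
  using assms inv_F by (simp add: pullback_section_def)

lemma pl_pts:
  assumes "B \<in> leaves M P"
  shows "y \<in> pts (pl B) \<Longrightarrow> \<Phi> y \<in> pts B" "x \<in> pts B \<Longrightarrow> \<Psi> x \<in> pts (pl B)"
    "x \<in> pts B \<Longrightarrow> x \<in> pts M" "y \<in> pts (pl B) \<Longrightarrow> y \<in> pts M"
proof -
  obtain d' where B: "smooth_manifold d' B" "pts B \<subseteq> pts M" using leafD[OF assms] by metis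
  show "y \<in> pts (pl B) \<Longrightarrow> \<Phi> y \<in> pts B" "x \<in> pts B \<Longrightarrow> \<Psi> x \<in> pts (pl B)"
    "x \<in> pts B \<Longrightarrow> x \<in> pts M" "y \<in> pts (pl B) \<Longrightarrow> y \<in> pts M"
    using pullback_leaf_pts[OF B] pullback_leaf_sub[OF B] B(2) \<Phi>\<Psi> by auto
qed

lemma H0D:
  assumes "s \<in> H0 M L nab B"
  shows "s \<in> sections B L (pts B)" "s \<in> extensional (pts B)" "x \<in> pts B \<Longrightarrow> s x \<in> fibre L x"
    "X \<in> vector_fields B (pts B) \<Longrightarrow> x \<in> pts B \<Longrightarrow> leaf_connection M L nab B s x (X x) = lzero L x"
  using assms by (auto simp: flat_sections_def sections_def)

text \<open>In frames \<open>e\<close> and \<open>e'\<close> matched by \<open>G\<close>, the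
  transported section has the coefficient of \<open>s\<close> composed with \<open>\<Phi>\<close>,
  and the connection forms correspond. So its leaf derivative along \<open>Z\<close> has the same
  coefficient as that of \<open>s\<close> along the pushed forward vector, which is 0.\<close>

lemma ps_H0:
  assumes B: "B \<in> leaves M P" and s: "s \<in> H0 M L nab B"
  shows "ps B s \<in> H0 M L nab (pl B)"
proof -
  obtain d' where Bm: "smooth_manifold d' B" and sub: "pts B \<subseteq> pts M" and inc: "smooth_map_on B (pts B) M (\<lambda>x. x)"
    using leafD[OF B] by metis
  let ?B = "pl B"
  note B' = pullback_leaf_mfd[OF Bm sub] and sub' = pullback_leaf_sub[OF Bm sub]
  note fs = pullback_leaf_smooth[OF Bm sub] and inc' = pullback_leaf_inclusion[OF Bm sub inc]
  note p = pl_pts[OF B]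
  have o: "openin (mtop ?B) (pts ?B)" "openin (mtop B) (pts B)" by simp_all
  have val: "ps B s y = G (s (\<Phi> y))" if "y \<in> pts ?B" for y
    by (rule ps_eq[where s = s, OF B that fibreD(1)[OF H0D(3)[OF s p(1)[OF that]]]])
  have val_in: "ps B s y \<in> fibre L y" if "y \<in> pts ?B" for y
    using G_in[OF p(3) H0D(3)[OF s]] val[OF that] p(1)[OF that] \<Psi>\<Phi>[OF p(4)[OF that]] by metis
  have im: "\<Phi> ` pts ?B \<subseteq> pts B" using p(1) by blast
  have sm1: "smooth_map_on ?B (pts ?B) (ltotal L) (\<lambda>y. s (\<Phi> y))"
    by (rule smooth_map_on_compose[OF B' Bm total_mfd o fs im sectionsD(1)[OF H0D(1)[OF s]]])
  have "smooth_map_on ?B (pts ?B) (ltotal L) (\<lambda>y. G (s (\<Phi> y)))"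
    by (rule smooth_map_on_compose[OF B' total_mfd total_mfd o(1) _ sm1 _ flat_lift_smooth[OF \<Psi> G]])
      (use fibreD(1)[OF H0D(3)[OF s p(1)]] in auto)
  then have "smooth_map_on ?B (pts ?B) (ltotal L) (ps B s)"
    by (rule smooth_map_on_cong[OF B' o(1), rotated]) (simp add: val)
  then have sec: "ps B s \<in> sections ?B L (pts ?B)" using val_in by (simp add: sections_def)
  have flat: "leaf_connection M L nab ?B (ps B s) y (Z y) = lzero L y"
    if Z: "Z \<in> vector_fields ?B (pts ?B)" and y: "y \<in> pts ?B" for Z y
  proof -
    let ?x = "\<Phi> y" and ?v = "Z y"
    note yM = p(4)[OF y] and xB = p(1)[OF y]
    note xM = p(3)[OF xB]
    have \<Psi>x: "\<Psi> ?x = y" by (rule \<Psi>\<Phi>[OF yM])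
    have v: "?v \<in> tangent_space ?B y" using Z y by (auto simp: vector_fields_def)
    let ?u = "tangent_map ?B B \<Phi> y ?v"
    have u: "?u \<in> tangent_space B ?x" by (rule tangent_map_in[OF B' Bm o(1) fs y v])
    let ?w = "tangent_map B M (\<lambda>x. x) ?x ?u"
    have w: "?w \<in> tangent_space M ?x" by (rule tangent_map_in[OF Bm M o(2) inc xB u])
    obtain U e e' where xU: "?x \<in> U" and m: "matched \<Psi> U e e'"
      and eq: "\<And>l. l \<in> pts (ltotal L) \<Longrightarrow> lproj L l \<in> U \<Longrightarrow> G l = frame_lift \<Psi> e e' l"
      using locally_flat_liftE[OF G xM] by blast
    note e = matchedD[OF m]
    note V = diffeo_image_openin[OF \<Psi> e(1)]
    have yV: "y \<in> \<Psi> ` U" using xU \<Psi>x by force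
    define f where "f x = fcoef L (e x) (s x)" for x
    define O' where "O' = pts B \<inter> (\<lambda>x. x) -` U"
    have O: "openin (mtop B) O'" unfolding O'_def by (rule smooth_map_on_vimage[OF inc o(2) e(1)])
    have f: "smooth_fun_on B O' f" unfolding f_def
      by (rule fcoef_smooth[OF Bm O e(1,2) smooth_map_on_subset[OF inc]])
        (use sectionsD[OF H0D(1)[OF s]] in \<open>auto simp: O'_def intro: smooth_map_on_subset\<close>)
    have xO: "?x \<in> O'" using xB xU by (simp add: O'_def)
    define N where "N = pts ?B \<inter> \<Phi> -` O'"
    have N: "openin (mtop ?B) N" unfolding N_def by (rule smooth_map_on_vimage[OF fs o(1) O])
    have yN: "y \<in> N" using y xO by (simp add: N_def)
    have fN: "smooth_fun_on ?B N (\<lambda>z. f (\<Phi> z))"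
      by (rule smooth_fun_on_compose[OF B' Bm N smooth_map_on_subset[OF fs] _ f]) (auto simp: N_def)
    have fc: "fcoef L (e' z) (ps B s z) = f (\<Phi> z)" if z: "z \<in> N" for z
    proof -
      have zB: "z \<in> pts ?B" and \<Phi>z: "\<Phi> z \<in> U" using z by (auto simp: N_def O'_def)
      note sf = H0D(3)[OF s p(1)[OF zB]]
      have "ps B s z = lscale L (f (\<Phi> z)) (e' (\<Psi> (\<Phi> z)))"
        using val[OF zB] eq[OF fibreD(1)[OF sf]] fibreD(2)[OF sf] \<Phi>z by (simp add: frame_lift_def f_def)
      moreover have "\<Psi> (\<Phi> z) = z" by (rule \<Psi>\<Phi>[OF p(4)[OF zB]])
      moreover have "z \<in> \<Psi> ` U" using \<Phi>z calculation(2) by force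
      ultimately show ?thesis using fcoef_lscale[OF p(4)[OF zB] framesD(2,3)[OF e(3)]] by simp
    qed
    have d1: "tderiv ?B (\<lambda>z. fcoef L (e' z) (ps B s z)) y ?v = tderiv B f ?x ?u"
    proof -
      have "tderiv ?B (\<lambda>z. fcoef L (e' z) (ps B s z)) y ?v = tderiv ?B (\<lambda>z. f (\<Phi> z)) y ?v"
        by (rule tderiv_cong[OF B' N fN yN _ v, symmetric]) (simp add: fc)
      also have "\<dots> = tderiv B f ?x ?u"
        by (rule tderiv_compose[OF B' Bm o(1) fs y O f xO v])
      finally show ?thesis .
    qed
    have d2: "conn_form e' y (tangent_map ?B M (\<lambda>x. x) y ?v) = conn_form e ?x ?w"
      using e(4)[OF xU w] inc'(2)[OF y v] \<Psi>x by simp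
    define k where "k = tderiv B f ?x ?u + f ?x * conn_form e ?x ?w"
    have "leaf_connection M L nab B s ?x ?u = lscale L k (e ?x)"
      unfolding k_def f_def by (rule leaf_connection_eq[OF Bm inc H0D(1)[OF s] xB u e(1,2) xU])
    \<comment> \<open>Flatness of \<open>s\<close> is available for fields on all of
      \<open>B\<close>; the push-forward of \<open>Z\<close> is one, with value \<open>?u\<close> at
      \<open>?x\<close>.\<close>
    moreover have "leaf_connection M L nab B s ?x ?u = lzero L ?x"
      using H0D(4)[OF s pullback_leaf_field[OF Bm sub Z] xB] \<Psi>x by simp
    ultimately have "k = 0" using lscale_eq_lzero[OF xM framesD(2)[OF e(2) xU]] framesD(3)[OF e(2) xU] by metis
    then show ?thesis
      using leaf_connection_eq[OF B' inc'(1) sec y v V e(3) yV] d1 d2 fc[OF yN]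
        lscale_zero[OF yM framesD(2)[OF e(3) yV]] by (simp add: k_def)
  qed
  show ?thesis
    unfolding flat_sections_def using sec flat by (auto simp: pullback_section_def)
qed

lemma ps_zero:
  assumes B: "B \<in> leaves M P"
  shows "ps B (zero_section L B) = zero_section L (pl B)"
proof
  fix y
  show "ps B (zero_section L B) y = zero_section L (pl B) y"
  proof (cases "y \<in> pts (pl B)")
    case True
    note x = pl_pts(1)[OF B True]
    have "zero_section L B (\<Phi> y) = lzero L (\<Phi> y)" using x by (simp add: zero_section_def)
    then show ?thesis
      using ps_eq[OF B True, of "zero_section L B"] fibreD(1)[OF lzero_in[OF pl_pts(3)[OF B x]]]
        flat_lift_zero[OF \<Psi> G pl_pts(3)[OF B x]] \<Psi>\<Phi>[OF pl_pts(4)[OF B True]] True by (simp add: zero_section_def)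
  qed (simp add: pullback_section_def zero_section_def)
qed

lemma pl_leaves: "B \<in> leaves M P \<Longrightarrow> pl B \<in> leaves M P'"
  by (rule pullback_leaf_leaves[OF _ P])

lemma pl_back: "B \<in> leaves M P \<Longrightarrow> pullback_leaf M \<Psi> (pl B) = B"
  by (metis leafD pullback_leaf_back)

lemma distr_back: "leaves M (pullback_distr M \<Psi> P') = leaves M P"
  by (rule leaves_cong, rule pullback_distr_back[where P = P, OF _ P])

lemma BS_back: "BS M L nab (pullback_distr M \<Psi> P') = BS M L nab P"
  by (simp add: BS_def distr_back)

lemma ps_back:
  assumes B: "B \<in> leaves M P" and s: "s \<in> H0 M L nab B"
  shows "pullback_section M L \<Psi> G (pl B) (ps B s) = s"
proof
  interpret r: flat_lift_pair d M L nab \<omega> \<Psi> \<Phi> G F P' by (rule reversed)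
  note B' = pl_leaves[OF B]
  fix x
  show "pullback_section M L \<Psi> G (pl B) (ps B s) x = s x"
  proof (cases "x \<in> pts B")
    case True
    have \<Phi>\<Psi>x: "\<Phi> (\<Psi> x) = x" by (rule \<Phi>\<Psi>[OF pl_pts(3)[OF B True]])
    note y = pl_pts(2)[OF B True]
    note sx = fibreD(1)[OF H0D(3)[OF s True]]
    have v: "ps B s (\<Psi> x) = G (s x)" using ps_eq[OF B y] \<Phi>\<Psi>x sx by simp
    have "G (s x) \<in> pts (ltotal L)" using fibreD(1)[OF G_in[OF pl_pts(3)[OF B True] H0D(3)[OF s True]]] .
    then show ?thesis using r.ps_eq[OF B', of x "ps B s"] v True pl_back[OF B] FG[OF sx] by simp
  next
    \<comment> \<open>Off \<open>pts B\<close> the equality holds because sections in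
      \<open>H0\<close> are extensional.\<close>
    case False
    then show ?thesis
      using H0D(2)[OF s] pl_back[OF B] by (simp add: pullback_section_def extensional_def)
  qed
qed

text \<open>If the pulled back leaf carried only the zero section, transport back would leave only
  the zero section on \<open>B\<close>. As \<open>BS\<close> compares sets, the zero section must
  also be shown to belong to \<open>H0\<close> of \<open>B\<close>.\<close>

lemma pl_BS:
  assumes B: "B \<in> BS M L nab P"
  shows "pl B \<in> BS M L nab P'"
proof -
  interpret r: flat_lift_pair d M L nab \<omega> \<Psi> \<Phi> G F P' by (rule reversed)
  have Bl: "B \<in> leaves M P" and ne: "H0 M L nab B \<noteq> {zero_section L B}" using B by (auto simp: BS_def)
  note B' = pl_leaves[OF Bl]
  have "H0 M L nab (pl B) \<noteq> {zero_section L (pl B)}"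
  proof
    assume z: "H0 M L nab (pl B) = {zero_section L (pl B)}"
    have zr: "pullback_section M L \<Psi> G (pl B) (zero_section L (pl B)) = zero_section L B"
      using r.ps_zero[OF B'] pl_back[OF Bl] by simp
    then have "zero_section L B \<in> H0 M L nab B"
      using r.ps_H0[OF B', of "zero_section L (pl B)"] z pl_back[OF Bl] by simp
    moreover have "s = zero_section L B" if "s \<in> H0 M L nab B" for s
      using ps_back[OF Bl that] ps_H0[OF Bl that] z zr by simp
    ultimately show False using ne by blast
  qed
  then show ?thesis using B' by (simp add: BS_def)
qed

section \<open>The map between the direct sums\<close>

lemma BS_leaves: "B \<in> BS M L nab P \<Longrightarrow> B \<in> leaves M P"
  by (simp add: BS_def)

text \<open>An element of the target is indexed by leaves of the pulled back polarization; pulling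
  such a leaf back along \<open>\<Psi>\<close> names the source summand without any choice.\<close>

definition T :: "(('a, 'e) mfd \<Rightarrow> 'a \<Rightarrow> 'l) \<Rightarrow> ('a, 'e) mfd \<Rightarrow> 'a \<Rightarrow> 'l" where
  "T q = (\<lambda>B\<in>BS M L nab P'. ps (pullback_leaf M \<Psi> B) (q (pullback_leaf M \<Psi> B)))"

lemma
  assumes "B \<in> BS M L nab P'"
  shows lp_BS: "pullback_leaf M \<Psi> B \<in> BS M L nab P" and lp_back: "pl (pullback_leaf M \<Psi> B) = B"
proof -
  interpret r: flat_lift_pair d M L nab \<omega> \<Psi> \<Phi> G F P' by (rule reversed)
  show "pullback_leaf M \<Psi> B \<in> BS M L nab P" using r.pl_BS[OF assms] BS_back by simp
  show "pl (pullback_leaf M \<Psi> B) = B" by (rule r.pl_back[OF r.BS_leaves[OF assms]])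
qed

lemma T_pl: "B \<in> BS M L nab P \<Longrightarrow> T q (pl B) = ps B (q B)"
  by (simp add: T_def pl_BS pl_back[OF BS_leaves])

lemma T_Q:
  assumes q: "q \<in> Q_BS M L nab P"
  shows "T q \<in> Q_BS M L nab P'"
proof -
  have qB: "q B \<in> H0 M L nab B" if "B \<in> BS M L nab P" for B using q that by (auto simp: Q_BS_def PiE_def)
  have "T q \<in> (\<Pi>\<^sub>E B\<in>BS M L nab P'. H0 M L nab B)"
  proof (rule PiE_I)
    fix B assume B: "B \<in> BS M L nab P'"
    show "T q B \<in> H0 M L nab B"
      using ps_H0[OF BS_leaves[OF lp_BS[OF B]] qB[OF lp_BS[OF B]]] B lp_back[OF B] by (simp add: T_def)
  qed (simp add: T_def)
  \<comment> \<open>Transport preserves zero sections, so the support of \<open>T q\<close> lies in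
    the image under \<open>pl\<close> of the support of \<open>q\<close>.\<close>
  moreover have "finite {B \<in> BS M L nab P'. T q B \<noteq> zero_section L B}"
  proof (rule finite_subset)
    show "finite (pl ` {B \<in> BS M L nab P. q B \<noteq> zero_section L B})" using q by (simp add: Q_BS_def)
    show "{B \<in> BS M L nab P'. T q B \<noteq> zero_section L B} \<subseteq> pl ` {B \<in> BS M L nab P. q B \<noteq> zero_section L B}"
    proof
      fix B assume "B \<in> {B \<in> BS M L nab P'. T q B \<noteq> zero_section L B}"
      then have B: "B \<in> BS M L nab P'" and nz: "T q B \<noteq> zero_section L B" by auto
      let ?C = "pullback_leaf M \<Psi> B"
      note C = lp_BS[OF B] and e = lp_back[OF B]
      have "q ?C \<noteq> zero_section L ?C"
        using nz T_pl[OF C, of q] ps_zero[OF BS_leaves[OF C]] e by auto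
      then show "B \<in> pl ` {B \<in> BS M L nab P. q B \<noteq> zero_section L B}" using C e by force
    qed
  qed
  ultimately show ?thesis by (simp add: Q_BS_def)
qed

lemma T_back:
  assumes q: "q \<in> Q_BS M L nab P"
  shows "flat_lift_pair.T M L nab \<Psi> \<Phi> G P' (T q) = q"
proof
  interpret r: flat_lift_pair d M L nab \<omega> \<Psi> \<Phi> G F P' by (rule reversed)
  have qB: "q B \<in> H0 M L nab B" if "B \<in> BS M L nab P" for B using q that by (auto simp: Q_BS_def PiE_def)
  fix B
  show "r.T (T q) B = q B"
  proof (cases "B \<in> BS M L nab P")
    case True
    then show ?thesis using ps_back[OF BS_leaves[OF True] qB[OF True]]
      by (simp add: r.T_def BS_back T_pl)
  next
    case False
    then show ?thesis using q by (simp add: r.T_def BS_back Q_BS_def PiE_def extensional_def)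
  qed
qed

lemma T_bij: "bij_betw T (Q_BS M L nab P) (Q_BS M L nab P')"
proof -
  interpret r: flat_lift_pair d M L nab \<omega> \<Psi> \<Phi> G F P' by (rule reversed)
  \<comment> \<open>Reversing twice leads to the doubly pulled back distribution, which is known to
    agree with \<open>P\<close> only on \<open>pts M\<close>; hence \<open>Q_BS\<close> and
    \<open>T\<close> for it are identified with the original ones separately.\<close>
  interpret rr: flat_lift_pair d M L nab \<omega> \<Phi> \<Psi> F G "pullback_distr M \<Psi> P'" by (rule r.reversed)
  have Q: "Q_BS M L nab (pullback_distr M \<Psi> P') = Q_BS M L nab P" by (simp add: Q_BS_def BS_back)
  have BB: "BS M L nab (pullback_distr M \<Phi> (pullback_distr M \<Psi> P')) = BS M L nab P'"
    by (rule r.BS_back)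
  have TT: "rr.T = T" by (simp add: fun_eq_iff rr.T_def T_def BB)
  show ?thesis
    by (rule bij_betwI[of _ _ _ r.T])
      (use T_Q r.T_Q T_back r.T_back Q TT in auto)
qed

lemma T_linear:
  assumes q: "q \<in> Q_BS M L nab P" and q': "q' \<in> Q_BS M L nab P"
  shows "T (Q_add L (BS M L nab P) q q') = Q_add L (BS M L nab P') (T q) (T q')"
    and "T (Q_scale L (BS M L nab P) z q) = Q_scale L (BS M L nab P') z (T q)"
proof -
  have qB: "r B x \<in> fibre L x" if "r \<in> Q_BS M L nab P" "B \<in> BS M L nab P" "x \<in> pts B" for r B x
    using that H0D(3) by (auto simp: Q_BS_def PiE_def)
  have *: "T (Q_add L (BS M L nab P) q q') B y = Q_add L (BS M L nab P') (T q) (T q') B y \<and>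
      T (Q_scale L (BS M L nab P) z q) B y = Q_scale L (BS M L nab P') z (T q) B y" for B y
  \<comment> \<open>Outside these index sets both sides take the same default value of the
    restricted functions.\<close>
  proof (cases "B \<in> BS M L nab P' \<and> y \<in> pts B")
    case False
    then show ?thesis
      by (auto simp: T_def Q_add_def Q_scale_def pullback_section_def lp_back)
  next
    case True
    let ?C = "pullback_leaf M \<Psi> B"
    have C: "?C \<in> BS M L nab P" and e: "pl ?C = B" using lp_BS lp_back True by auto
    note Cl = BS_leaves[OF C]
    have y: "y \<in> pts (pl ?C)" using True e by simp
    note x = pl_pts(1)[OF Cl y]
    note xM = pl_pts(3)[OF Cl x]
    have f: "q ?C (\<Phi> y) \<in> fibre L (\<Phi> y)" "q' ?C (\<Phi> y) \<in> fibre L (\<Phi> y)" using qB q q' C x by auto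
    have v: "ps ?C r y = G (r (\<Phi> y))" if "r (\<Phi> y) \<in> fibre L (\<Phi> y)" for r
      by (rule ps_eq[where s = r, OF Cl y fibreD(1)[OF that]])
    show ?thesis
      using True C x f v ladd_in[OF xM f] lscale_in[OF xM f(1)] flat_lift_add[OF \<Psi> G xM f] flat_lift_scale[OF \<Psi> G xM f(1)]
      by (simp add: T_def Q_add_def Q_scale_def)
  qed
  then show "T (Q_add L (BS M L nab P) q q') = Q_add L (BS M L nab P') (T q) (T q')"
    "T (Q_scale L (BS M L nab P) z q) = Q_scale L (BS M L nab P') z (T q)" by (auto simp: fun_eq_iff)
qed

lemma T_incl:
  assumes B: "B \<in> BS M L nab P"
  shows "T (Q_incl L (BS M L nab P) B s) = Q_incl L (BS M L nab P') (pl B) (ps B s)"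
proof
  fix C
  show "T (Q_incl L (BS M L nab P) B s) C = Q_incl L (BS M L nab P') (pl B) (ps B s) C"
  proof (cases "C \<in> BS M L nab P'")
    case C: True
    have "pullback_leaf M \<Psi> C = B \<longleftrightarrow> C = pl B" using lp_back[OF C] pl_back[OF BS_leaves[OF B]] by auto
    then show ?thesis
      using C lp_BS[OF C] ps_zero[OF BS_leaves[OF lp_BS[OF C]]] lp_back[OF C] by (auto simp: T_def Q_incl_def)
  qed (simp add: T_def Q_incl_def)
qed

lemma T_isomorphism: "Q_isomorphism M L nab P P' T"
  unfolding Q_isomorphism_def using T_bij T_linear by blast

end

theorem theorem2:
  fixes M :: "('m, 'e::euclidean_space) mfd"
    and \<omega> :: "('m, 'e) form2"
    and P :: "('m, 'e) distr"
    and \<Phi> :: "'m \<Rightarrow> 'm"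
    and L :: "('m, 'l, 'e) line_bundle"
    and nab :: "('m, 'l, 'e) connection"
    and d :: nat
  assumes "symplectic_manifold d M \<omega>"
    and "polarization M \<omega> P"
    and "symplectomorphism M \<omega> \<Phi>"
    and "prequantum_line_bundle d M \<omega> L nab"
    and "cech_H1 (mtop M) (locally_constant_units (mtop M)) =
         {cech_trivial_class (mtop M) (locally_constant_units (mtop M))}"
  shows "\<exists>F. is_lift M L \<Phi> F \<and>
           connection_eq M L (pullback_connection M L \<Phi> F nab) nab \<and>
           (\<exists>T. Q_isomorphism M L nab P (pullback_distr M \<Phi> P) T \<and>
              (\<forall>B\<in>BS M L nab P.
                 pullback_leaf M \<Phi> B \<in> BS M L nab (pullback_distr M \<Phi> P) \<and>
                 (\<forall>s\<in>H0 M L nab B.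
                    T (Q_incl L (BS M L nab P) B s) =
                    Q_incl L (BS M L nab (pullback_distr M \<Phi> P)) (pullback_leaf M \<Phi> B)
                      (pullback_section M L \<Phi> F B s))))"
proof -
  have M: "smooth_manifold d M" using assms(1) by (simp add: symplectic_manifold_def)
  have \<Phi>: "diffeomorphism M M \<Phi>" and sym: "\<And>x v w. x \<in> pts M \<Longrightarrow> v \<in> tangent_space M x \<Longrightarrow> w \<in> tangent_space M x \<Longrightarrow>
      \<omega> (\<Phi> x) (tangent_map M M \<Phi> x v) (tangent_map M M \<Phi> x w) = \<omega> x v w"
    using assms(3) by (auto simp: symplectomorphism_def)
  interpret prequantum d M L nab \<omega>
    using M assms(4) by unfold_locales (auto simp: prequantum_line_bundle_def)
  obtain F where F: "locally_flat_lift \<Phi> F" using locally_flat_lift_exists[OF \<Phi> sym assms(5)] by blast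
  \<comment> \<open>The actual inverses, formed by \<open>inv_on\<close>, instantiate the second
    half of the symmetric locale; \<open>flat_lift_inverse\<close> makes the inverse of
    \<open>F\<close> locally flat.\<close>
  interpret flat_lift_pair d M L nab \<omega> \<Phi> "inv_on M \<Phi>" F "inv_on (ltotal L) F" P
  proof unfold_locales
    show "P x \<subseteq> tangent_space M x" if "x \<in> pts M" for x
      using assms(2) that by (simp add: polarization_def singular_subbundle_def)
  qed (rule M \<Phi> diffeomorphism_inv[OF M M \<Phi>] diffeo_inv1[OF \<Phi>] diffeo_inv2[OF \<Phi>] F
      flat_lift_inverse[OF \<Phi> F] flat_lift_inv_eq(1)[OF \<Phi> F] flat_lift_inv_eq(2)[OF \<Phi> F]; assumption?)+
  show ?thesis
    using flat_lift_is_lift[OF \<Phi> F] flat_lift_connection_eq[OF \<Phi> F] T_isomorphism pl_BS T_incl by blast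
qed

end
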